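(* Let $X$ be a separable (real) Banach space with $\dim(X)\ge 2$ and let $T\in\mathbf M_1(X)$ be a one-dimensional metric current. Then, for any given $\varepsilon>0$, there exist a cycle $C\in\mathbf M_1(X)$ and a Borel set $B\subset X$ such that, writing $R:=C-T$: 1. $\partial C=0$; 2. $\operatorname{spt} C\subset \operatorname{conv}\{x:\operatorname{dist}_X(x,\operatorname{spt}\|\partial T\|)\le\varepsilon\}$; 3. $\|T\|$ and $\|R\|$ are mutually singular; in particular, $T=C\llcorner B$ and $R=C\llcorner B^c$, where $B^c=X\setminus B$; 4. $\mathbf M(C)\le\mathbf M(T)+\|\partial T\|_{\mathrm{KR}}+\varepsilon$.
   Context: Let $X$ be a metric space. $\mathrm{Lip}(X)$ is the space of real-valued Lipschitz functions on $X$, $\mathrm{Lip}(f)$ is the Lipschitz constant, $\mathrm{Lip}_b(X)$ the bounded ones, $\mathrm{Lip}_1(X)$ those with Lipschitz constant at most $1$. A metric $1$-current on $X$ is a bilinear functional $T:\mathrm{Lip}_b(X)\times \mathrm{Lip}(X)\to\mathbb R$ such that: (i) (finite mass) there is a finite Borel measure $\mu$ on $X$ with $|T(f,\pi)|\le \mathrm{Lip}(\pi)\int_X |f|\,d\mu$ for all $(f,\pi)$; the minimal such measure is the mass measure $\|T\|$, and $\mathbf M(T):=\|T\|(X)$; (ii) (continuity) if $\pi_j\to\pi$ pointwise on $X$ and $\sup_j\mathrm{Lip}(\pi_j)<\infty$, then $T(f,\pi_j)\to T(f,\pi)$; (iii) (locality) $T(f,\pi)=0$ whenever $\pi$ is constant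 on a neighborhood of the support of $f$. The space of metric $1$-currents is $\mathbf M_1(X)$. Every $T\in\mathbf M_1(X)$ extends uniquely and continuously to $L^1(\|T\|)\times\mathrm{Lip}(X)$, and for a Borel set $E$ the restriction is $(T\llcorner E)(f,\pi):=T(\mathbf 1_Ef,\pi)$. The boundary is $\partial T(f):=T(1,f)$, $f\in\mathrm{Lip}(X)$; a cycle is a current with zero boundary; and $\|\partial T\|_{\mathrm{KR}}:=\sup\{\partial T(f):f\in\mathrm{Lip}_1(X)\}$. $\operatorname{spt}C$ denotes the support of the measure $\|C\|$. $\operatorname{spt}\|\partial T\|$ denotes the support of the boundary $\partial T$, i.e. the set of points $x$ such that every neighborhood of $x$ contains the support of some $f\in\mathrm{Lip}(X)$ with $\partial T(f)\neq0$ (when $\partial T$ has finite mass, this is the support of its mass measure $\|\partial T\|$). $\operatorname{dist}_X$ is the distance in $X$ and $\operatorname{conv}$ the convex hull.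
   Formalization: Item 2 as printed fails (T a segment plus a far-away loop in the plane: item 3 forces spt T ⊂ spt C); it is replaced by: spt R lies in conv{x : dist(x, spt‖∂T‖) ≤ ε}, and spt C lies in it whenever spt T does. *)

theory Defs
  imports "HOL-Analysis.Analysis"
begin

definition Lip :: "('a::metric_space \<Rightarrow> real) set" where
  "Lip = {f. \<exists>L. L-lipschitz_on UNIV f}"

definition Lip_bdd :: "('a::metric_space \<Rightarrow> real) set" where
  "Lip_bdd = {f \<in> Lip. bounded (range f)}"

definition lip_const :: "('a::metric_space \<Rightarrow> real) \<Rightarrow> real" where
  "lip_const f = Inf {L. L-lipschitz_on UNIV f}"

definition fun_spt :: "('a::topological_space \<Rightarrow> real) \<Rightarrow> 'a set" where
  "fun_spt f = closure {x. f x \<noteq> 0}"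

text \<open>
  A functional on \<open>Lip_bdd \<times> Lip\<close> is represented by a total function of two arguments.
  Its values outside \<open>Lip_bdd \<times> Lip\<close> carry no meaning, and no definition below depends on
  them; equality of currents is \<open>current_eq\<close>.
\<close>

type_synonym 'a functional = "('a \<Rightarrow> real) \<Rightarrow> ('a \<Rightarrow> real) \<Rightarrow> real"

definition current_eq :: "'a::metric_space functional \<Rightarrow> 'a functional \<Rightarrow> bool" where
  "current_eq S T \<longleftrightarrow> (\<forall>f\<in>Lip_bdd. \<forall>p\<in>Lip. S f p = T f p)"

definition bilinear_functional :: "'a::metric_space functional \<Rightarrow> bool" where
  "bilinear_functional T \<longleftrightarrow>
     (\<forall>f\<in>Lip_bdd. \<forall>g\<in>Lip_bdd. \<forall>p\<in>Lip. \<forall>a b.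
        T (\<lambda>x. a * f x + b * g x) p = a * T f p + b * T g p) \<and>
     (\<forall>f\<in>Lip_bdd. \<forall>p\<in>Lip. \<forall>q\<in>Lip. \<forall>a b.
        T f (\<lambda>x. a * p x + b * q x) = a * T f p + b * T f q)"

definition mass_bound :: "'a::metric_space functional \<Rightarrow> 'a measure \<Rightarrow> bool" where
  "mass_bound T \<mu> \<longleftrightarrow>
     sets \<mu> = sets borel \<and> finite_measure \<mu> \<and>
     (\<forall>f\<in>Lip_bdd. \<forall>p\<in>Lip. \<bar>T f p\<bar> \<le> lip_const p * (\<integral>x. \<bar>f x\<bar> \<partial>\<mu>))"

definition metric_current :: "'a::metric_space functional \<Rightarrow> bool" where
  "metric_current T \<longleftrightarrow>
     bilinear_functional T \<and>
     (\<exists>\<mu>. mass_bound T \<mu>) \<and>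
     (\<forall>f\<in>Lip_bdd. \<forall>P. \<forall>p\<in>Lip.
        (\<forall>j::nat. P j \<in> Lip) \<longrightarrow> bdd_above (range (\<lambda>j. lip_const (P j))) \<longrightarrow>
        (\<forall>x. (\<lambda>j. P j x) \<longlonglongrightarrow> p x) \<longrightarrow> (\<lambda>j. T f (P j)) \<longlonglongrightarrow> T f p) \<and>
     (\<forall>f\<in>Lip_bdd. \<forall>p\<in>Lip.
        (\<exists>U c. open U \<and> fun_spt f \<subseteq> U \<and> (\<forall>x\<in>U. p x = c)) \<longrightarrow> T f p = 0)"

text \<open>
  Minimality is setwise: the order \<open>\<le>\<close> on \<^typ>\<open>'a measure\<close> also compares spaces and
  \<open>\<sigma>\<close>-algebras, so it is spelled out.
\<close>

definition is_mass_measure :: "'a::metric_space functional \<Rightarrow> 'a measure \<Rightarrow> bool" where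
  "is_mass_measure T \<mu> \<longleftrightarrow>
     mass_bound T \<mu> \<and>
     (\<forall>\<nu>. mass_bound T \<nu> \<longrightarrow> (\<forall>A\<in>sets borel. emeasure \<mu> A \<le> emeasure \<nu> A))"

definition mass_measure :: "'a::metric_space functional \<Rightarrow> 'a measure" where
  "mass_measure T = (THE \<mu>. is_mass_measure T \<mu>)"

definition mass :: "'a::metric_space functional \<Rightarrow> real" where
  "mass T = measure (mass_measure T) UNIV"

text \<open>
  The value at \<open>(f, p)\<close> of the continuous extension of \<open>T\<close> to \<open>L\<^sup>1 \<times> Lip\<close>, where \<open>L\<^sup>1\<close> is taken
  with respect to the mass measure: the common limit of \<open>T (F n) p\<close> along all sequences \<open>F\<close>
  in \<open>Lip_bdd\<close> converging to \<open>f\<close> in \<open>L\<^sup>1\<close>. It is meant for integrable \<open>f\<close> only.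
\<close>

definition current_ext :: "'a::metric_space functional \<Rightarrow> 'a functional" where
  "current_ext T f p =
     (THE l. \<forall>F. (\<forall>n::nat. F n \<in> Lip_bdd) \<longrightarrow>
        (\<lambda>n. \<integral>x. \<bar>F n x - f x\<bar> \<partial>mass_measure T) \<longlonglongrightarrow> 0 \<longrightarrow>
        (\<lambda>n. T (F n) p) \<longlonglongrightarrow> l)"

definition current_restrict :: "'a::metric_space functional \<Rightarrow> 'a set \<Rightarrow> 'a functional" where
  "current_restrict T E = (\<lambda>f p. current_ext T (\<lambda>x. indicator E x * f x) p)"

definition current_boundary :: "'a::metric_space functional \<Rightarrow> ('a \<Rightarrow> real) \<Rightarrow> real" where
  "current_boundary T f = T (\<lambda>_. 1) f"

definition is_cycle :: "'a::metric_space functional \<Rightarrow> bool" where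
  "is_cycle T \<longleftrightarrow> (\<forall>f\<in>Lip. current_boundary T f = 0)"

definition KR_norm :: "(('a::metric_space \<Rightarrow> real) \<Rightarrow> real) \<Rightarrow> real" where
  "KR_norm D = (SUP f\<in>{f \<in> Lip. lip_const f \<le> 1}. D f)"

definition measure_spt :: "'a::topological_space measure \<Rightarrow> 'a set" where
  "measure_spt \<mu> = {x. \<forall>U. open U \<and> x \<in> U \<longrightarrow> emeasure \<mu> U > 0}"

definition current_spt :: "'a::metric_space functional \<Rightarrow> 'a set" where
  "current_spt T = measure_spt (mass_measure T)"

definition boundary_spt :: "'a::metric_space functional \<Rightarrow> 'a set" where
  "boundary_spt T =
     {x. \<forall>U. open U \<and> x \<in> U \<longrightarrow>
           (\<exists>f\<in>Lip. fun_spt f \<subseteq> U \<and> current_boundary T f \<noteq> 0)}"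

definition mutually_singular :: "'a::topological_space measure \<Rightarrow> 'a measure \<Rightarrow> bool" where
  "mutually_singular \<mu> \<nu> \<longleftrightarrow> (\<exists>A\<in>sets borel. emeasure \<mu> A = 0 \<and> emeasure \<nu> (- A) = 0)"

text \<open>
  The distance to the empty set is \<open>\<infinity>\<close>, so its neighbourhoods are empty; \<^const>\<open>infdist\<close>
  would give \<open>0\<close>.
\<close>

definition closed_nbhd :: "'a::metric_space set \<Rightarrow> real \<Rightarrow> 'a set" where
  "closed_nbhd S e = {x. S \<noteq> {} \<and> infdist x S \<le> e}"

text \<open>
  Let \<open>C\<close> be a cycle with \<open>T = C \<llcorner> B\<close> and \<open>R = C - T\<close>, and let \<open>K\<close> be the convex hull of a
  neighbourhood of the support of \<open>\<partial>T\<close>. Then \<open>spt T \<subseteq> spt C\<close>, while \<open>\<partial>T\<close> gives no control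
  on \<open>spt T\<close> (add to \<open>T\<close> a closed loop far away). So \<open>spt C \<subseteq> K\<close> can hold only if
  \<open>spt T \<subseteq> K\<close>; what holds in general is that the part \<open>R\<close> added to \<open>T\<close> is supported in \<open>K\<close>.
\<close>

end

theory Submission
  imports Defs "HOL-Library.Diagonal_Subsequence"
begin

text \<open>
  It suffices to find a current \<open>R\<close> with \<open>\<partial>R = - \<partial>T\<close> and \<open>M(R) \<le> \<parallel>\<partial>T\<parallel>\<^sub>K\<^sub>R + \<epsilon>\<close> that is carried
  by a \<open>\<parallel>T\<parallel>\<close>-null set and supported in the hull, and to put \<open>C = T + R\<close>.

  The boundary of \<open>T\<close> annihilates the Lipschitz functions that are constant near its support: \<open>T\<close> has
  finite mass, so cutting off at scale \<open>r\<close> around a finite net costs little once the net is chosen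
  after \<open>r\<close>; iterating with \<open>r \<rightarrow> 0\<close> leaves a function whose support is almost compact, and on a
  compact set finitely many neighbourhoods on which \<open>\<partial>T\<close> vanishes suffice. Since \<open>\<partial>T\<close> is moreover
  continuous under pointwise convergence with bounded Lipschitz constants, Hahn-Banach writes it as a
  series of dipoles \<open>a (\<delta>\<^sub>x - \<delta>\<^sub>y)\<close> with \<open>x\<close>, \<open>y\<close> near the support and
  \<open>\<Sum>\<bar>a\<bar> dist x y \<le> \<parallel>\<partial>T\<parallel>\<^sub>K\<^sub>R + \<epsilon>\<close>. Each dipole is filled by a slightly bent segment from one
  point to the other; in dimension at least two uncountably many bends are available, which are
  disjoint up to end points, so one of them is not charged by \<open>\<parallel>T\<parallel>\<close>.
\<close>

subsection \<open>Lipschitz functions and currents\<close>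

text \<open>Two obstacles besides the construction of \<open>R\<close> shape the development.
  \<open>mass_measure\<close> is a definite description, so supports, singularity and restrictions
  can only be discussed once a smallest mass bound is known to exist; this is proved for complete
  separable spaces, where finite Borel measures are inner regular. And \<partial>T may have infinite
  mass, so it cannot be treated as a measure whose positive part is transported to its negative
  part; the dipoles come from duality for a continuous functional on Lipschitz functions instead.

  The hull in the conclusion need not be closed, whereas limits of fillings only stay in closed
  sets. The margin \<epsilon> is therefore split: the dipoles have their ends within
  \<open>\<epsilon> / 2\<close> of the support, bending and closing up take a further
  \<open>\<epsilon> / 4\<close>, and the closed set so obtained still lies in the hull of the
  \<epsilon>-neighbourhood.\<close>

lemma LipI: "L-lipschitz_on UNIV f \<Longrightarrow> f \<in> Lip"
  by (auto simp: Lip_def)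

lemma Lip_bddI: "L-lipschitz_on UNIV f \<Longrightarrow> (\<And>x. \<bar>f x\<bar> \<le> B) \<Longrightarrow> f \<in> Lip_bdd"
  by (auto simp: Lip_bdd_def bounded_iff intro: LipI)

lemma Lip_bdd_Lip: "f \<in> Lip_bdd \<Longrightarrow> f \<in> Lip"
  by (simp add: Lip_bdd_def)

lemma Lip_bddE:
  assumes "f \<in> Lip_bdd"
  obtains B where "B > 0" "\<And>x. \<bar>f x\<bar> \<le> B"
  using assms unfolding Lip_bdd_def bounded_pos by auto

lemma lip_const_le: "L-lipschitz_on UNIV f \<Longrightarrow> lip_const f \<le> L"
  unfolding lip_const_def
  by (rule cInf_lower) (auto intro!: bdd_belowI[of _ 0] lipschitz_on_nonneg)

text \<open>For fixed distinct points every admissible constant is at least the difference quotient,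
  hence so is the infimum, which is therefore admissible itself.\<close>

lemma lip_const_lipschitz:
  fixes f :: "'a::metric_space \<Rightarrow> real"
  assumes "f \<in> Lip"
  shows "(lip_const f)-lipschitz_on UNIV f"
proof (rule lipschitz_onI)
  have ne: "{L. L-lipschitz_on UNIV f} \<noteq> {}"
    using assms by (auto simp: Lip_def)
  show "0 \<le> lip_const f"
    unfolding lip_const_def using ne by (rule cInf_greatest) (auto intro: lipschitz_on_nonneg)
  fix x y
  show "dist (f x) (f y) \<le> lip_const f * dist x y"
  proof (cases "x = y")
    case False
    have "dist (f x) (f y) / dist x y \<le> lip_const f"
      unfolding lip_const_def using ne
    proof (rule cInf_greatest)
      fix L assume "L \<in> {L. L-lipschitz_on UNIV f}"
      then have "dist (f x) (f y) \<le> L * dist x y"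
        by (auto simp: lipschitz_on_def)
      then show "dist (f x) (f y) / dist x y \<le> L"
        using False by (simp add: divide_le_eq)
    qed
    then show ?thesis
      using False by (simp add: divide_le_eq)
  qed simp
qed

lemma lip_const_nonneg: "f \<in> Lip \<Longrightarrow> 0 \<le> lip_const f"
  by (rule lipschitz_on_nonneg[OF lip_const_lipschitz])

lemma Lip_const [simp]: "(\<lambda>_. c) \<in> Lip"
  by (rule LipI[OF lipschitz_on_constant])

lemma Lip_bdd_const [simp]: "(\<lambda>_. c) \<in> Lip_bdd"
  by (rule Lip_bddI[OF lipschitz_on_constant, of _ "\<bar>c\<bar>"]) auto

lemma lipschitz_lincomb:
  fixes f g :: "'a::metric_space \<Rightarrow> real"
  assumes "L-lipschitz_on UNIV f" "M-lipschitz_on UNIV g"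
  shows "(\<bar>a\<bar> * L + \<bar>b\<bar> * M)-lipschitz_on UNIV (\<lambda>x. a * f x + b * g x)"
  using assms by (intro lipschitz_on_add lipschitz_on_cmult_real)

lemma Lip_lincomb: "f \<in> Lip \<Longrightarrow> g \<in> Lip \<Longrightarrow> (\<lambda>x. a * f x + b * g x) \<in> Lip"
  by (rule LipI[OF lipschitz_lincomb[OF lip_const_lipschitz lip_const_lipschitz]])

lemma Lip_diff: "f \<in> Lip \<Longrightarrow> g \<in> Lip \<Longrightarrow> (\<lambda>x. f x - g x) \<in> Lip"
  using Lip_lincomb[of f g 1 "-1"] by simp

lemma lipschitz_diff:
  fixes f g :: "'a::metric_space \<Rightarrow> real"
  shows "L-lipschitz_on UNIV f \<Longrightarrow> M-lipschitz_on UNIV g \<Longrightarrow> (L + M)-lipschitz_on UNIV (\<lambda>x. f x - g x)"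
  using lipschitz_lincomb[of L f M g 1 "-1"] by simp

lemma lipschitz_mult:
  fixes f g :: "'a::metric_space \<Rightarrow> real"
  assumes f: "L-lipschitz_on UNIV f" and g: "M-lipschitz_on UNIV g"
    and bf: "\<And>x. \<bar>f x\<bar> \<le> A" and bg: "\<And>x. \<bar>g x\<bar> \<le> B"
  shows "(A * M + B * L)-lipschitz_on UNIV (\<lambda>x. f x * g x)"
proof (rule lipschitz_onI)
  \<comment> \<open>\<open>undefined\<close> merely names a point; a bound for an absolute value is
    nonnegative.\<close>
  have AB: "0 \<le> A" "0 \<le> B"
    using bf[of undefined] bg[of undefined] by auto
  show "0 \<le> A * M + B * L"
    using AB lipschitz_on_nonneg[OF f] lipschitz_on_nonneg[OF g] by simp
  fix x y
  have "\<bar>f x * g x - f y * g y\<bar> = \<bar>f x * (g x - g y) + g y * (f x - f y)\<bar>"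
    by (simp add: algebra_simps)
  also have "\<dots> \<le> \<bar>f x\<bar> * \<bar>g x - g y\<bar> + \<bar>g y\<bar> * \<bar>f x - f y\<bar>"
    by (metis abs_mult abs_triangle_ineq)
  also have "\<dots> \<le> A * (M * dist x y) + B * (L * dist x y)"
    using lipschitz_onD[OF f, of x y] lipschitz_onD[OF g, of x y] bf[of x] bg[of y] AB
    by (intro add_mono mult_mono) (auto simp: dist_real_def)
  finally show "dist (f x * g x) (f y * g y) \<le> (A * M + B * L) * dist x y"
    by (simp add: dist_real_def algebra_simps)
qed

lemma Lip_bdd_mult:
  assumes "f \<in> Lip_bdd" "g \<in> Lip_bdd"
  shows "(\<lambda>x. f x * g x) \<in> Lip_bdd"
proof -
  obtain A where A: "\<And>x. \<bar>f x\<bar> \<le> A" using Lip_bddE[OF assms(1)] by metis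
  obtain B where B: "\<And>x. \<bar>g x\<bar> \<le> B" using Lip_bddE[OF assms(2)] by metis
  have "\<bar>f x * g x\<bar> \<le> A * B" for x
    unfolding abs_mult using A[of x] B[of x] by (intro mult_mono) auto
  with lipschitz_mult[OF lip_const_lipschitz[OF Lip_bdd_Lip[OF assms(1)]]
      lip_const_lipschitz[OF Lip_bdd_Lip[OF assms(2)]] A B]
  show ?thesis by (rule Lip_bddI)
qed

lemma Lip_bdd_lincomb:
  assumes "f \<in> Lip_bdd" "g \<in> Lip_bdd"
  shows "(\<lambda>x. a * f x + b * g x) \<in> Lip_bdd"
proof -
  obtain A where A: "\<And>x. \<bar>f x\<bar> \<le> A" using Lip_bddE[OF assms(1)] by metis
  obtain B where B: "\<And>x. \<bar>g x\<bar> \<le> B" using Lip_bddE[OF assms(2)] by metis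
  have "\<bar>a * f x + b * g x\<bar> \<le> \<bar>a\<bar> * A + \<bar>b\<bar> * B" for x
    using A[of x] B[of x]
    by (intro order.trans[OF abs_triangle_ineq] add_mono) (auto simp: abs_mult intro: mult_left_mono)
  with lipschitz_lincomb[OF lip_const_lipschitz[OF Lip_bdd_Lip[OF assms(1)]]
      lip_const_lipschitz[OF Lip_bdd_Lip[OF assms(2)]]]
  show ?thesis by (rule Lip_bddI)
qed

lemma Lip_bdd_diff: "f \<in> Lip_bdd \<Longrightarrow> g \<in> Lip_bdd \<Longrightarrow> (\<lambda>x. f x - g x) \<in> Lip_bdd"
  using Lip_bdd_lincomb[of f g 1 "-1"] by simp

text \<open>The cut-off functions below have the form \<open>clamp01 (a + b * infdist x F)\<close>:
  their Lipschitz constant is at most \<open>\<bar>b\<bar>\<close>, whatever the set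
  \<open>F\<close>.\<close>

definition clamp01 :: "real \<Rightarrow> real" where
  "clamp01 t = max 0 (min 1 t)"

lemma clamp01_bounds [simp]: "0 \<le> clamp01 t" "clamp01 t \<le> 1"
  by (auto simp: clamp01_def)

lemma clamp01_eq_1: "1 \<le> t \<Longrightarrow> clamp01 t = 1"
  and clamp01_eq_0: "t \<le> 0 \<Longrightarrow> clamp01 t = 0"
  by (auto simp: clamp01_def)

lemma lipschitz_infdist: "1-lipschitz_on UNIV (\<lambda>x. infdist x A)"
  by (rule lipschitz_onI) (auto simp: dist_real_def infdist_triangle_abs)

lemma lipschitz_clamp01:
  fixes g :: "'a::metric_space \<Rightarrow> real"
  assumes "L-lipschitz_on UNIV g"
  shows "L-lipschitz_on UNIV (\<lambda>x. clamp01 (g x))"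
proof (rule lipschitz_onI)
  fix x y
  have "dist (clamp01 (g x)) (clamp01 (g y)) \<le> dist (g x) (g y)"
    by (auto simp: clamp01_def dist_real_def)
  also have "\<dots> \<le> L * dist x y"
    using lipschitz_onD[OF assms] by simp
  finally show "dist (clamp01 (g x)) (clamp01 (g y)) \<le> L * dist x y" .
qed (rule lipschitz_on_nonneg[OF assms])

lemma lipschitz_clamp01_affine:
  fixes g :: "'a::metric_space \<Rightarrow> real"
  assumes "1-lipschitz_on UNIV g"
  shows "\<bar>b\<bar>-lipschitz_on UNIV (\<lambda>x. clamp01 (a + b * g x))"
  using lipschitz_lincomb[OF lipschitz_on_constant[of UNIV 1] assms, of a b]
  by (intro lipschitz_clamp01) simp

lemma Lip_continuous_on: "f \<in> Lip \<Longrightarrow> continuous_on S f"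
  by (rule lipschitz_on_continuous_on[OF lipschitz_on_subset[OF lip_const_lipschitz]]) auto

lemma Lip_measurable:
  assumes "f \<in> Lip" "sets \<mu> = sets borel"
  shows "f \<in> borel_measurable \<mu>"
  using borel_measurable_continuous_onI[OF Lip_continuous_on[OF assms(1)]] assms(2)
  by (simp cong: measurable_cong_sets)

lemma Lip_bdd_integrable:
  fixes f :: "'a::metric_space \<Rightarrow> real"
  assumes "f \<in> Lip_bdd" "finite_measure \<mu>" "sets \<mu> = sets borel"
  shows "integrable \<mu> f"
proof -
  obtain B where "\<And>x. \<bar>f x\<bar> \<le> B" using Lip_bddE[OF assms(1)] by metis
  then show ?thesis
    using Lip_measurable[OF Lip_bdd_Lip[OF assms(1)] assms(3)]
    by (intro finite_measure.integrable_const_bound[OF assms(2), of _ B]) auto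
qed

section \<open>Working forms of the axioms of a current\<close>

lemma mass_boundD:
  assumes "mass_bound T \<mu>" "f \<in> Lip_bdd" "L-lipschitz_on UNIV p"
  shows "\<bar>T f p\<bar> \<le> L * (\<integral>x. \<bar>f x\<bar> \<partial>\<mu>)"
proof -
  have "\<bar>T f p\<bar> \<le> lip_const p * (\<integral>x. \<bar>f x\<bar> \<partial>\<mu>)"
    using assms(1,2) LipI[OF assms(3)] by (auto simp: mass_bound_def)
  also have "\<dots> \<le> L * (\<integral>x. \<bar>f x\<bar> \<partial>\<mu>)"
    by (intro mult_right_mono lip_const_le assms integral_nonneg_AE) auto
  finally show ?thesis .
qed

lemma mass_boundD_sets: "mass_bound T \<mu> \<Longrightarrow> sets \<mu> = sets borel"
  and mass_boundD_finite: "mass_bound T \<mu> \<Longrightarrow> finite_measure \<mu>"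
  by (auto simp: mass_bound_def)

lemma mass_boundI:
  assumes "sets \<mu> = sets borel" "finite_measure \<mu>"
    and "\<And>f p L. f \<in> Lip_bdd \<Longrightarrow> L-lipschitz_on UNIV p \<Longrightarrow> \<bar>T f p\<bar> \<le> L * (\<integral>x. \<bar>f x\<bar> \<partial>\<mu>)"
  shows "mass_bound T \<mu>"
  using assms(1,2) assms(3)[OF _ lip_const_lipschitz] by (auto simp: mass_bound_def)

text \<open>Continuity only has to be checked with one constant common to the sequence and its
  limit: the maximum of the bound for the sequence and \<open>lip_const p\<close> serves for
  both.\<close>

lemma metric_currentI:
  fixes T :: "'a::metric_space functional"
  assumes "bilinear_functional T" "mass_bound T \<mu>"
    and cont: "\<And>(f :: 'a \<Rightarrow> real) (P :: nat \<Rightarrow> 'a \<Rightarrow> real) (p :: 'a \<Rightarrow> real) L. f \<in> Lip_bdd \<Longrightarrow> (\<And>j. L-lipschitz_on UNIV (P j)) \<Longrightarrow>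
      L-lipschitz_on UNIV p \<Longrightarrow> (\<And>x. (\<lambda>j. P j x) \<longlonglongrightarrow> p x) \<Longrightarrow> (\<lambda>j. T f (P j)) \<longlonglongrightarrow> T f p"
    and loc: "\<And>(f :: 'a \<Rightarrow> real) (p :: 'a \<Rightarrow> real) U c. f \<in> Lip_bdd \<Longrightarrow> p \<in> Lip \<Longrightarrow> open U \<Longrightarrow> fun_spt f \<subseteq> U \<Longrightarrow>
      (\<And>x. x \<in> U \<Longrightarrow> p x = c) \<Longrightarrow> T f p = 0"
  shows "metric_current T"
  unfolding metric_current_def
proof (intro conjI ballI allI impI)
  fix f p :: "'a \<Rightarrow> real" and P :: "nat \<Rightarrow> 'a \<Rightarrow> real"
  assume f: "f \<in> Lip_bdd" and p: "p \<in> Lip" and P: "\<forall>j::nat. P j \<in> Lip"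
    and bd: "bdd_above (range (\<lambda>j. lip_const (P j)))" and lim: "\<forall>x. (\<lambda>j. P j x) \<longlonglongrightarrow> p x"
  from bd obtain M where M: "\<And>j. lip_const (P j) \<le> M"
    by (auto simp: bdd_above_def)
  show "(\<lambda>j. T f (P j)) \<longlonglongrightarrow> T f p"
  proof (rule cont[OF f])
    show "(max M (lip_const p))-lipschitz_on UNIV (P j)" for j
      using M[of j] by (intro lipschitz_on_le[OF lip_const_lipschitz[OF P[rule_format, of j]]]) simp
    show "(max M (lip_const p))-lipschitz_on UNIV p"
      by (rule lipschitz_on_le[OF lip_const_lipschitz[OF p]]) simp
  qed (use lim in auto)
next
  fix f p :: "'a \<Rightarrow> real"
  assume f: "f \<in> Lip_bdd" and p: "p \<in> Lip" and "\<exists>U c. open U \<and> fun_spt f \<subseteq> U \<and> (\<forall>x\<in>U. p x = c)"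
  then obtain U c where "open U" "fun_spt f \<subseteq> U" "\<And>x. x \<in> U \<Longrightarrow> p x = c" by blast
  then show "T f p = 0" by (rule loc[OF f p])
qed (use assms(1,2) in auto)

lemma current_mass_bound: "metric_current T \<Longrightarrow> \<exists>\<mu>. mass_bound T \<mu>"
  by (simp add: metric_current_def)

lemma current_continuous:
  fixes T :: "'a::metric_space functional"
  assumes "metric_current T" "f \<in> Lip_bdd" "\<And>j::nat. L-lipschitz_on UNIV (P j)"
    "p \<in> Lip" "\<And>x. (\<lambda>j. P j x) \<longlonglongrightarrow> p x"
  shows "(\<lambda>j. T f (P j)) \<longlonglongrightarrow> T f p"
proof -
  have "bdd_above (range (\<lambda>j. lip_const (P j)))"
    by (rule bdd_aboveI2[where M = L]) (rule lip_const_le[OF assms(3)])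
  moreover have "\<forall>j. P j \<in> Lip" "\<forall>x. (\<lambda>j. P j x) \<longlonglongrightarrow> p x"
    using LipI[OF assms(3)] assms(5) by blast+
  ultimately show ?thesis
    using assms(1)[unfolded metric_current_def, THEN conjunct2, THEN conjunct2, THEN conjunct1,
        rule_format, OF assms(2,4), of P] by blast
qed

lemma current_local:
  fixes T :: "'a::metric_space functional"
  assumes T: "metric_current T" and f: "f \<in> Lip_bdd" and p: "p \<in> Lip"
    and U: "open U" "fun_spt f \<subseteq> U" "\<And>x. x \<in> U \<Longrightarrow> p x = c"
  shows "T f p = 0"
proof -
  have "\<exists>U c. open U \<and> fun_spt f \<subseteq> U \<and> (\<forall>x\<in>U. p x = c)"
    by (intro exI[of _ U] exI[of _ c] conjI ballI U)
  with T[unfolded metric_current_def, THEN conjunct2, THEN conjunct2, THEN conjunct2]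
    f p show ?thesis by (metis (no_types, lifting))
qed

lemma bilinear_left:
  assumes "bilinear_functional T" "f \<in> Lip_bdd" "g \<in> Lip_bdd" "p \<in> Lip"
  shows "T (\<lambda>x. a * f x + b * g x) p = a * T f p + b * T g p"
  using assms(1)[unfolded bilinear_functional_def, THEN conjunct1, rule_format, OF assms(2-4)] .

lemma bilinear_right:
  assumes "bilinear_functional T" "f \<in> Lip_bdd" "p \<in> Lip" "q \<in> Lip"
  shows "T f (\<lambda>x. a * p x + b * q x) = a * T f p + b * T f q"
  using assms(1)[unfolded bilinear_functional_def, THEN conjunct2, rule_format, OF assms(2-4)] .

lemma bilinear_diff_left:
  "bilinear_functional T \<Longrightarrow> f \<in> Lip_bdd \<Longrightarrow> g \<in> Lip_bdd \<Longrightarrow> p \<in> Lip \<Longrightarrow>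
    T (\<lambda>x. f x - g x) p = T f p - T g p"
  using bilinear_left[of T f g p 1 "-1"] by simp

lemma bilinear_diff_right:
  "bilinear_functional T \<Longrightarrow> f \<in> Lip_bdd \<Longrightarrow> p \<in> Lip \<Longrightarrow> q \<in> Lip \<Longrightarrow>
    T f (\<lambda>x. p x - q x) = T f p - T f q"
  using bilinear_right[of T f p q 1 "-1"] by simp

lemma current_bilinear: "metric_current T \<Longrightarrow> bilinear_functional T"
  by (simp add: metric_current_def)

lemma Lip_bdd_abs: "f \<in> Lip_bdd \<Longrightarrow> (\<lambda>x. \<bar>f x\<bar>) \<in> Lip_bdd"
proof -
  assume f: "f \<in> Lip_bdd"
  obtain B where B: "\<And>x. \<bar>f x\<bar> \<le> B" using Lip_bddE[OF f] by metis
  have "(lip_const f)-lipschitz_on UNIV (\<lambda>x. \<bar>f x\<bar>)"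
  proof (rule lipschitz_onI)
    fix x y
    show "dist \<bar>f x\<bar> \<bar>f y\<bar> \<le> lip_const f * dist x y"
      using lipschitz_onD[OF lip_const_lipschitz[OF Lip_bdd_Lip[OF f]], of x y]
      by (auto simp: dist_real_def)
  qed (rule lip_const_nonneg[OF Lip_bdd_Lip[OF f]])
  then show "(\<lambda>x. \<bar>f x\<bar>) \<in> Lip_bdd"
    using B by (intro Lip_bddI[of _ _ B]) auto
qed

subsection \<open>Existence of the mass measure\<close>

text \<open>Cut-offs of slope \<open>n\<close>: off the closed set \<open>K\<close> the distance is
  positive, so \<open>\<phi> n x\<close> vanishes once \<open>n\<close> exceeds its
  reciprocal.\<close>

lemma closed_indicator_limit:
  fixes K :: "'a::metric_space set"
  assumes "closed K"
  obtains \<phi> :: "nat \<Rightarrow> 'a \<Rightarrow> real" where "\<And>n. \<phi> n \<in> Lip_bdd"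
    "\<And>n x. 0 \<le> \<phi> n x \<and> \<phi> n x \<le> 1" "\<And>x. (\<lambda>n. \<phi> n x) \<longlonglongrightarrow> indicator K x"
proof (cases "K = {}")
  \<comment> \<open>\<open>infdist\<close> to the empty set is 0, so the cut-offs used for nonempty
    \<open>K\<close> would be constantly 1 here.\<close>
  case True
  show ?thesis by (rule that[of "\<lambda>_ _. 0"]) (auto simp: True)
next
  case False
  define \<phi> where "\<phi> n x = clamp01 (1 + (- real n) * infdist x K)" for n and x :: 'a
  show ?thesis
  proof (rule that[of \<phi>])
    show "\<phi> n \<in> Lip_bdd" for n
      unfolding \<phi>_def
      by (rule Lip_bddI[OF lipschitz_clamp01_affine[OF lipschitz_infdist], of _ _ _ 1]) auto
    show "0 \<le> \<phi> n x \<and> \<phi> n x \<le> 1" for n x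
      by (simp add: \<phi>_def)
    show "(\<lambda>n. \<phi> n x) \<longlonglongrightarrow> indicator K x" for x
    proof (cases "x \<in> K")
      case True
      then show ?thesis by (simp add: \<phi>_def clamp01_def)
    next
      case xK: False
      then have pos: "infdist x K > 0"
        using infdist_pos_not_in_closed[OF assms False] by blast
      obtain N :: nat where N: "1 / infdist x K < real N" using reals_Archimedean2 by blast
      have "\<phi> n x = 0" if "n \<ge> N" for n
      proof -
        have "1 / infdist x K < real n" using N that by linarith
        then have "1 < real n * infdist x K" using pos by (simp add: divide_less_eq)
        then show ?thesis by (simp add: \<phi>_def clamp01_eq_0)
      qed
      then have "eventually (\<lambda>n. \<phi> n x = indicator K x) sequentially"
        using xK by (auto simp: eventually_sequentially)
      then show ?thesis by (rule tendsto_eventually)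
    qed
  qed
qed

text \<open>Inner regularity with an additive error. The case \<open>measure \<mu> Y \<le> e\<close>
  stands apart because \<open>ennreal\<close> would truncate a negative
  \<open>measure \<mu> Y - e\<close> to 0.\<close>

lemma inner_compact_approx:
  fixes \<mu> :: "'a::{second_countable_topology, complete_space} measure"
  assumes "finite_measure \<mu>" "sets \<mu> = sets borel" "Y \<in> sets borel" "e > 0"
  obtains K where "K \<subseteq> Y" "compact K" "measure \<mu> Y \<le> measure \<mu> K + e"
proof (cases "measure \<mu> Y \<le> e")
  case True
  show ?thesis by (rule that[of "{}"]) (use True in auto)
next
  case False
  interpret finite_measure \<mu> by fact
  have "ennreal (measure \<mu> Y - e) < emeasure \<mu> Y"
    using False assms(4) by (simp add: emeasure_eq_measure ennreal_less_iff)
  also have "\<dots> = (SUP K \<in> {K. K \<subseteq> Y \<and> compact K}. emeasure \<mu> K)"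
    using assms by (intro inner_regular) auto
  finally obtain K where K: "K \<subseteq> Y" "compact K" "ennreal (measure \<mu> Y - e) < emeasure \<mu> K"
    unfolding less_SUP_iff by auto
  then have "measure \<mu> Y - e < measure \<mu> K"
    using False by (simp add: emeasure_eq_measure ennreal_less_iff)
  with K show ?thesis by (intro that[of K]) auto
qed

text \<open>One function has to serve both measures, since one current is going to be split by it.
  The union of two compact subsets of \<open>Y\<close>, one good for each measure, is closed and
  good for both. Half of \<open>e\<close> pays for \<open>Y - K\<close>, the other half for
  replacing the indicator of \<open>K\<close> by a Lipschitz function, by dominated
  convergence.\<close>

lemma Lip_bdd_approx_indicator:
  fixes \<mu> \<nu> :: "'a::{second_countable_topology, complete_space} measure"
  assumes m: "finite_measure \<mu>" "sets \<mu> = sets borel" and n: "finite_measure \<nu>" "sets \<nu> = sets borel"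
    and Y: "Y \<in> sets borel" and e: "e > 0"
  obtains \<phi> where "\<phi> \<in> Lip_bdd" "\<And>x. 0 \<le> \<phi> x \<and> \<phi> x \<le> 1"
    "(\<integral>x. \<bar>\<phi> x - indicator Y x\<bar> \<partial>\<mu>) \<le> e" "(\<integral>x. \<bar>\<phi> x - indicator Y x\<bar> \<partial>\<nu>) \<le> e"
proof -
  have e2: "e / 2 > 0" using e by simp
  obtain K1 where K1: "K1 \<subseteq> Y" "compact K1" "measure \<mu> Y \<le> measure \<mu> K1 + e / 2"
    by (rule inner_compact_approx[OF m Y e2])
  obtain K2 where K2: "K2 \<subseteq> Y" "compact K2" "measure \<nu> Y \<le> measure \<nu> K2 + e / 2"
    by (rule inner_compact_approx[OF n Y e2])
  define K where "K = K1 \<union> K2"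
  have K: "K \<subseteq> Y" "closed K" using K1 K2 by (auto simp: K_def compact_imp_closed)
  then have Kb: "K \<in> sets borel" by auto
  obtain \<phi> where \<phi>: "\<And>n. \<phi> n \<in> Lip_bdd" "\<And>n x. 0 \<le> \<phi> n x \<and> \<phi> n x \<le> 1"
    "\<And>x. (\<lambda>n::nat. \<phi> n x) \<longlonglongrightarrow> indicator K x"
    using closed_indicator_limit[OF K(2)] by metis
  have *: "eventually (\<lambda>k. (\<integral>x. \<bar>\<phi> k x - indicator Y x\<bar> \<partial>\<kappa>) \<le> e) sequentially"
    if l: "finite_measure \<kappa>" "sets \<kappa> = sets borel" and C: "C \<subseteq> K" "compact C" "measure \<kappa> Y \<le> measure \<kappa> C + e / 2"
    for \<kappa> :: "'a measure" and C
  proof -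
    interpret finite_measure \<kappa> by fact
    have [measurable]: "\<phi> k \<in> borel_measurable \<kappa>" for k
      using Lip_measurable[OF Lip_bdd_Lip[OF \<phi>(1)] l(2)] .
    have [measurable]: "K \<in> sets \<kappa>" "Y \<in> sets \<kappa>" "C \<in> sets \<kappa>"
      using Kb Y l(2) C(2) by (auto simp: borel_compact)
    have "(\<lambda>k. \<integral>x. \<bar>\<phi> k x - indicator K x\<bar> \<partial>\<kappa>) \<longlonglongrightarrow> (\<integral>x. 0 \<partial>\<kappa>)"
    proof (rule integral_dominated_convergence[where w = "\<lambda>_. 1"])
      have "(\<lambda>k. \<bar>\<phi> k x - indicator K x\<bar>) \<longlonglongrightarrow> \<bar>indicator K x - indicator K x\<bar>" for x
        by (intro tendsto_intros \<phi>(3))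
      then show "AE x in \<kappa>. (\<lambda>k. \<bar>\<phi> k x - indicator K x\<bar>) \<longlonglongrightarrow> 0" by simp
      show "AE x in \<kappa>. norm \<bar>\<phi> k x - indicator K x\<bar> \<le> 1" for k
        using \<phi>(2)[of k] by (auto intro!: AE_I2 simp: indicator_def)
    qed auto
    then have "eventually (\<lambda>k. (\<integral>x. \<bar>\<phi> k x - indicator K x\<bar> \<partial>\<kappa>) < e / 2) sequentially"
      using e by (intro order_tendstoD) auto
    then show ?thesis
    proof eventually_elim
      case (elim k)
      have int: "integrable \<kappa> (\<lambda>x. \<bar>\<phi> k x - indicator K x\<bar>)"
        using \<phi>(2)[of k] by (intro integrable_const_bound[of _ 1]) (auto intro!: AE_I2 simp: indicator_def)
      have int2: "integrable \<kappa> (\<lambda>x. indicator (Y - K) x :: real)"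
        by (intro integrable_const_bound[of _ 1]) (auto simp: indicator_def)
      have "(\<integral>x. \<bar>\<phi> k x - indicator Y x\<bar> \<partial>\<kappa>) \<le> (\<integral>x. \<bar>\<phi> k x - indicator K x\<bar> + indicator (Y - K) x \<partial>\<kappa>)"
        using K(1) int int2
        by (intro integral_mono' Bochner_Integration.integrable_add) (auto simp: indicator_def)
      also have "\<dots> = (\<integral>x. \<bar>\<phi> k x - indicator K x\<bar> \<partial>\<kappa>) + measure \<kappa> (Y - K)"
        using int int2 l(2) by (subst Bochner_Integration.integral_add) (auto simp: sets_eq_imp_space_eq)
      also have "measure \<kappa> (Y - K) = measure \<kappa> Y - measure \<kappa> K"
        using K(1) by (intro finite_measure_Diff) auto
      finally have "(\<integral>x. \<bar>\<phi> k x - indicator Y x\<bar> \<partial>\<kappa>)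
          \<le> (\<integral>x. \<bar>\<phi> k x - indicator K x\<bar> \<partial>\<kappa>) + (measure \<kappa> Y - measure \<kappa> K)" .
      moreover have "measure \<kappa> C \<le> measure \<kappa> K"
        using C(1) by (intro finite_measure_mono) auto
      ultimately show ?case using elim C(3) by linarith
    qed
  qed
  from *[OF m _ K1(2,3)] *[OF n _ K2(2,3)]
  have "eventually (\<lambda>k. (\<integral>x. \<bar>\<phi> k x - indicator Y x\<bar> \<partial>\<mu>) \<le> e \<and> (\<integral>x. \<bar>\<phi> k x - indicator Y x\<bar> \<partial>\<nu>) \<le> e) sequentially"
    by (intro eventually_conj) (auto simp: K_def)
  then obtain k where "(\<integral>x. \<bar>\<phi> k x - indicator Y x\<bar> \<partial>\<mu>) \<le> e" "(\<integral>x. \<bar>\<phi> k x - indicator Y x\<bar> \<partial>\<nu>) \<le> e"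
    unfolding eventually_sequentially by auto
  then show ?thesis by (rule that[OF \<phi>(1) \<phi>(2)])
qed

text \<open>Splitting \<open>f\<close> by a Lipschitz function close to the indicator of
  \<open>Y\<close> in both \<open>L^1\<close> spaces gives two summands, each estimated by its own
  measure. So mass bounds may be glued along a Borel set; this is the property from which a smallest
  one is obtained.\<close>

lemma mass_bound_glue:
  fixes T :: "'a::{second_countable_topology, complete_space} functional"
  assumes T: "bilinear_functional T" and m: "mass_bound T \<mu>" and n: "mass_bound T \<nu>"
    and Y: "Y \<in> sets borel" and f: "f \<in> Lip_bdd" and p: "L-lipschitz_on UNIV p"
  shows "\<bar>T f p\<bar> \<le> L * ((\<integral>x. indicator Y x * \<bar>f x\<bar> \<partial>\<mu>) + (\<integral>x. indicator (- Y) x * \<bar>f x\<bar> \<partial>\<nu>))"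
    (is "_ \<le> L * (?I + ?J)")
proof -
  have L: "0 \<le> L" using p by (rule lipschitz_on_nonneg)
  obtain B where B: "B > 0" "\<And>x. \<bar>f x\<bar> \<le> B" using Lip_bddE[OF f] by metis
  note mf = mass_boundD_finite[OF m] mass_boundD_sets[OF m]
  note nf = mass_boundD_finite[OF n] mass_boundD_sets[OF n]
  have "\<bar>T f p\<bar> \<le> L * (?I + ?J) + L * B * 2 * e" if e: "e > 0" for e
  proof -
    obtain \<phi> where \<phi>: "\<phi> \<in> Lip_bdd" "\<And>x. 0 \<le> \<phi> x \<and> \<phi> x \<le> 1"
      "(\<integral>x. \<bar>\<phi> x - indicator Y x\<bar> \<partial>\<mu>) \<le> e" "(\<integral>x. \<bar>\<phi> x - indicator Y x\<bar> \<partial>\<nu>) \<le> e"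
      using Lip_bdd_approx_indicator[OF mf nf Y e] by metis
    have g1: "(\<lambda>x. \<phi> x * f x) \<in> Lip_bdd" by (rule Lip_bdd_mult[OF \<phi>(1) f])
    have g2: "(\<lambda>x. (1 - \<phi> x) * f x) \<in> Lip_bdd"
      by (intro Lip_bdd_mult[OF _ f] Lip_bdd_diff[OF _ \<phi>(1)]) simp
    have "T f p = T (\<lambda>x. 1 * (\<phi> x * f x) + 1 * ((1 - \<phi> x) * f x)) p"
      by (simp add: algebra_simps)
    also have "\<dots> = T (\<lambda>x. \<phi> x * f x) p + T (\<lambda>x. (1 - \<phi> x) * f x) p"
      using bilinear_left[OF T g1 g2 LipI[OF p], of 1 1] by simp
    also have "\<bar>\<dots>\<bar> \<le> L * (\<integral>x. \<bar>\<phi> x * f x\<bar> \<partial>\<mu>) + L * (\<integral>x. \<bar>(1 - \<phi> x) * f x\<bar> \<partial>\<nu>)"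
      using mass_boundD[OF m g1 p] mass_boundD[OF n g2 p] by linarith
    also have "\<dots> = L * ((\<integral>x. \<bar>\<phi> x * f x\<bar> \<partial>\<mu>) + (\<integral>x. \<bar>(1 - \<phi> x) * f x\<bar> \<partial>\<nu>))"
      by (simp add: algebra_simps)
    also have "\<dots> \<le> L * ((?I + B * e) + (?J + B * e))"
    proof (intro mult_left_mono[OF _ L] add_mono)
      have *: "(\<integral>x. \<bar>\<psi> x * f x\<bar> \<partial>\<kappa>) \<le> (\<integral>x. indicator Z x * \<bar>f x\<bar> \<partial>\<kappa>) + B * e"
        if l: "finite_measure \<kappa>" "sets \<kappa> = sets borel" and Z: "Z \<in> sets borel"
          and \<psi>: "\<psi> \<in> Lip_bdd" "\<And>x. 0 \<le> \<psi> x \<and> \<psi> x \<le> 1"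
          and le: "(\<integral>x. \<bar>\<psi> x - indicator Z x\<bar> \<partial>\<kappa>) \<le> e" for \<kappa> :: "'a measure" and Z \<psi>
      proof -
        interpret finite_measure \<kappa> by fact
        have [measurable]: "\<psi> \<in> borel_measurable \<kappa>" "f \<in> borel_measurable \<kappa>" "Z \<in> sets \<kappa>"
          using Lip_measurable[OF Lip_bdd_Lip l(2)] \<psi>(1) f Z l(2) by auto
        have i1: "integrable \<kappa> (\<lambda>x. indicator Z x * \<bar>f x\<bar>)"
          using B by (intro integrable_const_bound[of _ B]) (auto simp: indicator_def)
        have i2: "integrable \<kappa> (\<lambda>x. \<bar>\<psi> x - indicator Z x\<bar>)"
          using \<psi>(2) by (intro integrable_const_bound[of _ 1]) (auto intro!: AE_I2 simp: indicator_def)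
        have "(\<integral>x. \<bar>\<psi> x * f x\<bar> \<partial>\<kappa>) \<le> (\<integral>x. indicator Z x * \<bar>f x\<bar> + B * \<bar>\<psi> x - indicator Z x\<bar> \<partial>\<kappa>)"
        proof (rule integral_mono')
          fix x
          have "\<bar>\<psi> x * f x\<bar> \<le> (indicator Z x + \<bar>\<psi> x - indicator Z x\<bar>) * \<bar>f x\<bar>"
            unfolding abs_mult using \<psi>(2)[of x] by (intro mult_right_mono) auto
          also have "\<dots> \<le> indicator Z x * \<bar>f x\<bar> + B * \<bar>\<psi> x - indicator Z x\<bar>"
            using mult_left_mono[OF B(2)[of x], of "\<bar>\<psi> x - indicator Z x\<bar>"] by (simp add: algebra_simps)
          finally show "\<bar>\<psi> x * f x\<bar> \<le> indicator Z x * \<bar>f x\<bar> + B * \<bar>\<psi> x - indicator Z x\<bar>" .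
        qed (use i1 i2 B in auto)
        also have "\<dots> = (\<integral>x. indicator Z x * \<bar>f x\<bar> \<partial>\<kappa>) + B * (\<integral>x. \<bar>\<psi> x - indicator Z x\<bar> \<partial>\<kappa>)"
          using i1 i2 by simp
        finally show ?thesis using mult_left_mono[OF le, of B] B(1) by linarith
      qed
      show "(\<integral>x. \<bar>\<phi> x * f x\<bar> \<partial>\<mu>) \<le> ?I + B * e"
        by (rule *[OF mf Y \<phi>(1-3)])
      have "(\<integral>x. \<bar>(1 - \<phi> x) - indicator (- Y) x\<bar> \<partial>\<nu>) = (\<integral>x. \<bar>\<phi> x - indicator Y x\<bar> \<partial>\<nu>)"
        by (intro Bochner_Integration.integral_cong) (auto simp: indicator_def)
      then show "(\<integral>x. \<bar>(1 - \<phi> x) * f x\<bar> \<partial>\<nu>) \<le> ?J + B * e"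
        using Y \<phi> by (intro *[OF nf]) (auto intro: Lip_bdd_diff)
    qed
    finally show ?thesis by (simp add: algebra_simps)
  qed
  then have "\<bar>T f p\<bar> \<le> L * (?I + ?J) + e" if "e > 0" for e
  proof -
    \<comment> \<open>The error is rescaled by \<open>L + 1\<close> rather than \<open>L\<close>,
      which covers \<open>L = 0\<close>.\<close>
    have d: "e / (2 * B * (L + 1)) > 0"
      using that B(1) L by (simp add: add_nonneg_pos)
    have "\<bar>T f p\<bar> \<le> L * (?I + ?J) + L * B * 2 * (e / (2 * B * (L + 1)))"
      by (rule \<open>\<And>e. e > 0 \<Longrightarrow> \<bar>T f p\<bar> \<le> L * (?I + ?J) + L * B * 2 * e\<close>[OF d])
    also have "L * B * 2 * (e / (2 * B * (L + 1))) = e * (L / (L + 1))"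
      using B(1) L by (simp add: divide_simps)
    also have "\<dots> \<le> e * 1"
      using that L by (intro mult_left_mono) auto
    finally show ?thesis by simp
  qed
  then show ?thesis by (rule field_le_epsilon)
qed

text \<open>Gluing along the set where \<open>g \<le> h\<close> shows that the minimum of two
  admissible densities is admissible. A minimizing sequence can therefore be made decreasing; its
  limit is admissible by dominated convergence and attains the infimum of the integrals.\<close>

lemma mass_bound_minimal_density:
  fixes T :: "'a::{second_countable_topology, complete_space} functional"
  assumes T: "bilinear_functional T" and m: "mass_bound T \<mu>"
  shows "\<exists>g. g \<in> borel_measurable \<mu> \<and> (\<forall>x. 0 \<le> g x) \<and> integrable \<mu> g \<and> mass_bound T (density \<mu> g) \<and>
     (\<forall>h. h \<in> borel_measurable \<mu> \<longrightarrow> (\<forall>x. 0 \<le> h x) \<longrightarrow> integrable \<mu> h \<longrightarrow> mass_bound T (density \<mu> h) \<longrightarrow>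
        integral\<^sup>L \<mu> g \<le> integral\<^sup>L \<mu> h)"
proof -
  interpret finite_measure \<mu> using mass_boundD_finite[OF m] .
  note sm [simp] = mass_boundD_sets[OF m]
  have sp [simp]: "space \<mu> = UNIV" using sets_eq_imp_space_eq[OF sm] by simp
  define D where "D g \<longleftrightarrow> g \<in> borel_measurable \<mu> \<and> (\<forall>x. 0 \<le> g x) \<and> integrable \<mu> g \<and> mass_bound T (density \<mu> g)"
    for g :: "'a \<Rightarrow> real"
  have finD: "finite_measure (density \<mu> g)" if "g \<in> borel_measurable \<mu>" "\<forall>x. 0 \<le> g x" "integrable \<mu> g" for g :: "'a \<Rightarrow> real"
    using that by (intro finite_measureI) (simp add: emeasure_density nn_integral_eq_integral)
  have intD: "(\<integral>x. \<bar>f x\<bar> \<partial>density \<mu> g) = (\<integral>x. g x * \<bar>f x\<bar> \<partial>\<mu>)"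
    if "g \<in> borel_measurable \<mu>" "\<forall>x. 0 \<le> g x" "f \<in> Lip_bdd" for g f :: "'a \<Rightarrow> real"
    using that(1,2) Lip_measurable[OF Lip_bdd_Lip[OF that(3)] sm] by (subst integral_density) auto
  have D1: "D (\<lambda>_. 1)"
    using m by (auto simp: D_def density_1 one_ennreal_def[symmetric])
  have Dmin: "D (\<lambda>x. min (g x) (h x))" if g: "D g" and h: "D h" for g h
  proof -
    have [measurable]: "g \<in> borel_measurable \<mu>" "h \<in> borel_measurable \<mu>" using g h by (auto simp: D_def)
    have int: "integrable \<mu> (\<lambda>x. min (g x) (h x))"
      using g h by (intro integrable_min) (auto simp: D_def)
    have nn: "0 \<le> g x" "0 \<le> h x" for x using g h by (auto simp: D_def)
    have "mass_bound T (density \<mu> (\<lambda>x. min (g x) (h x)))"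
    proof (rule mass_boundI)
      show "finite_measure (density \<mu> (\<lambda>x. min (g x) (h x)))"
        using int nn by (intro finD) auto
      fix f p :: "'a \<Rightarrow> real" and L assume f: "f \<in> Lip_bdd" and p: "L-lipschitz_on UNIV p"
      have [measurable]: "f \<in> borel_measurable \<mu>" using Lip_measurable[OF Lip_bdd_Lip[OF f] sm] .
      obtain B where B: "B > 0" "\<And>x. \<bar>f x\<bar> \<le> B" using Lip_bddE[OF f] by metis
      define Y where "Y = {x. g x \<le> h x}"
      have Y: "Y \<in> sets \<mu>"
        using borel_measurable_le[OF \<open>g \<in> borel_measurable \<mu>\<close> \<open>h \<in> borel_measurable \<mu>\<close>]
        by (simp only: sp UNIV_I simp_thms Y_def)
      note [measurable] = Y
      have i1: "integrable \<mu> (\<lambda>x. g x * (indicator Y x * \<bar>f x\<bar>))"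
      proof (rule Bochner_Integration.integrable_bound[of _ "\<lambda>x. B * g x"])
        show "AE x in \<mu>. norm (g x * (indicator Y x * \<bar>f x\<bar>)) \<le> norm (B * g x)"
          using mult_right_mono[OF B(2) nn(1)] B(1) nn(1)
          by (intro AE_I2) (simp add: indicator_def abs_mult mult.commute)
      qed (use g in \<open>auto simp: D_def\<close>)
      have i2: "integrable \<mu> (\<lambda>x. h x * (indicator (- Y) x * \<bar>f x\<bar>))"
      proof (rule Bochner_Integration.integrable_bound[of _ "\<lambda>x. B * h x"])
        show "AE x in \<mu>. norm (h x * (indicator (- Y) x * \<bar>f x\<bar>)) \<le> norm (B * h x)"
          using mult_right_mono[OF B(2) nn(2)] B(1) nn(2)
          by (intro AE_I2) (simp add: indicator_def abs_mult mult.commute)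
        show "(\<lambda>x. h x * (indicator (- Y) x * \<bar>f x\<bar>)) \<in> borel_measurable \<mu>"
          using Y by (auto intro!: borel_measurable_times borel_measurable_indicator simp: Compl_eq_Diff_UNIV)
      qed (use h in \<open>auto simp: D_def\<close>)
      have e1: "(\<integral>x. indicator Y x * \<bar>f x\<bar> \<partial>density \<mu> g) = (\<integral>x. g x * (indicator Y x * \<bar>f x\<bar>) \<partial>\<mu>)"
        using nn by (subst integral_density) auto
      have e2: "(\<integral>x. indicator (- Y) x * \<bar>f x\<bar> \<partial>density \<mu> h) = (\<integral>x. h x * (indicator (- Y) x * \<bar>f x\<bar>) \<partial>\<mu>)"
        using nn Y by (subst integral_density) (auto simp: Compl_eq_Diff_UNIV)
      have "\<bar>T f p\<bar> \<le> L * ((\<integral>x. indicator Y x * \<bar>f x\<bar> \<partial>density \<mu> g) + (\<integral>x. indicator (- Y) x * \<bar>f x\<bar> \<partial>density \<mu> h))"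
        using g h Y by (intro mass_bound_glue[OF T _ _ _ f p]) (auto simp: D_def)
      also have "\<dots> = L * (\<integral>x. g x * (indicator Y x * \<bar>f x\<bar>) + h x * (indicator (- Y) x * \<bar>f x\<bar>) \<partial>\<mu>)"
        unfolding e1 e2 using i1 i2 by simp
      also have "\<dots> = L * (\<integral>x. min (g x) (h x) * \<bar>f x\<bar> \<partial>\<mu>)"
        by (intro arg_cong[of _ _ "\<lambda>t. L * t"] Bochner_Integration.integral_cong) (auto simp: Y_def indicator_def min_def)
      also have "\<dots> = L * (\<integral>x. \<bar>f x\<bar> \<partial>density \<mu> (\<lambda>x. min (g x) (h x)))"
        using nn by (subst intD[OF _ _ f]) auto
      finally show "\<bar>T f p\<bar> \<le> \<dots>" .
    qed simp
    then show ?thesis using int nn by (auto simp: D_def)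
  qed
  define I where "I = Inf (integral\<^sup>L \<mu> ` Collect D)"
  have bdd: "bdd_below (integral\<^sup>L \<mu> ` Collect D)"
    by (rule bdd_belowI[of _ 0]) (auto simp: D_def intro!: integral_nonneg)
  have I: "I \<le> integral\<^sup>L \<mu> g" if "D g" for g
    unfolding I_def using bdd that by (auto intro: cInf_lower)
  have "\<exists>g. D g \<and> integral\<^sup>L \<mu> g < I + 1 / real (Suc n)" for n
  proof -
    have "\<exists>y\<in>integral\<^sup>L \<mu> ` Collect D. y < I + 1 / real (Suc n)"
      unfolding I_def using bdd D1 by (subst cInf_less_iff[symmetric]) auto
    then show ?thesis by auto
  qed
  then obtain g where g: "\<And>n. D (g n)" "\<And>n. integral\<^sup>L \<mu> (g n) < I + 1 / real (Suc n)" by metis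
  \<comment> \<open>Running minima of the minimizing sequence: still admissible, and dominated by
    the integrable \<open>G 0\<close>.\<close>
  define G where "G = rec_nat (g 0) (\<lambda>n h x. min (h x) (g (Suc n) x))"
  have G0: "G 0 = g 0" and GS: "G (Suc n) = (\<lambda>x. min (G n x) (g (Suc n) x))" for n
    by (auto simp: G_def)
  have DG: "D (G n)" for n
    by (induction n) (auto simp: G0 GS g intro: Dmin)
  have Gg: "G n x \<le> g n x" for n x
    by (cases n) (auto simp: G0 GS)
  have dec: "decseq (\<lambda>n. G n x)" for x
    by (auto intro!: decseq_SucI simp: GS)
  have G_nn: "0 \<le> G n x" and [measurable]: "G n \<in> borel_measurable \<mu>" and G_int: "integrable \<mu> (G n)"
    and G_mb: "mass_bound T (density \<mu> (G n))" for n x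
    using DG by (auto simp: D_def)
  have "\<exists>l. (\<lambda>n. G n x) \<longlonglongrightarrow> l" for x
    using decseq_convergent[OF dec, of 0 x] G_nn by metis
  then obtain H where H: "\<And>x. (\<lambda>n. G n x) \<longlonglongrightarrow> H x" by metis
  have HG: "H x \<le> G n x" for n x
    using decseq_ge[OF dec H] .
  have H_nn: "0 \<le> H x" for x
    by (rule LIMSEQ_le_const[OF H]) (use G_nn in auto)
  have [measurable]: "H \<in> borel_measurable \<mu>"
    by (rule borel_measurable_LIMSEQ_real[OF H]) auto
  have lim: "integrable \<mu> (\<lambda>x. H x * u x) \<and> (\<lambda>n. \<integral>x. G n x * u x \<partial>\<mu>) \<longlonglongrightarrow> (\<integral>x. H x * u x \<partial>\<mu>)"
    if u [measurable]: "u \<in> borel_measurable \<mu>" and B: "\<And>x. 0 \<le> u x \<and> u x \<le> B" for u B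
  proof -
    have a: "AE x in \<mu>. (\<lambda>n. G n x * u x) \<longlonglongrightarrow> H x * u x"
      by (auto intro!: AE_I2 tendsto_intros H)
    have b: "AE x in \<mu>. norm (G n x * u x) \<le> B * G 0 x" for n
    proof (rule AE_I2)
      fix x
      have "G n x * u x \<le> G 0 x * B"
        using decseqD[OF dec, of 0 n x] G_nn B by (intro mult_mono) auto
      then show "norm (G n x * u x) \<le> B * G 0 x"
        using G_nn B by (simp add: abs_mult mult.commute)
    qed
    have w: "integrable \<mu> (\<lambda>x. B * G 0 x)" using G_int by simp
    from integrable_dominated_convergence[OF _ _ w a b] integral_dominated_convergence[OF _ _ w a b]
    show ?thesis by auto
  qed
  have H_int: "integrable \<mu> H" using lim[of "\<lambda>_. 1" 1] by simp
  have "mass_bound T (density \<mu> H)"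
  proof (rule mass_boundI)
    show "finite_measure (density \<mu> H)" using H_nn H_int by (intro finD) auto
    fix f p :: "'a \<Rightarrow> real" and L assume f: "f \<in> Lip_bdd" and p: "L-lipschitz_on UNIV p"
    have [measurable]: "f \<in> borel_measurable \<mu>" using Lip_measurable[OF Lip_bdd_Lip[OF f] sm] .
    obtain B where B: "B > 0" "\<And>x. \<bar>f x\<bar> \<le> B" using Lip_bddE[OF f] by metis
    have "(\<lambda>n. L * (\<integral>x. G n x * \<bar>f x\<bar> \<partial>\<mu>)) \<longlonglongrightarrow> L * (\<integral>x. H x * \<bar>f x\<bar> \<partial>\<mu>)"
      using lim[of "\<lambda>x. \<bar>f x\<bar>" B] B by (intro tendsto_intros) auto
    moreover have "\<bar>T f p\<bar> \<le> L * (\<integral>x. G n x * \<bar>f x\<bar> \<partial>\<mu>)" for n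
      using mass_boundD[OF G_mb f p] G_nn by (subst (asm) intD[OF _ _ f]) auto
    ultimately have "\<bar>T f p\<bar> \<le> L * (\<integral>x. H x * \<bar>f x\<bar> \<partial>\<mu>)"
      by (intro LIMSEQ_le_const) auto
    then show "\<bar>T f p\<bar> \<le> L * (\<integral>x. \<bar>f x\<bar> \<partial>density \<mu> H)"
      using H_nn by (subst intD[OF _ _ f]) auto
  qed simp
  then have DH: "D H" using H_nn H_int by (simp add: D_def)
  have "integral\<^sup>L \<mu> H \<le> I"
  proof (rule LIMSEQ_le_const)
    show "(\<lambda>n. I + 1 / real (Suc n)) \<longlonglongrightarrow> I"
      using tendsto_add[OF tendsto_const[of I] LIMSEQ_Suc[OF lim_1_over_n]] by simp
    have "integral\<^sup>L \<mu> H \<le> I + 1 / real (Suc n)" for n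
    proof -
      have "integral\<^sup>L \<mu> H \<le> integral\<^sup>L \<mu> (g n)"
        using H_int g(1)[of n] order.trans[OF HG Gg] by (intro integral_mono) (auto simp: D_def)
      with g(2)[of n] show ?thesis by linarith
    qed
    then show "\<exists>N. \<forall>n\<ge>N. integral\<^sup>L \<mu> H \<le> I + 1 / real (Suc n)" by blast
  qed
  then have "\<forall>h. D h \<longrightarrow> integral\<^sup>L \<mu> H \<le> integral\<^sup>L \<mu> h" using I by force
  with DH show ?thesis unfolding D_def by blast
qed

text \<open>Least total mass among densities is upgraded to setwise minimality. Let \<open>Y\<close>
  be a Hahn set, with \<nu> below \<kappa> inside \<open>Y\<close> and \<kappa> below \<nu> outside.
  The measure that is \<nu> on \<open>Y\<close> and \<kappa> elsewhere has a density with respect to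
  \<mu> and bounds \<open>T\<close> by gluing, so the minimality of \<open>g\<close> gives
  \<open>measure \<kappa> Y \<le> measure \<nu> Y\<close>.\<close>

lemma mass_measure_exists:
  fixes T :: "'a::{second_countable_topology, complete_space} functional"
  assumes T: "bilinear_functional T" and m: "mass_bound T \<mu>"
  shows "\<exists>\<kappa>. is_mass_measure T \<kappa>"
proof -
  interpret \<mu>: finite_measure \<mu> using mass_boundD_finite[OF m] .
  note sm [simp] = mass_boundD_sets[OF m]
  have sp [simp]: "space \<mu> = UNIV" using sets_eq_imp_space_eq[OF sm] by simp
  obtain g where g: "g \<in> borel_measurable \<mu>" "\<And>x. 0 \<le> g x" "integrable \<mu> g" "mass_bound T (density \<mu> g)"
    and gmin: "\<And>h. h \<in> borel_measurable \<mu> \<Longrightarrow> (\<And>x. 0 \<le> h x) \<Longrightarrow> integrable \<mu> h \<Longrightarrow> mass_bound T (density \<mu> h) \<Longrightarrow>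
        integral\<^sup>L \<mu> g \<le> integral\<^sup>L \<mu> h"
    using mass_bound_minimal_density[OF T m] by blast
  note [measurable] = g(1)
  define \<kappa> where "\<kappa> = density \<mu> g"
  have sk [simp]: "sets \<kappa> = sets borel" by (simp add: \<kappa>_def)
  have spk [simp]: "space \<kappa> = UNIV" by (simp add: \<kappa>_def)
  interpret \<kappa>: finite_measure \<kappa> using mass_boundD_finite[OF g(4)] by (simp add: \<kappa>_def)
  have "emeasure \<kappa> A \<le> emeasure \<nu> A" if n: "mass_bound T \<nu>" and A: "A \<in> sets borel" for \<nu> A
  proof -
    interpret \<nu>: finite_measure \<nu> using mass_boundD_finite[OF n] .
    note sn [simp] = mass_boundD_sets[OF n]
    have spn [simp]: "space \<nu> = UNIV" using sets_eq_imp_space_eq[OF sn] by simp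
    obtain Y where Y: "Y \<in> sets borel" "\<And>X. X \<in> sets borel \<Longrightarrow> X \<subseteq> Y \<Longrightarrow> emeasure \<nu> X \<le> emeasure \<kappa> X"
      "\<And>X. X \<in> sets borel \<Longrightarrow> X \<inter> Y = {} \<Longrightarrow> emeasure \<kappa> X \<le> emeasure \<nu> X"
      using finite_unsigned_Hahn_decomposition[OF \<kappa>.finite_measure_axioms \<nu>.finite_measure_axioms] by auto
    define \<nu>Y where "\<nu>Y = density \<nu> (indicator Y)"
    have sY [simp]: "sets \<nu>Y = sets borel" by (simp add: \<nu>Y_def)
    have Ynu [measurable]: "Y \<in> sets \<nu>" "Y \<in> sets \<mu>" using Y(1) by auto
    have eY: "emeasure \<nu>Y X = emeasure \<nu> (Y \<inter> X)" if "X \<in> sets borel" for X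
      using that Y(1) by (simp add: \<nu>Y_def emeasure_restricted)
    have "finite_measure \<nu>Y"
      by (rule finite_measureI) (simp add: eY sets_eq_imp_space_eq[OF sY])
    \<comment> \<open>Inside \<open>Y\<close> the measure \<nu> lies below \<kappa>, which has a
      density with respect to \<mu>.\<close>
    have ac: "absolutely_continuous \<mu> \<nu>Y"
      unfolding absolutely_continuous_def
    proof
      fix N assume N: "N \<in> null_sets \<mu>"
      then have Nb: "N \<in> sets borel" using sm by blast
      have "emeasure \<nu> (Y \<inter> N) \<le> emeasure \<kappa> (Y \<inter> N)"
        using Y Nb by (intro Y(2)) auto
      also have "\<dots> = 0"
      proof -
        have "Y \<inter> N \<in> null_sets \<mu>" using N Ynu by (intro null_set_Int1) auto
        moreover have "absolutely_continuous \<mu> \<kappa>"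
          unfolding \<kappa>_def by (intro absolutely_continuousI_density) auto
        ultimately show ?thesis by (auto simp: absolutely_continuous_def)
      qed
      finally show "N \<in> null_sets \<nu>Y"
        using Nb by (intro null_setsI) (auto simp: eY)
    qed
    obtain h where h [measurable]: "h \<in> borel_measurable \<mu>" and hRN: "AE x in \<mu>. RN_deriv \<mu> \<nu>Y x = ennreal (h x)"
      and h0: "\<And>x. 0 \<le> h x"
      using \<mu>.real_RN_deriv[OF \<open>finite_measure \<nu>Y\<close> ac] by (metis sY sm)
    have dh: "density \<mu> h = \<nu>Y"
      using \<mu>.density_RN_deriv[OF ac] density_cong[OF _ _ hRN] by simp
    have "(\<integral>\<^sup>+x. ennreal (h x) \<partial>\<mu>) = emeasure (density \<mu> h) UNIV"
      by (subst emeasure_density) auto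
    also have "\<dots> = emeasure \<nu> Y" using dh by (simp add: eY)
    finally have nh: "(\<integral>\<^sup>+x. ennreal (h x) \<partial>\<mu>) = ennreal (measure \<nu> Y)"
      by (simp add: \<nu>.emeasure_eq_measure)
    have hint: "integrable \<mu> h" and hI: "integral\<^sup>L \<mu> h = measure \<nu> Y"
    proof -
      show "integrable \<mu> h" using h0 nh by (intro integrableI_nonneg) auto
      then show "integral\<^sup>L \<mu> h = measure \<nu> Y"
        using nh h0 by (subst (asm) nn_integral_eq_integral) (auto simp: integral_nonneg)
    qed
    \<comment> \<open>The density of the competitor: \<nu> on \<open>Y\<close>, \<kappa> off
      \<open>Y\<close>.\<close>
    define k where "k x = indicator (- Y) x * g x + h x" for x
    have mY: "- Y \<in> sets \<mu>" using Y(1) by auto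
    note [measurable] = mY
    have k0: "0 \<le> k x" for x using g h0 by (simp add: k_def)
    have gint: "integrable \<mu> (\<lambda>x. indicator Z x * g x)" if "Z \<in> sets \<mu>" for Z
      using integrable_real_mult_indicator[OF that g(3)] by (simp add: mult.commute)
    have kint: "integrable \<mu> k" unfolding k_def using gint[OF mY] hint by simp
    have [measurable]: "k \<in> borel_measurable \<mu>" unfolding k_def by measurable
    have "mass_bound T (density \<mu> k)"
    proof (rule mass_boundI)
      show "finite_measure (density \<mu> k)"
        using k0 kint by (intro finite_measureI) (simp add: emeasure_density nn_integral_eq_integral)
      fix f p :: "'a \<Rightarrow> real" and L assume f: "f \<in> Lip_bdd" and p: "L-lipschitz_on UNIV p"
      have fm [measurable]: "f \<in> borel_measurable \<mu>" "f \<in> borel_measurable \<nu>"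
        using Lip_measurable[OF Lip_bdd_Lip[OF f]] by auto
      obtain B where B: "B > 0" "\<And>x. \<bar>f x\<bar> \<le> B" using Lip_bddE[OF f] by metis
      have bd: "integrable \<mu> (\<lambda>x. u x * \<bar>f x\<bar>)" if "integrable \<mu> u" "\<And>x. 0 \<le> u x" for u
      proof (rule Bochner_Integration.integrable_bound[of _ "\<lambda>x. B * u x"])
        show "AE x in \<mu>. norm (u x * \<bar>f x\<bar>) \<le> norm (B * u x)"
          using mult_left_mono[OF B(2) that(2)] B(1) that(2)
          by (intro AE_I2) (simp add: abs_mult mult.commute)
        show "(\<lambda>x. u x * \<bar>f x\<bar>) \<in> borel_measurable \<mu>"
          using borel_measurable_integrable[OF that(1)] by measurable
      qed (use that in simp)
      have e1: "(\<integral>x. indicator Y x * \<bar>f x\<bar> \<partial>\<nu>) = (\<integral>x. h x * \<bar>f x\<bar> \<partial>\<mu>)"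
      proof -
        have "(\<integral>x. indicator Y x * \<bar>f x\<bar> \<partial>\<nu>) = (\<integral>x. \<bar>f x\<bar> \<partial>density \<nu> (\<lambda>x. ennreal (indicator Y x)))"
          by (subst integral_density) auto
        also have "density \<nu> (\<lambda>x. ennreal (indicator Y x)) = density \<mu> h"
          unfolding dh \<nu>Y_def by (simp add: ennreal_indicator)
        also have "(\<integral>x. \<bar>f x\<bar> \<partial>density \<mu> h) = (\<integral>x. h x * \<bar>f x\<bar> \<partial>\<mu>)"
          using h0 by (subst integral_density) auto
        finally show ?thesis .
      qed
      have e2: "(\<integral>x. indicator (- Y) x * \<bar>f x\<bar> \<partial>\<kappa>) = (\<integral>x. (indicator (- Y) x * g x) * \<bar>f x\<bar> \<partial>\<mu>)"
        unfolding \<kappa>_def using g(2) by (subst integral_density) (auto simp: algebra_simps)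
      have "\<bar>T f p\<bar> \<le> L * ((\<integral>x. indicator Y x * \<bar>f x\<bar> \<partial>\<nu>) + (\<integral>x. indicator (- Y) x * \<bar>f x\<bar> \<partial>\<kappa>))"
        using g(4) by (intro mass_bound_glue[OF T n _ Y(1) f p]) (simp add: \<kappa>_def)
      also have "\<dots> = L * (\<integral>x. k x * \<bar>f x\<bar> \<partial>\<mu>)"
        unfolding e1 e2 using bd[OF hint h0] bd[OF gint[OF mY]] g(2) by (simp add: k_def algebra_simps)
      also have "\<dots> = L * (\<integral>x. \<bar>f x\<bar> \<partial>density \<mu> k)"
        using k0 by (subst integral_density) auto
      finally show "\<bar>T f p\<bar> \<le> \<dots>" .
    qed simp
    then have "integral\<^sup>L \<mu> g \<le> integral\<^sup>L \<mu> k" using k0 kint by (intro gmin) auto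
    also have "\<dots> = (\<integral>x. indicator (- Y) x * g x \<partial>\<mu>) + measure \<nu> Y"
      unfolding k_def using gint[OF mY] hint by (simp add: hI)
    also have "integral\<^sup>L \<mu> g = (\<integral>x. indicator (- Y) x * g x + indicator Y x * g x \<partial>\<mu>)"
      by (intro Bochner_Integration.integral_cong) (auto simp: indicator_def)
    also have "\<dots> = (\<integral>x. indicator (- Y) x * g x \<partial>\<mu>) + (\<integral>x. indicator Y x * g x \<partial>\<mu>)"
      using gint[OF mY] gint[of Y] Ynu by simp
    finally have "(\<integral>x. indicator Y x * g x \<partial>\<mu>) \<le> measure \<nu> Y" by simp
    moreover have "(\<integral>x. indicator Y x * g x \<partial>\<mu>) = measure \<kappa> Y"
    proof -
      have "emeasure \<kappa> Y = (\<integral>\<^sup>+x. ennreal (indicator Y x * g x) \<partial>\<mu>)"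
        unfolding \<kappa>_def using Ynu
        by (subst emeasure_density) (auto intro!: nn_integral_cong simp: indicator_def)
      also have "\<dots> = ennreal (\<integral>x. indicator Y x * g x \<partial>\<mu>)"
        using gint[of Y] Ynu g(2) by (intro nn_integral_eq_integral) auto
      finally show ?thesis using g(2) by (simp add: \<kappa>.emeasure_eq_measure integral_nonneg)
    qed
    ultimately have kY: "measure \<kappa> Y \<le> measure \<nu> Y" by simp
    have split: "measure M A = measure M (A \<inter> Y) + measure M (A - Y)" "measure M Y = measure M (A \<inter> Y) + measure M (Y - A)"
      if "finite_measure M" "sets M = sets borel" for M :: "'a measure"
    proof -
      interpret M: finite_measure M by fact
      have s: "A \<in> sets M" "Y \<in> sets M" using that A Y by auto
      show "measure M A = measure M (A \<inter> Y) + measure M (A - Y)"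
        using s by (subst M.finite_measure_Union[symmetric]) (auto intro!: arg_cong[of _ _ "measure M"])
      show "measure M Y = measure M (A \<inter> Y) + measure M (Y - A)"
        using s by (subst M.finite_measure_Union[symmetric]) (auto intro!: arg_cong[of _ _ "measure M"])
    qed
    \<comment> \<open>An excess of \<kappa> over \<nu> on \<open>A \<inter> Y\<close> could not be
      made up on \<open>Y - A\<close>, where \<nu> is the smaller one, and would contradict
      \<open>kY\<close>.\<close>
    have le: "measure \<nu> (Y - A) \<le> measure \<kappa> (Y - A)" "measure \<kappa> (A - Y) \<le> measure \<nu> (A - Y)"
      using Y(2)[of "Y - A"] Y(3)[of "A - Y"] Y(1) A
      by (auto simp: \<nu>.emeasure_eq_measure \<kappa>.emeasure_eq_measure)
    have "measure \<kappa> A \<le> measure \<nu> A"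
      using split[OF \<kappa>.finite_measure_axioms sk] split[OF \<nu>.finite_measure_axioms sn] le kY by linarith
    then show ?thesis by (simp add: \<nu>.emeasure_eq_measure \<kappa>.emeasure_eq_measure)
  qed
  then have "is_mass_measure T \<kappa>" using g(4) by (simp add: is_mass_measure_def \<kappa>_def)
  then show ?thesis ..
qed

lemma is_mass_measure_mass_measure:
  fixes T :: "'a::{second_countable_topology, complete_space} functional"
  assumes "metric_current T"
  shows "is_mass_measure T (mass_measure T)"
proof -
  obtain \<kappa> where k: "is_mass_measure T \<kappa>"
    using mass_measure_exists[OF current_bilinear[OF assms]] current_mass_bound[OF assms] by blast
  show ?thesis
    unfolding mass_measure_def
  proof (rule theI[of "is_mass_measure T", OF k])
    fix \<nu> assume n: "is_mass_measure T \<nu>"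
    show "\<nu> = \<kappa>"
    proof (rule measure_eqI)
      show "sets \<nu> = sets \<kappa>" using n k by (simp add: is_mass_measure_def mass_bound_def)
      fix A assume "A \<in> sets \<nu>"
      then have "A \<in> sets borel" using n by (simp add: is_mass_measure_def mass_bound_def)
      then show "emeasure \<nu> A = emeasure \<kappa> A"
        using n k by (auto simp: is_mass_measure_def intro!: antisym)
    qed
  qed
qed

lemma mass_measure_bound:
  fixes T :: "'a::{second_countable_topology, complete_space} functional"
  shows "metric_current T \<Longrightarrow> mass_bound T (mass_measure T)"
  using is_mass_measure_mass_measure by (auto simp: is_mass_measure_def)

lemma mass_measure_le:
  fixes T :: "'a::{second_countable_topology, complete_space} functional"
  shows "metric_current T \<Longrightarrow> mass_bound T \<nu> \<Longrightarrow> A \<in> sets borel \<Longrightarrow> emeasure (mass_measure T) A \<le> emeasure \<nu> A"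
  using is_mass_measure_mass_measure unfolding is_mass_measure_def by blast

subsection \<open>The boundary vanishes off its support\<close>

text \<open>The sets of points farther than \<open>r\<close> from the first points of a dense
  sequence decrease to the empty set, so their finite measures tend to 0.\<close>

lemma finite_net_mass:
  fixes \<mu> :: "'a::{second_countable_topology, metric_space} measure"
  assumes "finite_measure \<mu>" "sets \<mu> = sets borel" "r > 0" "\<eta> > 0"
  obtains F where "finite F" "F \<noteq> {}" "measure \<mu> {x. r < infdist x F} \<le> \<eta>"
proof -
  interpret finite_measure \<mu> by fact
  obtain D :: "'a set" where D: "countable D" "\<And>X. open X \<Longrightarrow> X \<noteq> {} \<Longrightarrow> \<exists>d\<in>D. d \<in> X"
    using countable_dense_setE by blast
  have ne: "D \<noteq> {}" using D(2)[of UNIV] by auto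
  define d where "d = from_nat_into D"
  have rd: "range d = D" using ne D(1) by (simp add: d_def range_from_nat_into)
  define A where "A n = {x. r < infdist x (d ` {..n})}" for n :: nat
  have op: "open (A n)" for n
    unfolding A_def by (intro open_Collect_less continuous_intros)
  have "decseq A"
  proof (rule decseq_SucI)
    show "A (Suc n) \<subseteq> A n" for n
    proof
      fix x assume "x \<in> A (Suc n)"
      moreover have "infdist x (d ` {..Suc n}) \<le> infdist x (d ` {..n})"
        by (rule infdist_mono) auto
      ultimately show "x \<in> A n" by (simp add: A_def)
    qed
  qed
  moreover have "(\<Inter>n. A n) = {}"
  proof -
    have "\<exists>n. x \<notin> A n" for x
    proof -
      obtain y where "y \<in> D" "y \<in> ball x r" using D(2)[of "ball x r"] assms(3) by auto
      then obtain n where "d n \<in> ball x r" using rd by (metis imageE)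
      then have "infdist x (d ` {..n}) \<le> r" by (intro infdist_le2[of "d n"]) auto
      then show ?thesis by (auto simp: A_def not_less)
    qed
    then show ?thesis by auto
  qed
  ultimately have "(\<lambda>n. measure \<mu> (A n)) \<longlonglongrightarrow> 0"
    using finite_Lim_measure_decseq[of A] borel_open[OF op] assms(2) by auto
  then have "eventually (\<lambda>n. measure \<mu> (A n) < \<eta>) sequentially"
    using assms(4) by (intro order_tendstoD) auto
  then obtain n where "measure \<mu> (A n) < \<eta>" by (auto simp: eventually_sequentially)
  then show ?thesis by (intro that[of "d ` {..n}"]) (auto simp: A_def)
qed

text \<open>
  The Lipschitz constant of \<open>(1 - h) g\<close> depends on \<open>r\<close> but not on the net \<open>F\<close>, so \<open>F\<close> can be
  chosen so fine that the mass off its neighbourhood outweighs \<open>1 / r\<close>.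
\<close>

lemma current_cutoff_step:
  fixes T :: "'a::{second_countable_topology, complete_space} functional"
  assumes T: "metric_current T" and g: "g \<in> Lip_bdd" and r: "r > 0" and e: "\<eta> > 0"
  shows "\<exists>F g'. finite F \<and> F \<noteq> {} \<and> g' \<in> Lip_bdd \<and> \<bar>T (\<lambda>_. 1) g - T (\<lambda>_. 1) g'\<bar> \<le> \<eta> \<and>
    (\<forall>x. g' x \<noteq> 0 \<longrightarrow> g x \<noteq> 0 \<and> infdist x F \<le> 4 * r)"
proof -
  note bil = current_bilinear[OF T]
  obtain \<mu> where m: "mass_bound T \<mu>" using current_mass_bound[OF T] by blast
  interpret finite_measure \<mu> using mass_boundD_finite[OF m] .
  note sm = mass_boundD_sets[OF m]
  obtain B where B: "B > 0" "\<And>x. \<bar>g x\<bar> \<le> B" using Lip_bddE[OF g] by metis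
  have gl: "(lip_const g)-lipschitz_on UNIV g" using lip_const_lipschitz[OF Lip_bdd_Lip[OF g]] .
  \<comment> \<open>The product rule bound for the Lipschitz constant of \<open>(1 - h) g\<close>;
    it is fixed before \<open>F\<close> is chosen.\<close>
  define M where "M = 1 * lip_const g + B * (1 / r)"
  have M: "M > 0" using lipschitz_on_nonneg[OF gl] B(1) r by (simp add: M_def add_nonneg_pos)
  obtain F where F: "finite F" "F \<noteq> {}" "measure \<mu> {x. r < infdist x F} \<le> \<eta> / M"
    using finite_net_mass[OF finite_measure_axioms sm r, of "\<eta> / M"] e M by auto
  \<comment> \<open>\<open>h\<close> is 1 up to distance \<open>3 * r\<close> from \<open>F\<close>
    and 0 from \<open>4 * r\<close> on; \<open>\<theta>\<close> is 0 up to \<open>r\<close> and 1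
    from \<open>2 * r\<close> on. Hence \<open>k = (1 - h) g\<close> vanishes on a neighbourhood of
    the support of \<open>1 - \<theta>\<close>, locality turns \<open>T 1 k\<close> into
    \<open>T \<theta> k\<close>, and \<open>\<theta>\<close> lives where \<mu> is small.\<close>
  define h where "h x = clamp01 (4 + (- (1 / r)) * infdist x F)" for x
  define \<theta> where "\<theta> x = clamp01 (-1 + (1 / r) * infdist x F)" for x
  have hl: "(1 / r)-lipschitz_on UNIV h" and \<theta>l: "(1 / r)-lipschitz_on UNIV \<theta>"
    using lipschitz_clamp01_affine[OF lipschitz_infdist, of "- (1 / r)" 4 F]
      lipschitz_clamp01_affine[OF lipschitz_infdist, of "1 / r" "-1" F] r
    unfolding h_def \<theta>_def by (auto simp del: mult_minus_left)
  have hb: "h \<in> Lip_bdd" and \<theta>b: "\<theta> \<in> Lip_bdd"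
    by (rule Lip_bddI[OF hl, of 1], simp add: h_def) (rule Lip_bddI[OF \<theta>l, of 1], simp add: \<theta>_def)
  define k where "k x = (1 - h x) * g x" for x
  have kl: "M-lipschitz_on UNIV k"
    unfolding k_def M_def
  proof (rule lipschitz_mult[OF _ gl])
    show "(1 / r)-lipschitz_on UNIV (\<lambda>x. 1 - h x)"
      using lipschitz_diff[OF lipschitz_on_constant[of UNIV 1] hl] by simp
  qed (use B in \<open>auto simp: h_def\<close>)
  have kb: "k \<in> Lip_bdd"
    unfolding k_def by (intro Lip_bdd_mult Lip_bdd_diff hb g) simp
  have g'b: "(\<lambda>x. h x * g x) \<in> Lip_bdd" by (intro Lip_bdd_mult hb g)
  have \<theta>'b: "(\<lambda>x. 1 - \<theta> x) \<in> Lip_bdd" by (intro Lip_bdd_diff \<theta>b) simp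
  have "T (\<lambda>_. 1) (\<lambda>x. h x * g x) = T (\<lambda>_. 1) (\<lambda>x. g x - k x)"
    by (simp add: k_def algebra_simps)
  also have "\<dots> = T (\<lambda>_. 1) g - T (\<lambda>_. 1) k"
    by (rule bilinear_diff_right[OF bil]) (use g kb in \<open>auto intro: Lip_bdd_Lip\<close>)
  finally have diff: "T (\<lambda>_. 1) g - T (\<lambda>_. 1) (\<lambda>x. h x * g x) = T (\<lambda>_. 1) k" by simp
  have "T (\<lambda>x. 1 - \<theta> x) k = 0"
  proof (rule current_local[OF T \<theta>'b Lip_bdd_Lip[OF kb]])
    show "open {x. infdist x F < 3 * r}"
      by (intro open_Collect_less continuous_intros)
    show "fun_spt (\<lambda>x. 1 - \<theta> x) \<subseteq> {x. infdist x F < 3 * r}"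
    proof -
      have cl: "closed {x. infdist x F \<le> 2 * r}"
        by (intro closed_Collect_le continuous_intros)
      have "{x. 1 - \<theta> x \<noteq> 0} \<subseteq> {x. infdist x F \<le> 2 * r}"
      proof
        fix x assume "x \<in> {x. 1 - \<theta> x \<noteq> 0}"
        then have "\<not> 1 \<le> -1 + (1 / r) * infdist x F" using clamp01_eq_1 by (auto simp: \<theta>_def)
        then show "x \<in> {x. infdist x F \<le> 2 * r}" using r by (simp add: field_simps)
      qed
      then have "fun_spt (\<lambda>x. 1 - \<theta> x) \<subseteq> {x. infdist x F \<le> 2 * r}"
        unfolding fun_spt_def using cl by (rule closure_minimal)
      also have "\<dots> \<subseteq> {x. infdist x F < 3 * r}" using r by auto
      finally show ?thesis .
    qed
    fix x assume "x \<in> {x. infdist x F < 3 * r}"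
    then have "1 \<le> 4 + (- (1 / r)) * infdist x F" using r by (simp add: field_simps)
    then have "h x = 1" unfolding h_def by (rule clamp01_eq_1)
    then show "k x = 0" by (simp add: k_def)
  qed
  moreover have "T (\<lambda>x. 1 - \<theta> x) k = T (\<lambda>_. 1) k - T \<theta> k"
    by (rule bilinear_diff_left[OF bil]) (use \<theta>b kb in \<open>auto intro: Lip_bdd_Lip\<close>)
  ultimately have "T (\<lambda>_. 1) k = T \<theta> k" by simp
  also have "\<bar>\<dots>\<bar> \<le> M * (\<integral>x. \<bar>\<theta> x\<bar> \<partial>\<mu>)" by (rule mass_boundD[OF m \<theta>b kl])
  also have "\<dots> \<le> M * (\<eta> / M)"
  proof (intro mult_left_mono)
    have A: "{x. r < infdist x F} \<in> sets \<mu>"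
      unfolding sm by (intro borel_open open_Collect_less continuous_intros)
    have "(\<integral>x. \<bar>\<theta> x\<bar> \<partial>\<mu>) \<le> (\<integral>x. indicator {x. r < infdist x F} x \<partial>\<mu>)"
    proof (rule integral_mono')
      show "integrable \<mu> (\<lambda>x. indicator {x. r < infdist x F} x :: real)"
        using A by (intro integrable_const_bound[of _ 1] borel_measurable_indicator) auto
      fix x
      show "\<bar>\<theta> x\<bar> \<le> indicator {x. r < infdist x F} x"
      proof (cases "r < infdist x F")
        case False
        then have "-1 + (1 / r) * infdist x F \<le> 0" using r by (simp add: field_simps)
        then show ?thesis using clamp01_eq_0 by (simp add: \<theta>_def)
      qed (simp add: \<theta>_def)
    qed auto
    also have "\<dots> = measure \<mu> {x. r < infdist x F}"
      using A sets_eq_imp_space_eq[OF sm] by simp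
    finally show "(\<integral>x. \<bar>\<theta> x\<bar> \<partial>\<mu>) \<le> \<eta> / M" using F(3) by simp
  qed (use M in auto)
  finally have "\<bar>T (\<lambda>_. 1) k\<bar> \<le> \<eta>" using M by simp
  moreover have "infdist x F \<le> 4 * r" if "h x * g x \<noteq> 0" for x
  proof -
    have "\<not> 4 + (- (1 / r)) * infdist x F \<le> 0" using that clamp01_eq_0 by (auto simp: h_def)
    then show ?thesis using r by (simp add: field_simps)
  qed
  ultimately show ?thesis
    using F(1,2) g'b diff by (intro exI[of _ F] exI[of _ "\<lambda>x. h x * g x"]) auto
qed

text \<open>The balls are peeled off one at a time by a cut-off that is 1 on
  \<open>ball y \<rho>\<close> and supported in \<open>cball y (2 * \<rho>)\<close>. The part cut
  out is annihilated by assumption, the rest vanishes on the ball and lives on the remaining ones.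
  The factor 3 makes room for the closed support.\<close>

lemma current_finite_patch:
  fixes T :: "'a::metric_space functional"
  assumes T: "metric_current T" and I: "finite I"
    and "g \<in> Lip_bdd" "{x. g x \<noteq> 0} \<subseteq> (\<Union>(y, \<rho>)\<in>I. ball y \<rho>)"
    and "\<And>y \<rho>. (y, \<rho>) \<in> I \<Longrightarrow> \<rho> > 0"
    and "\<And>y \<rho> \<phi>. (y, \<rho>) \<in> I \<Longrightarrow> \<phi> \<in> Lip \<Longrightarrow> fun_spt \<phi> \<subseteq> ball y (3 * \<rho>) \<Longrightarrow> T (\<lambda>_. 1) \<phi> = 0"
  shows "T (\<lambda>_. 1) g = 0"
  using I assms(3-)
proof (induction I arbitrary: g rule: finite_induct)
  case empty
  \<comment> \<open>The zero function is presented as a linear combination with coefficients 0, so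
    that linearity yields the value 0.\<close>
  then have "g = (\<lambda>_. 0 * 0 + 0 * 0)" by auto
  then have "T (\<lambda>_. 1) g = T (\<lambda>_. 1) (\<lambda>_. 0 * 0 + 0 * 0)" by (rule arg_cong)
  also have "\<dots> = 0"
    using bilinear_right[OF current_bilinear[OF T], of "\<lambda>_. 1" "\<lambda>_. 0" "\<lambda>_. 0" 0 0] by simp
  finally show ?case .
next
  case (insert i I)
  obtain y \<rho> where i: "i = (y, \<rho>)" by (cases i)
  have \<rho>: "\<rho> > 0" using insert.prems(3)[of y \<rho>] i by auto
  define \<phi> where "\<phi> x = clamp01 (2 + (- (1 / \<rho>)) * infdist x {y})" for x
  have \<phi>b: "\<phi> \<in> Lip_bdd"
    unfolding \<phi>_def by (rule Lip_bddI[OF lipschitz_clamp01_affine[OF lipschitz_infdist], of _ _ _ 1]) auto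
  have b1: "(\<lambda>x. \<phi> x * g x) \<in> Lip_bdd" by (intro Lip_bdd_mult \<phi>b insert.prems)
  have b2: "(\<lambda>x. g x - \<phi> x * g x) \<in> Lip_bdd" by (intro Lip_bdd_diff b1 insert.prems)
  have "fun_spt (\<lambda>x. \<phi> x * g x) \<subseteq> cball y (2 * \<rho>)"
    unfolding fun_spt_def
  proof (rule closure_minimal)
    show "{x. \<phi> x * g x \<noteq> 0} \<subseteq> cball y (2 * \<rho>)"
    proof
      fix x assume "x \<in> {x. \<phi> x * g x \<noteq> 0}"
      then have "\<not> 2 + (- (1 / \<rho>)) * infdist x {y} \<le> 0" using clamp01_eq_0 by (auto simp: \<phi>_def)
      then show "x \<in> cball y (2 * \<rho>)" using \<rho> by (simp add: field_simps dist_commute)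
    qed
  qed simp
  also have "\<dots> \<subseteq> ball y (3 * \<rho>)" using \<rho> by auto
  finally have "T (\<lambda>_. 1) (\<lambda>x. \<phi> x * g x) = 0"
    using insert.prems(4)[of y \<rho>] Lip_bdd_Lip[OF b1] i by blast
  moreover have "T (\<lambda>_. 1) (\<lambda>x. g x - \<phi> x * g x) = 0"
  proof (rule insert.IH[OF b2])
    show "{x. g x - \<phi> x * g x \<noteq> 0} \<subseteq> (\<Union>(y, \<rho>)\<in>I. ball y \<rho>)"
    proof
      fix x assume x: "x \<in> {x. g x - \<phi> x * g x \<noteq> 0}"
      have "x \<notin> ball y \<rho>"
      proof
        assume "x \<in> ball y \<rho>"
        then have "1 \<le> 2 + (- (1 / \<rho>)) * infdist x {y}" using \<rho> by (simp add: field_simps dist_commute)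
        then have "\<phi> x = 1" unfolding \<phi>_def by (rule clamp01_eq_1)
        with x show False by simp
      qed
      moreover have "x \<in> (\<Union>(y, \<rho>)\<in>insert i I. ball y \<rho>)"
        using x insert.prems(2) by (intro subsetD[OF insert.prems(2)]) auto
      ultimately show "x \<in> (\<Union>(y, \<rho>)\<in>I. ball y \<rho>)" using i by auto
    qed
    show "\<rho> > 0" if "(y, \<rho>) \<in> I" for y \<rho> using insert.prems(3) that by blast
    show "T (\<lambda>_. 1) \<phi> = 0" if "(y, \<rho>) \<in> I" "\<phi> \<in> Lip" "fun_spt \<phi> \<subseteq> ball y (3 * \<rho>)" for y \<rho> \<phi>
      using insert.prems(4)[OF insertI2] that by blast
  qed
  moreover have "T (\<lambda>_. 1) (\<lambda>x. g x - \<phi> x * g x) = T (\<lambda>_. 1) g - T (\<lambda>_. 1) (\<lambda>x. \<phi> x * g x)"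
    by (rule bilinear_diff_right[OF current_bilinear[OF T]]) (use b1 insert.prems in \<open>auto intro: Lip_bdd_Lip\<close>)
  ultimately show ?case by simp
qed

section \<open>Compactness of nested closed sets with fine finite covers\<close>

lemma closed_totally_bounded_compact:
  fixes S :: "'a::complete_space set"
  assumes "\<And>e. e > 0 \<Longrightarrow> \<exists>F. finite F \<and> S \<subseteq> (\<Union>x\<in>F. cball x e)"
  shows "compact (closure S)"
  unfolding compact_eq_totally_bounded
proof (intro conjI allI impI)
  show "complete (closure S)" by (simp add: complete_eq_closed)
  fix e :: real assume e: "e > 0"
  then obtain F where F: "finite F" "S \<subseteq> (\<Union>x\<in>F. cball x (e / 2))" using assms[of "e / 2"] by auto
  have "closure S \<subseteq> (\<Union>x\<in>F. cball x (e / 2))"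
    using F by (intro closure_minimal closed_UN) auto
  also have "\<dots> \<subseteq> (\<Union>x\<in>F. ball x e)" using e by force
  finally show "\<exists>k. finite k \<and> closure S \<subseteq> (\<Union>x\<in>k. ball x e)" using F(1) by blast
qed

text \<open>Kuratowski's intersection theorem.\<close>

lemma decseq_closed_totally_bounded:
  fixes D :: "nat \<Rightarrow> 'a::complete_space set"
  assumes cl: "\<And>n. closed (D n)" and dec: "\<And>n. D (Suc n) \<subseteq> D n"
    and tb: "\<And>e. e > 0 \<Longrightarrow> \<exists>n F. finite F \<and> D n \<subseteq> (\<Union>x\<in>F. cball x e)"
  shows "compact (\<Inter>n. D n)"
    and "open V \<Longrightarrow> (\<Inter>n. D n) \<subseteq> V \<Longrightarrow> \<exists>n. D n \<subseteq> V"
proof -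
  have dec': "D n \<subseteq> D m" if "m \<le> n" for m n
    using lift_Suc_antimono_le[of D, OF dec that] .
  have "compact (closure (\<Inter>n. D n))"
  proof (rule closed_totally_bounded_compact)
    fix e :: real assume "e > 0"
    then obtain n F where "finite F" "D n \<subseteq> (\<Union>x\<in>F. cball x e)" using tb by blast
    then show "\<exists>F. finite F \<and> (\<Inter>n. D n) \<subseteq> (\<Union>x\<in>F. cball x e)" by blast
  qed
  then show "compact (\<Inter>n. D n)" using cl by (simp add: closure_closed closed_INT)
  assume V: "open V" "(\<Inter>n. D n) \<subseteq> V"
  show "\<exists>n. D n \<subseteq> V"
  proof (rule ccontr)
    assume "\<nexists>n. D n \<subseteq> V"
    then have "\<forall>n. \<exists>x. x \<in> D n \<and> x \<notin> V" by auto
    then obtain x where x: "\<And>n. x n \<in> D n" "\<And>n. x n \<notin> V" by metis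
    have "compact (closure (range x))"
    proof (rule closed_totally_bounded_compact)
      fix e :: real assume e: "e > 0"
      then obtain n F where F: "finite F" "D n \<subseteq> (\<Union>x\<in>F. cball x e)" using tb by blast
      \<comment> \<open>The terms beyond \<open>n\<close> lie in \<open>D n\<close>; the finitely
        many others are taken as centres themselves.\<close>
      have "x m \<in> (\<Union>y\<in>F \<union> x ` {..n}. cball y e)" for m
      proof (cases "m \<le> n")
        case True
        then show ?thesis using e by (intro UN_I[of "x m"]) auto
      next
        case False
        then have "x m \<in> D n" using x(1)[of m] dec'[of n m] by auto
        then show ?thesis using F(2) by blast
      qed
      then show "\<exists>F. finite F \<and> range x \<subseteq> (\<Union>x\<in>F. cball x e)"
        using F(1) by (intro exI[of _ "F \<union> x ` {..n}"] conjI image_subsetI) auto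
    qed
    then have "seq_compact (closure (range x))" by (rule compact_imp_seq_compact)
    then obtain l s where s: "strict_mono s" "(x \<circ> s) \<longlonglongrightarrow> l"
      by (rule seq_compactE[of _ x]) (auto intro: subsetD[OF closure_subset])
    have "l \<in> D n" for n
    proof (rule Lim_in_closed_set[OF cl _ _ s(2)])
      have "(x \<circ> s) m \<in> D n" if "m \<ge> n" for m
        using x(1)[of "s m"] dec'[of n "s m"] seq_suble[OF s(1), of m] that by auto
      then show "eventually (\<lambda>m. (x \<circ> s) m \<in> D n) sequentially"
        by (auto simp: eventually_sequentially)
    qed simp
    then have "l \<in> V" using V(2) by auto
    moreover have "l \<in> - V"
      using V(1) x(2) by (intro Lim_in_closed_set[OF _ _ _ s(2)]) (auto simp: closed_Compl)
    ultimately show False by simp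
  qed
qed


text \<open>No \<open>g n\<close> need have compact support, but the supports \<open>D n\<close> are
  nested, closed and admit ever finer finite covers. Their intersection is thus compact, finitely
  many balls on which the boundary vanishes cover it, and these balls already contain some
  \<open>D n\<close>.\<close>

lemma boundary_vanishes_bdd:
  fixes T :: "'a::{second_countable_topology, complete_space} functional"
  assumes T: "metric_current T" and f: "f \<in> Lip_bdd" and disj: "fun_spt f \<inter> boundary_spt T = {}"
  shows "T (\<lambda>_. 1) f = 0"
proof -
  have "\<bar>T (\<lambda>_. 1) f\<bar> \<le> 0 + \<eta>" if \<eta>: "\<eta> > 0" for \<eta>
  proof -
    \<comment> \<open>The scales \<open>(1 / 2) ^ n\<close> tend to 0 while the errors of all steps
      add up to at most \<eta>.\<close>
    have "\<forall>n g. \<exists>F g'. g \<in> Lip_bdd \<longrightarrow> finite F \<and> F \<noteq> {} \<and> g' \<in> Lip_bdd \<and>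
        \<bar>T (\<lambda>_. 1) g - T (\<lambda>_. 1) g'\<bar> \<le> \<eta> * (1 / 2) ^ Suc n \<and>
        (\<forall>x. g' x \<noteq> 0 \<longrightarrow> g x \<noteq> 0 \<and> infdist x F \<le> 4 * (1 / 2) ^ n)"
      using current_cutoff_step[OF T] \<eta> by (simp add: zero_less_power del: power_Suc)
    then obtain NF NG where N: "\<And>n g. g \<in> Lip_bdd \<Longrightarrow> finite (NF n g) \<and> NF n g \<noteq> {} \<and> NG n g \<in> Lip_bdd \<and>
        \<bar>T (\<lambda>_. 1) g - T (\<lambda>_. 1) (NG n g)\<bar> \<le> \<eta> * (1 / 2) ^ Suc n \<and>
        (\<forall>x. NG n g x \<noteq> 0 \<longrightarrow> g x \<noteq> 0 \<and> infdist x (NF n g) \<le> 4 * (1 / 2) ^ n)"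
      by metis
    define g where "g = rec_nat f NG"
    have g0: "g 0 = f" and gS: "g (Suc n) = NG n (g n)" for n by (auto simp: g_def)
    have gb: "g n \<in> Lip_bdd" for n by (induction n) (use f N in \<open>auto simp: g0 gS\<close>)
    define F where "F n = NF n (g n)" for n
    have F: "finite (F n)" "F n \<noteq> {}"
      and dist: "\<bar>T (\<lambda>_. 1) (g n) - T (\<lambda>_. 1) (g (Suc n))\<bar> \<le> \<eta> * (1 / 2) ^ Suc n"
      and sub: "\<And>x. g (Suc n) x \<noteq> 0 \<Longrightarrow> g n x \<noteq> 0 \<and> infdist x (F n) \<le> 4 * (1 / 2) ^ n" for n
      using N[OF gb, of n n] by (auto simp: F_def gS)
    have tot: "\<bar>T (\<lambda>_. 1) f - T (\<lambda>_. 1) (g n)\<bar> \<le> \<eta> * (1 - (1 / 2) ^ n)" for n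
    proof (induction n)
      case (Suc n)
      have "\<bar>T (\<lambda>_. 1) f - T (\<lambda>_. 1) (g (Suc n))\<bar> \<le> \<eta> * (1 - (1 / 2) ^ n) + \<eta> * (1 / 2) ^ Suc n"
        using Suc dist[of n] by linarith
      then show ?case by (simp add: algebra_simps)
    qed (simp add: g0)
    define D where "D n = fun_spt (g n)" for n
    have D0: "D n \<subseteq> fun_spt f" for n
    proof (induction n)
      case (Suc n)
      have "D (Suc n) \<subseteq> D n"
        unfolding D_def fun_spt_def using sub by (intro closure_mono) auto
      with Suc show ?case by blast
    qed (simp add: D_def g0)
    have cl: "closed (D n)" for n by (simp add: D_def fun_spt_def)
    have dec: "D (Suc n) \<subseteq> D n" for n
      unfolding D_def fun_spt_def using sub by (intro closure_mono) auto
    have tb: "\<exists>n F. finite F \<and> D n \<subseteq> (\<Union>x\<in>F. cball x e)" if e: "e > 0" for e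
    proof -
      obtain n where n: "(1 / 2) ^ n < e / 4"
        using real_arch_pow_inv[of "e / 4" "1 / 2"] e by auto
      have "{x. g (Suc n) x \<noteq> 0} \<subseteq> (\<Union>y\<in>F n. cball y e)"
      proof
        fix x assume "x \<in> {x. g (Suc n) x \<noteq> 0}"
        then have "infdist x (F n) \<le> 4 * (1 / 2) ^ n" using sub by blast
        also have "\<dots> \<le> e" using n by simp
        finally have le: "infdist x (F n) \<le> e" .
        \<comment> \<open>The distance to a finite nonempty set is attained, so the bound on it
          becomes a cover by closed balls.\<close>
        have "infdist x (F n) = Min (dist x ` F n)"
          using F[of n] by (simp add: infdist_notempty cInf_eq_Min)
        then have "infdist x (F n) \<in> dist x ` F n"
          using Min_in[of "dist x ` F n"] F[of n] by simp
        then obtain y where "y \<in> F n" "infdist x (F n) = dist x y" by blast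
        with le show "x \<in> (\<Union>y\<in>F n. cball y e)" by (auto simp: dist_commute)
      qed
      then have "D (Suc n) \<subseteq> (\<Union>y\<in>F n. cball y e)"
        unfolding D_def fun_spt_def using F(1) by (intro closure_minimal closed_UN) auto
      with F(1) show ?thesis by blast
    qed
    \<comment> \<open>The radius is a third of the one on which the boundary vanishes, as
      \<open>current_finite_patch\<close> requires.\<close>
    define good where "good y \<rho> \<longleftrightarrow> \<rho> > 0 \<and> (\<forall>\<phi>\<in>Lip. fun_spt \<phi> \<subseteq> ball y (3 * \<rho>) \<longrightarrow> T (\<lambda>_. 1) \<phi> = 0)" for y and \<rho> :: real
    have "\<exists>\<rho>. good x \<rho>" if x: "x \<in> (\<Inter>n. D n)" for x
    proof -
      have "x \<notin> boundary_spt T" using x D0 disj by blast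
      then obtain U where U: "open U" "x \<in> U" "\<And>\<phi>. \<phi> \<in> Lip \<Longrightarrow> fun_spt \<phi> \<subseteq> U \<Longrightarrow> T (\<lambda>_. 1) \<phi> = 0"
        unfolding boundary_spt_def current_boundary_def by blast
      then obtain e where "e > 0" "ball x e \<subseteq> U" unfolding open_contains_ball by blast
      then have "good x (e / 3)" unfolding good_def using U(3) by auto
      then show ?thesis ..
    qed
    then obtain \<rho> where \<rho>: "\<And>x. x \<in> (\<Inter>n. D n) \<Longrightarrow> good x (\<rho> x)" by metis
    have "compact (\<Inter>n. D n)" by (rule decseq_closed_totally_bounded(1)[OF cl dec tb])
    moreover have "(\<Inter>n. D n) \<subseteq> (\<Union>x\<in>(\<Inter>n. D n). ball x (\<rho> x))"
      using \<rho> by (force simp: good_def)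
    ultimately obtain C where C: "C \<subseteq> (\<Inter>n. D n)" "finite C" "(\<Inter>n. D n) \<subseteq> (\<Union>x\<in>C. ball x (\<rho> x))"
      using compactE_image[of "\<Inter>n. D n" "\<Inter>n. D n" "\<lambda>x. ball x (\<rho> x)"] by (metis open_ball)
    obtain n where n: "D n \<subseteq> (\<Union>x\<in>C. ball x (\<rho> x))"
      using decseq_closed_totally_bounded(2)[OF cl dec tb _ C(3)] by auto
    have "T (\<lambda>_. 1) (g n) = 0"
    proof (rule current_finite_patch[OF T _ gb])
      show "finite ((\<lambda>x. (x, \<rho> x)) ` C)" using C(2) by simp
      have "{x. g n x \<noteq> 0} \<subseteq> D n" unfolding D_def fun_spt_def by (rule closure_subset)
      then show "{x. g n x \<noteq> 0} \<subseteq> (\<Union>(y, \<rho>)\<in>(\<lambda>x. (x, \<rho> x)) ` C. ball y \<rho>)" using n by auto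
    qed (use \<rho> C(1) in \<open>auto simp: good_def\<close>)
    then have "\<bar>T (\<lambda>_. 1) f\<bar> \<le> \<eta> * (1 - (1 / 2) ^ n)" using tot[of n] by simp
    also have "\<dots> \<le> \<eta> * 1" using \<eta> by (intro mult_left_mono) auto
    finally show ?thesis by simp
  qed
  then have "\<bar>T (\<lambda>_. 1) f\<bar> \<le> 0" by (rule field_le_epsilon)
  then show ?thesis by simp
qed

text \<open>Truncation at heights \<open>- n\<close> and \<open>n\<close> increases neither the
  Lipschitz constant nor the support and converges pointwise, so continuity of the current carries
  the bounded case over.\<close>

lemma boundary_vanishes:
  fixes T :: "'a::{second_countable_topology, complete_space} functional"
  assumes T: "metric_current T" and f: "f \<in> Lip" and disj: "fun_spt f \<inter> boundary_spt T = {}"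
  shows "T (\<lambda>_. 1) f = 0"
proof -
  define P where "P n x = max (- real n) (min (real n) (f x))" for n x
  have Pl: "(lip_const f)-lipschitz_on UNIV (P n)" for n
  proof (rule lipschitz_onI)
    fix x y
    have "dist (P n x) (P n y) \<le> dist (f x) (f y)" by (auto simp: P_def dist_real_def)
    also have "\<dots> \<le> lip_const f * dist x y" using lipschitz_onD[OF lip_const_lipschitz[OF f]] by simp
    finally show "dist (P n x) (P n y) \<le> lip_const f * dist x y" .
  qed (rule lip_const_nonneg[OF f])
  have Pb: "P n \<in> Lip_bdd" for n
    by (rule Lip_bddI[OF Pl, of _ "real n"]) (auto simp: P_def)
  have "T (\<lambda>_. 1) (P n) = 0" for n
  proof (rule boundary_vanishes_bdd[OF T Pb])
    have "fun_spt (P n) \<subseteq> fun_spt f"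
      unfolding fun_spt_def by (rule closure_mono) (auto simp: P_def)
    then show "fun_spt (P n) \<inter> boundary_spt T = {}" using disj by blast
  qed
  moreover have "(\<lambda>n. T (\<lambda>_. 1) (P n)) \<longlonglongrightarrow> T (\<lambda>_. 1) f"
  proof (rule current_continuous[OF T _ Pl f])
    fix x
    obtain N :: nat where N: "\<bar>f x\<bar> \<le> real N" using real_arch_simple by blast
    have "P n x = f x" if "n \<ge> N" for n
    proof -
      have "\<bar>f x\<bar> \<le> real n" using N that by linarith
      then show ?thesis by (auto simp: P_def)
    qed
    then show "(\<lambda>n. P n x) \<longlonglongrightarrow> f x"
      by (intro tendsto_eventually) (auto simp: eventually_sequentially)
  qed simp
  ultimately show ?thesis by (simp add: LIMSEQ_const_iff)
qed

subsection \<open>Decomposition of the boundary into dipoles\<close>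

text \<open>Helly's one-step extension, repeated over finitely many coordinates: the new coefficient
  must lie between all lower bounds \<open>s g\<close> and all upper bounds \<open>u h\<close>, and
  subadditivity of \<open>q\<close> at \<open>(g - e) + (h + e)\<close> says that these are
  compatible.\<close>

lemma finite_hahn_banach:
  fixes q :: "('i \<Rightarrow> real) \<Rightarrow> real"
  assumes fin: "finite I" and sub: "\<And>g h. q (\<lambda>i. g i + h i) \<le> q g + q h"
    and hom: "\<And>c h. c > 0 \<Longrightarrow> q (\<lambda>i. c * h i) = c * q h"
  shows "\<exists>a. \<forall>h. (\<forall>i. i \<notin> I \<longrightarrow> h i = 0) \<longrightarrow> (\<Sum>i\<in>I. a i * h i) \<le> q h"
  using fin
proof (induction I rule: finite_induct)
  case empty
  have "q (\<lambda>_. 0) \<le> q (\<lambda>_. 0) + q (\<lambda>_. 0)" using sub[of "\<lambda>_. 0" "\<lambda>_. 0"] by simp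
  then have "0 \<le> q h" if "\<forall>i. h i = 0" for h using that by (subgoal_tac "h = (\<lambda>_. 0)") auto
  then show ?case by simp
next
  case (insert j I)
  then obtain a where a: "\<And>h. (\<And>i. i \<notin> I \<Longrightarrow> h i = 0) \<Longrightarrow> (\<Sum>i\<in>I. a i * h i) \<le> q h" by blast
  define V where "V = {h :: 'i \<Rightarrow> real. \<forall>i. i \<notin> I \<longrightarrow> h i = 0}"
  define e where "e i = (if i = j then 1 else 0 :: real)" for i
  define s where "s h = (\<Sum>i\<in>I. a i * h i) - q (\<lambda>i. h i - e i)" for h
  define u where "u h = q (\<lambda>i. h i + e i) - (\<Sum>i\<in>I. a i * h i)" for h
  have su: "s g \<le> u h" if "g \<in> V" "h \<in> V" for g h
  proof -
    have "(\<Sum>i\<in>I. a i * g i) + (\<Sum>i\<in>I. a i * h i) = (\<Sum>i\<in>I. a i * (g i + h i))"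
      by (simp add: sum.distrib algebra_simps)
    also have "\<dots> \<le> q (\<lambda>i. g i + h i)" using that by (intro a) (auto simp: V_def)
    also have "\<dots> = q (\<lambda>i. (g i - e i) + (h i + e i))" by simp
    also have "\<dots> \<le> q (\<lambda>i. g i - e i) + q (\<lambda>i. h i + e i)" by (rule sub)
    finally show ?thesis by (simp add: s_def u_def)
  qed
  define \<alpha> where "\<alpha> = (SUP g\<in>V. s g)"
  have V0: "(\<lambda>_. 0) \<in> V" by (simp add: V_def)
  have bdd: "bdd_above (s ` V)" by (rule bdd_aboveI2[OF su[OF _ V0]])
  have s\<alpha>: "s g \<le> \<alpha>" if "g \<in> V" for g unfolding \<alpha>_def by (rule cSUP_upper[OF that bdd])
  have \<alpha>u: "\<alpha> \<le> u h" if "h \<in> V" for h unfolding \<alpha>_def by (rule cSUP_least) (use V0 su that in auto)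
  have "(\<Sum>i\<in>insert j I. (a(j := \<alpha>)) i * h i) \<le> q h" if h: "\<And>i. i \<notin> insert j I \<Longrightarrow> h i = 0" for h
  proof -
    define k where "k = h(j := 0)"
    have kV: "k \<in> V" using h by (auto simp: V_def k_def)
    have cV: "(\<lambda>i. c * k i) \<in> V" for c using kV by (simp add: V_def)
    have sum: "(\<Sum>i\<in>insert j I. (a(j := \<alpha>)) i * h i) = \<alpha> * h j + (\<Sum>i\<in>I. a i * k i)"
    proof -
      have "(\<Sum>i\<in>I. (a(j := \<alpha>)) i * h i) = (\<Sum>i\<in>I. a i * k i)"
        using insert.hyps by (intro sum.cong) (auto simp: k_def)
      then show ?thesis using insert.hyps by simp
    qed
    have hk: "h = (\<lambda>i. k i + h j * e i)" by (auto simp: k_def e_def)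
    have scale: "(\<Sum>i\<in>I. a i * k i) = c * (\<Sum>i\<in>I. a i * (1 / c * k i))" if "c > 0" for c
      using that by (simp add: sum_distrib_left)
    \<comment> \<open>Homogeneity normalizes a nonzero coordinate \<open>h j\<close> to 1 or to -1;
      the first case uses an upper bound of \<open>\<alpha>\<close>, the second a lower one.\<close>
    consider "h j = 0" | "h j > 0" | "h j < 0" by linarith
    then have "\<alpha> * h j + (\<Sum>i\<in>I. a i * k i) \<le> q h"
    proof cases
      case 1
      then have "h = k" by (auto simp: k_def)
      then show ?thesis using 1 a[of k] kV by (simp add: V_def)
    next
      case 2
      define c where "c = h j"
      have c: "c > 0" using 2 by (simp add: c_def)
      have "h = (\<lambda>i. c * (1 / c * k i + e i))" using c by (subst hk) (simp add: c_def[symmetric] algebra_simps)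
      then have "q h = c * q (\<lambda>i. 1 / c * k i + e i)" using hom[OF c, of "\<lambda>i. 1 / c * k i + e i"] by simp
      moreover have "\<alpha> + (\<Sum>i\<in>I. a i * (1 / c * k i)) \<le> q (\<lambda>i. 1 / c * k i + e i)"
        using \<alpha>u[OF cV[of "1 / c"]] by (simp add: u_def)
      then have "c * (\<alpha> + (\<Sum>i\<in>I. a i * (1 / c * k i))) \<le> c * q (\<lambda>i. 1 / c * k i + e i)"
        using c by (intro mult_left_mono) auto
      ultimately show ?thesis unfolding scale[OF c] by (simp add: c_def algebra_simps)
    next
      case 3
      define c where "c = - h j"
      have c: "c > 0" using 3 by (simp add: c_def)
      have "h = (\<lambda>i. c * (1 / c * k i - e i))" using c by (subst hk) (simp add: c_def algebra_simps)
      then have "q h = c * q (\<lambda>i. 1 / c * k i - e i)" using hom[OF c, of "\<lambda>i. 1 / c * k i - e i"] by simp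
      moreover have "(\<Sum>i\<in>I. a i * (1 / c * k i)) - \<alpha> \<le> q (\<lambda>i. 1 / c * k i - e i)"
        using s\<alpha>[OF cV[of "1 / c"]] by (simp add: s_def)
      then have "c * ((\<Sum>i\<in>I. a i * (1 / c * k i)) - \<alpha>) \<le> c * q (\<lambda>i. 1 / c * k i - e i)"
        using c by (intro mult_left_mono) auto
      ultimately show ?thesis unfolding scale[OF c] by (simp add: c_def algebra_simps)
    qed
    then show ?thesis unfolding sum .
  qed
  then show ?case by (intro exI[of _ "a(j := \<alpha>)"]) blast
qed

text \<open>McShane's extension; over a finite set its infimum is an attained minimum.\<close>

lemma lipschitz_extend_finite:
  fixes f :: "'a::metric_space \<Rightarrow> real"
  assumes F: "finite F" and K: "K \<ge> 0" and f: "\<And>x y. x \<in> F \<Longrightarrow> y \<in> F \<Longrightarrow> f x - f y \<le> K * dist x y"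
  obtains g where "K-lipschitz_on UNIV g" "\<And>x. x \<in> F \<Longrightarrow> g x = f x"
proof (cases "F = {}")
  case True
  show ?thesis
    by (rule that[of "\<lambda>_. 0"]) (use True K in \<open>auto intro: lipschitz_on_le[OF lipschitz_on_constant]\<close>)
next
  case False
  define g where "g x = Min ((\<lambda>y. f y + K * dist x y) ` F)" for x
  have le: "g x \<le> f y + K * dist x y" if "y \<in> F" for x y
    unfolding g_def using F that by (intro Min_le) auto
  have att: "\<exists>y\<in>F. g x = f y + K * dist x y" for x
  proof -
    have "g x \<in> (\<lambda>y. f y + K * dist x y) ` F"
      unfolding g_def using F False by (intro Min_in) auto
    then show ?thesis by blast
  qed
  have one: "g x - g z \<le> K * dist x z" for x z
  proof -
    obtain y where y: "y \<in> F" "g z = f y + K * dist z y" using att by blast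
    have "g x \<le> f y + K * dist x y" by (rule le[OF y(1)])
    also have "\<dots> \<le> f y + K * (dist x z + dist z y)"
      using K by (intro add_left_mono mult_left_mono dist_triangle)
    finally show ?thesis using y(2) by (simp add: algebra_simps)
  qed
  show ?thesis
  proof (rule that[of g])
    show "K-lipschitz_on UNIV g"
    proof (rule lipschitz_onI)
      show "dist (g x) (g y) \<le> K * dist x y" for x y
        using one[of x y] one[of y x] by (simp add: dist_real_def dist_commute abs_le_iff)
    qed (rule K)
    fix x assume x: "x \<in> F"
    obtain y where y: "y \<in> F" "g x = f y + K * dist x y" using att by blast
    show "g x = f x" using le[OF x, of x] f[OF x y(1)] y(2) by simp
  qed
qed

text \<open>The Arzela-Ascoli argument for pointwise convergence: vanishing at \<open>z\<close>
  bounds the values at each point, a diagonal subsequence converges on a countable dense set, and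
  the common Lipschitz constant carries convergence to all points.\<close>

lemma lipschitz_subsequence:
  fixes u :: "nat \<Rightarrow> 'a::{second_countable_topology, metric_space} \<Rightarrow> real"
  assumes u: "\<And>n. 1-lipschitz_on UNIV (u n)" and z: "\<And>n. u n z = 0"
  obtains s p where "strict_mono s" "1-lipschitz_on UNIV p" "\<And>x. (\<lambda>n. u (s n) x) \<longlonglongrightarrow> p x"
proof -
  obtain D :: "'a set" where D: "countable D" "\<And>X. open X \<Longrightarrow> X \<noteq> {} \<Longrightarrow> \<exists>d\<in>D. d \<in> X"
    using countable_dense_setE by blast
  have ne: "D \<noteq> {}" using D(2)[of UNIV] by auto
  define d where "d = from_nat_into D"
  have rd: "range d = D" using ne D(1) by (simp add: d_def range_from_nat_into)
  define P where "P n s = convergent (\<lambda>k. u (s k) (d n))" for n and s :: "nat \<Rightarrow> nat"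
  interpret subseqs P
  proof
    fix n and s :: "nat \<Rightarrow> nat"
    have "u (s k) (d n) \<in> {- dist (d n) z..dist (d n) z}" for k
      using lipschitz_onD[OF u, of "d n" z "s k"] z[of "s k"] by (auto simp: dist_real_def abs_le_iff)
    moreover have "seq_compact {- dist (d n) z..dist (d n) z}"
      by (intro compact_imp_seq_compact compact_Icc)
    ultimately obtain l r where "strict_mono r" "((\<lambda>k. u (s k) (d n)) \<circ> r) \<longlonglongrightarrow> l"
      using seq_compactE[of "{- dist (d n) z..dist (d n) z}" "\<lambda>k. u (s k) (d n)"] by metis
    then show "\<exists>r'. strict_mono r' \<and> P n (s \<circ> r')"
      unfolding P_def convergent_def by (auto simp: o_def)
  qed
  have conv: "convergent (\<lambda>k. u (diagseq k) (d n))" for n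
  proof -
    \<comment> \<open>Only from index \<open>Suc n\<close> on is the diagonal sequence a subsequence
      of the one chosen for \<open>d n\<close>; the shift is undone by
      \<open>LIMSEQ_offset\<close>.\<close>
    have "P n (diagseq \<circ> ((+) (Suc n)))"
    proof (rule diagseq_holds)
      fix r s :: "nat \<Rightarrow> nat" and n assume "strict_mono r" "P n s"
      then show "P n (s \<circ> r)"
        unfolding P_def convergent_def using LIMSEQ_subseq_LIMSEQ[of "\<lambda>k. u (s k) (d n)" _ r] by (auto simp: o_def)
    qed
    then obtain l where "(\<lambda>k. u (diagseq (Suc n + k)) (d n)) \<longlonglongrightarrow> l"
      unfolding P_def convergent_def by (auto simp: o_def)
    then have "(\<lambda>k. u (diagseq (k + Suc n)) (d n)) \<longlonglongrightarrow> l" by (simp add: add.commute)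
    then have "(\<lambda>k. u (diagseq k) (d n)) \<longlonglongrightarrow> l" by (rule LIMSEQ_offset)
    then show ?thesis by (auto simp: convergent_def)
  qed
  have "Cauchy (\<lambda>k. u (diagseq k) x)" for x
  proof (rule metric_CauchyI)
    fix e :: real assume e: "e > 0"
    obtain y where "y \<in> D" "y \<in> ball x (e / 3)" using D(2)[of "ball x (e / 3)"] e by auto
    then obtain n where n: "dist x (d n) < e / 3" using rd by (metis imageE mem_ball)
    obtain M where M: "\<And>i j. i \<ge> M \<Longrightarrow> j \<ge> M \<Longrightarrow> dist (u (diagseq i) (d n)) (u (diagseq j) (d n)) < e / 3"
      using metric_CauchyD[OF convergent_Cauchy[OF conv[of n]], of "e / 3"] e by auto
    have "dist (u (diagseq i) x) (u (diagseq j) x) < e" if "i \<ge> M" "j \<ge> M" for i j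
    proof -
      have "dist (u (diagseq i) x) (u (diagseq j) x) \<le> dist (u (diagseq i) x) (u (diagseq i) (d n))
          + dist (u (diagseq i) (d n)) (u (diagseq j) (d n)) + dist (u (diagseq j) x) (u (diagseq j) (d n))"
        unfolding dist_real_def by linarith
      with M[OF that] n lipschitz_onD[OF u, of x "d n" "diagseq i"] lipschitz_onD[OF u, of x "d n" "diagseq j"]
      show ?thesis by simp
    qed
    then show "\<exists>M. \<forall>m\<ge>M. \<forall>n\<ge>M. dist (u (diagseq m) x) (u (diagseq n) x) < e" by blast
  qed
  then have "\<exists>l. (\<lambda>k. u (diagseq k) x) \<longlonglongrightarrow> l" for x
    by (meson Cauchy_convergent_iff convergent_def)
  then obtain p where p: "\<And>x. (\<lambda>k. u (diagseq k) x) \<longlonglongrightarrow> p x" by metis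
  have "1-lipschitz_on UNIV p"
  proof (rule lipschitz_onI)
    fix x y
    show "dist (p x) (p y) \<le> 1 * dist x y"
      by (rule LIMSEQ_le_const2[OF tendsto_dist[OF p p]]) (use lipschitz_onD[OF u] in auto)
  qed simp
  with subseq_diagseq p show ?thesis by (intro that[of diagseq p])
qed

text \<open>
  The elements of norm at most \<open>N\<close> of the Lipschitz-free space over \<open>A\<close>, as functionals on \<^const>\<open>Lip\<close>.
  The boundary of a current is one, for \<open>A\<close> any neighbourhood of its support.
\<close>

definition KR_functional :: "'a::metric_space set \<Rightarrow> real \<Rightarrow> (('a \<Rightarrow> real) \<Rightarrow> real) \<Rightarrow> bool" where
  "KR_functional A N m \<longleftrightarrow>
     (\<forall>f\<in>Lip. \<forall>g\<in>Lip. \<forall>a b. m (\<lambda>x. a * f x + b * g x) = a * m f + b * m g) \<and>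
     (\<forall>P p L. (\<forall>j::nat. L-lipschitz_on UNIV (P j)) \<longrightarrow> p \<in> Lip \<longrightarrow> (\<forall>x. (\<lambda>j. P j x) \<longlonglongrightarrow> p x) \<longrightarrow>
        (\<lambda>j. m (P j)) \<longlonglongrightarrow> m p) \<and>
     (\<forall>f L. L-lipschitz_on UNIV f \<longrightarrow> \<bar>m f\<bar> \<le> N * L) \<and>
     (\<forall>f\<in>Lip. \<forall>c. (\<forall>x\<in>A. f x = c) \<longrightarrow> m f = 0)"

section \<open>The clauses of \<open>KR_functional\<close> as rules\<close>

lemma KR_lincomb:
  assumes "KR_functional A N m" "f \<in> Lip" "g \<in> Lip"
  shows "m (\<lambda>x. a * f x + b * g x) = a * m f + b * m g"
proof -
  from assms(1) have "\<forall>f\<in>Lip. \<forall>g\<in>Lip. \<forall>a b. m (\<lambda>x. a * f x + b * g x) = a * m f + b * m g"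
    unfolding KR_functional_def by (rule conjunct1)
  from this[THEN bspec, OF assms(2), THEN bspec, OF assms(3), THEN spec, THEN spec, of a b]
  show ?thesis .
qed

lemma KR_cont:
  fixes P :: "nat \<Rightarrow> 'a::metric_space \<Rightarrow> real"
  assumes m: "KR_functional A N m" and P: "\<And>j. L-lipschitz_on UNIV (P j)"
    and p: "p \<in> Lip" "\<And>x. (\<lambda>j. P j x) \<longlonglongrightarrow> p x"
  shows "(\<lambda>j. m (P j)) \<longlonglongrightarrow> m p"
proof -
  from m have "\<forall>P p L. (\<forall>j::nat. L-lipschitz_on UNIV (P j)) \<longrightarrow> p \<in> Lip \<longrightarrow> (\<forall>x. (\<lambda>j. P j x) \<longlonglongrightarrow> p x) \<longrightarrow>
        (\<lambda>j. m (P j)) \<longlonglongrightarrow> m p"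
    unfolding KR_functional_def by (elim conjE)
  from this[THEN spec, of P, THEN spec, of p, THEN spec, of L] show ?thesis
    using P p by simp
qed

lemma KR_bound:
  assumes "KR_functional A N m" "L-lipschitz_on UNIV f"
  shows "\<bar>m f\<bar> \<le> N * L"
proof -
  from assms(1) have "\<forall>f L. L-lipschitz_on UNIV f \<longrightarrow> \<bar>m f\<bar> \<le> N * L"
    unfolding KR_functional_def by (elim conjE)
  from this[THEN spec, of f, THEN spec, of L] assms(2) show ?thesis by (rule mp)
qed

lemma KR_const:
  assumes m: "KR_functional A N m" and f: "f \<in> Lip" "\<And>x. x \<in> A \<Longrightarrow> f x = c"
  shows "m f = 0"
proof -
  from m have "\<forall>f\<in>Lip. \<forall>c. (\<forall>x\<in>A. f x = c) \<longrightarrow> m f = 0"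
    unfolding KR_functional_def by (elim conjE)
  from this[THEN bspec, OF f(1), THEN spec, of c] show ?thesis using f(2) by blast
qed

lemma KR_diff:
  assumes "KR_functional A N m" "f \<in> Lip" "g \<in> Lip"
  shows "m (\<lambda>x. f x - g x) = m f - m g"
  using KR_lincomb[OF assms, of 1 "-1"] by simp

lemma KR_add:
  assumes "KR_functional A N m" "f \<in> Lip" "g \<in> Lip"
  shows "m (\<lambda>x. f x + g x) = m f + m g"
  using KR_lincomb[OF assms, of 1 1] by simp

lemma KR_cmult:
  assumes "KR_functional A N m" "f \<in> Lip"
  shows "m (\<lambda>x. c * f x) = c * m f"
  using KR_lincomb[OF assms assms(2), of c 0] by simp

lemma KR_nonneg: "KR_functional A N m \<Longrightarrow> 0 \<le> N"
proof -
  assume m: "KR_functional A N m"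
  have "1-lipschitz_on UNIV (\<lambda>_::'a. 0::real)"
    by (rule lipschitz_on_le[OF lipschitz_on_constant]) simp
  from KR_bound[OF m this] show ?thesis by simp
qed

text \<open>The dense points must lie in \<open>A\<close> itself, as they become end points of
  dipoles: one is picked from each basic open set that meets \<open>A\<close>.\<close>

lemma countable_dense_subset:
  fixes A :: "'a::{second_countable_topology, metric_space} set"
  obtains D where "countable D" "D \<subseteq> A" "A \<subseteq> closure D"
proof -
  obtain B :: "'a set set" where B: "countable B" "topological_basis B"
    using ex_countable_basis by auto
  define D where "D = (\<lambda>U. SOME x. x \<in> U \<inter> A) ` {U \<in> B. U \<inter> A \<noteq> {}}"
  have pick: "(SOME x. x \<in> U \<inter> A) \<in> U \<inter> A" if "U \<inter> A \<noteq> {}" for U :: "'a set"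
    using that unfolding some_in_eq .
  show ?thesis
  proof (rule that[of D])
    show "countable D" using B(1) by (simp add: D_def)
    show "D \<subseteq> A" using pick by (auto simp: D_def)
    show "A \<subseteq> closure D"
    proof
      fix x assume x: "x \<in> A"
      show "x \<in> closure D"
        unfolding closure_iff_nhds_not_empty
      proof (intro allI impI)
        fix X V :: "'a set" assume V: "V \<subseteq> X" "open V" "x \<in> V"
        obtain U where U: "U \<in> B" "x \<in> U" "U \<subseteq> V" using topological_basisE[OF B(2) V(2,3)] by metis
        then have "U \<inter> A \<noteq> {}" using x by auto
        then have "(SOME x. x \<in> U \<inter> A) \<in> D" "(SOME x. x \<in> U \<inter> A) \<in> V"
          using pick[of U] U by (auto simp: D_def)
        then show "D \<inter> X \<noteq> {}" using V(1) by blast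
      qed
    qed
  qed
qed

text \<open>Otherwise there are 1-Lipschitz functions vanishing at the first \<open>n\<close> points
  of a dense sequence of \<open>A\<close> on which \<open>m\<close> stays above \<eta> in absolute
  value. A subsequence converges pointwise to a function that vanishes on \<open>A\<close>, where
  \<open>m\<close> gives 0, against the continuity of \<open>m\<close>.\<close>

lemma KR_finite_test:
  fixes m :: "('a::{second_countable_topology, metric_space} \<Rightarrow> real) \<Rightarrow> real"
  assumes m: "KR_functional A N m" and e: "\<eta> > 0"
  obtains F where "finite F" "F \<subseteq> A"
    "\<And>f L. L-lipschitz_on UNIV f \<Longrightarrow> (\<And>x. x \<in> F \<Longrightarrow> f x = 0) \<Longrightarrow> \<bar>m f\<bar> \<le> \<eta> * L"
proof (cases "A = {}")
  case True
  show ?thesis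
  proof (rule that[of "{}"])
    fix f :: "'a \<Rightarrow> real" and L assume f: "L-lipschitz_on UNIV f"
    have "m f = 0" by (rule KR_const[OF m LipI[OF f]]) (simp add: True)
    then show "\<bar>m f\<bar> \<le> \<eta> * L" using e lipschitz_on_nonneg[OF f] by simp
  qed auto
next
  case False
  obtain D where D: "countable D" "D \<subseteq> A" "A \<subseteq> closure D" using countable_dense_subset[of A] by metis
  have ne: "D \<noteq> {}" using D(3) False by auto
  define z where "z = from_nat_into D"
  have rz: "range z = D" using ne D(1) by (simp add: z_def range_from_nat_into)
  have "\<exists>n. \<forall>f L. L-lipschitz_on UNIV f \<longrightarrow> (\<forall>x\<in>z ` {..n}. f x = 0) \<longrightarrow> \<bar>m f\<bar> \<le> \<eta> * L"
  proof (rule ccontr)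
    assume "\<not> ?thesis"
    then have "\<forall>n. \<exists>f L. L-lipschitz_on UNIV f \<and> (\<forall>x\<in>z ` {..n}. f x = 0) \<and> \<not> \<bar>m f\<bar> \<le> \<eta> * L"
      by blast
    from choice[OF this] obtain f where
      "\<forall>n. \<exists>L. L-lipschitz_on UNIV (f n) \<and> (\<forall>x\<in>z ` {..n}. f n x = 0) \<and> \<not> \<bar>m (f n)\<bar> \<le> \<eta> * L" ..
    from choice[OF this] obtain L where
      "\<forall>n. (L n)-lipschitz_on UNIV (f n) \<and> (\<forall>x\<in>z ` {..n}. f n x = 0) \<and> \<not> \<bar>m (f n)\<bar> \<le> \<eta> * L n" ..
    then have "(L n)-lipschitz_on UNIV (f n) \<and> (\<forall>x\<in>z ` {..n}. f n x = 0) \<and> \<eta> * L n < \<bar>m (f n)\<bar>" for n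
      unfolding not_le ..
    then have f: "(L n)-lipschitz_on UNIV (f n)" "\<forall>x\<in>z ` {..n}. f n x = 0" "\<eta> * L n < \<bar>m (f n)\<bar>" for n
      by blast+
    \<comment> \<open>A constant 0 would force \<open>m (f n) = 0\<close> against the strict
      inequality; so \<open>f n\<close> can be normalized.\<close>
    have L: "L n > 0" for n
    proof (rule ccontr)
      assume "\<not> L n > 0"
      then have "L n = 0" using lipschitz_on_nonneg[OF f(1)[of n]] by simp
      then show False using KR_bound[OF m f(1)[of n]] f(3)[of n] by simp
    qed
    define u where "u n x = (1 / L n) * f n x" for n x
    have u1: "1-lipschitz_on UNIV (u n)" for n
      unfolding u_def using lipschitz_on_cmult_real[OF f(1)[of n], of "1 / L n"] L[of n] by simp
    have u0: "u n (z k) = 0" if "k \<le> n" for n k using f(2)[of n] that by (simp add: u_def)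
    have mu: "\<eta> < \<bar>m (u n)\<bar>" for n
    proof -
      have "m (u n) = (1 / L n) * m (f n)" unfolding u_def by (rule KR_cmult[OF m LipI[OF f(1)]])
      then have "\<bar>m (u n)\<bar> = \<bar>m (f n)\<bar> / L n" using L[of n] by (simp add: abs_mult)
      then show ?thesis using f(3)[of n] L[of n] by (simp add: less_divide_eq)
    qed
    obtain s p where s: "strict_mono s" "1-lipschitz_on UNIV p" "\<And>x. (\<lambda>n. u (s n) x) \<longlonglongrightarrow> p x"
      using lipschitz_subsequence[of u "z 0", OF u1 u0] by auto
    have pz: "p (z k) = 0" for k
    proof (rule LIMSEQ_unique[OF s(3)])
      have "u (s n) (z k) = 0" if "n \<ge> k" for n using seq_suble[OF s(1), of n] that by (intro u0) simp
      then show "(\<lambda>n. u (s n) (z k)) \<longlonglongrightarrow> 0"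
        by (intro tendsto_eventually) (auto simp: eventually_sequentially)
    qed
    have pA: "p x = 0" if "x \<in> A" for x
    proof -
      have "x \<in> closure D" using that D(3) by blast
      moreover have "closure D \<subseteq> {x. p x = 0}"
        using pz rz by (intro closure_minimal closed_Collect_eq Lip_continuous_on[OF LipI[OF s(2)]] continuous_on_const) auto
      ultimately show ?thesis by blast
    qed
    have "m p = 0" by (rule KR_const[OF m LipI[OF s(2)] pA])
    moreover have "(\<lambda>n. m (u (s n))) \<longlonglongrightarrow> m p" by (rule KR_cont[OF m u1 LipI[OF s(2)] s(3)])
    then have "(\<lambda>n. \<bar>m (u (s n))\<bar>) \<longlonglongrightarrow> \<bar>m p\<bar>" by (rule tendsto_rabs)
    then have "\<eta> \<le> \<bar>m p\<bar>" by (rule LIMSEQ_le_const) (use mu in \<open>auto intro: less_imp_le\<close>)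
    ultimately show False using e by simp
  qed
  then obtain n where n: "\<forall>f L. L-lipschitz_on UNIV f \<longrightarrow> (\<forall>x\<in>z ` {..n}. f x = 0) \<longrightarrow> \<bar>m f\<bar> \<le> \<eta> * L" ..
  show ?thesis
  proof (rule that)
    show "finite (z ` {..n})" by simp
    show "z ` {..n} \<subseteq> A" using rz D(2) by blast
    show "\<bar>m f\<bar> \<le> \<eta> * L" if "L-lipschitz_on UNIV f" "\<And>x. x \<in> z ` {..n} \<Longrightarrow> f x = 0" for f L
      using n[rule_format, OF that] .
  qed
qed

text \<open>
  Kantorovich duality on the finite test set and approximation of \<open>m\<close> by it come out of a single
  application of Hahn-Banach, to a functional of the differences \<open>h (x, y) = f x - f y\<close>.
\<close>

lemma KR_dipole_step:
  fixes m :: "('a::{second_countable_topology, metric_space} \<Rightarrow> real) \<Rightarrow> real"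
  assumes m: "KR_functional A N m" and e: "\<eta> > 0"
  shows "\<exists>I a. finite I \<and> I \<subseteq> A \<times> A \<and> (\<forall>x. (x, x) \<notin> I) \<and> (\<Sum>(x, y)\<in>I. \<bar>a (x, y)\<bar> * dist x y) \<le> N + \<eta> \<and>
    (\<forall>f L. L-lipschitz_on UNIV f \<longrightarrow> \<bar>m f - (\<Sum>(x, y)\<in>I. a (x, y) * (f x - f y))\<bar> \<le> \<eta> * L)"
proof -
  obtain F where F: "finite F" "F \<subseteq> A"
    "\<And>f L. L-lipschitz_on UNIV f \<Longrightarrow> (\<And>x. x \<in> F \<Longrightarrow> f x = 0) \<Longrightarrow> \<bar>m f\<bar> \<le> \<eta> * L"
    using KR_finite_test[OF m e] by metis
  define I where "I = {(x, y) \<in> F \<times> F. x \<noteq> y}"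
  have fI: "finite I" by (rule finite_subset[of _ "F \<times> F"]) (use F in \<open>auto simp: I_def\<close>)
  have N0: "0 \<le> N" by (rule KR_nonneg[OF m])
  \<comment> \<open>\<open>h\<close> is compared with the differences of a function
    \<open>f\<close>, and the mismatch is penalized through \<open>K\<close>. The infimum
    \<open>q h\<close> serves two ends: exact differences of \<open>f\<close>, with
    \<open>K = 0\<close>, give \<open>q h \<le> m f + \<eta> * L\<close>, hence the approximation of
    \<open>m\<close>; the choice \<open>f = 0\<close>, \<open>K = 1\<close> gives the bound
    \<open>N + \<eta>\<close> on the cost.\<close>
  define S where "S h = {m f + \<eta> * L + (N + \<eta>) * K | f L K. L-lipschitz_on UNIV f \<and> 0 \<le> K \<and>
    (\<forall>(x, y)\<in>I. \<bar>h (x, y) - (f x - f y)\<bar> \<le> K * dist x y)}" for h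
  have SI: "m f + \<eta> * L + (N + \<eta>) * K \<in> S h"
    if "L-lipschitz_on UNIV f" "0 \<le> K" "\<And>x y. (x, y) \<in> I \<Longrightarrow> \<bar>h (x, y) - (f x - f y)\<bar> \<le> K * dist x y" for f L K h
    using that unfolding S_def by blast
  have SE: "\<exists>f L K. s = m f + \<eta> * L + (N + \<eta>) * K \<and> L-lipschitz_on UNIV f \<and> 0 \<le> K \<and>
    (\<forall>x y. (x, y) \<in> I \<longrightarrow> \<bar>h (x, y) - (f x - f y)\<bar> \<le> K * dist x y)" if "s \<in> S h" for s h
    using that unfolding S_def by blast
  have zero_lip: "0-lipschitz_on UNIV (\<lambda>_::'a. 0::real)" by (rule lipschitz_on_constant)
  have m0: "m (\<lambda>_. 0) = 0" using KR_bound[OF m zero_lip] by simp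
  have ne: "S h \<noteq> {}" for h
  proof -
    define K where "K = (\<Sum>(x, y)\<in>I. \<bar>h (x, y)\<bar> / dist x y)"
    have "\<bar>h (x, y) - (0 - 0)\<bar> \<le> K * dist x y" if xy: "(x, y) \<in> I" for x y
    proof -
      have "\<bar>h (x, y)\<bar> / dist x y \<le> K"
        unfolding K_def using member_le_sum[OF xy, of "\<lambda>(x, y). \<bar>h (x, y)\<bar> / dist x y"] fI by auto
      moreover have "dist x y > 0" using xy by (simp add: I_def)
      ultimately show ?thesis by (simp add: divide_le_eq)
    qed
    moreover have "0 \<le> K" unfolding K_def by (intro sum_nonneg) auto
    ultimately show ?thesis using SI[OF zero_lip, of K h] by blast
  qed
  \<comment> \<open>Two competitors for the same \<open>h\<close> differ on \<open>F\<close> by a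
    function with constant \<open>K + K0\<close>. Its extension \<open>g\<close> costs at most
    \<open>N * (K + K0)\<close>, and what remains vanishes on \<open>F\<close> and costs at most
    \<open>\<eta> * (L + L0 + K + K0)\<close>. The penalty factor \<open>N + \<eta>\<close> is the
    sum of the two rates for \<open>K\<close>.\<close>
  have bdd: "bdd_below (S h)" for h
  proof -
    obtain s where "s \<in> S h" using ne by blast
    then obtain f0 L0 K0 where 0: "L0-lipschitz_on UNIV f0" "0 \<le> K0"
      "\<And>x y. (x, y) \<in> I \<Longrightarrow> \<bar>h (x, y) - (f0 x - f0 y)\<bar> \<le> K0 * dist x y" using SE by metis
    show ?thesis
    proof (rule bdd_belowI[of _ "m f0 - (N + \<eta>) * K0 - \<eta> * L0"])
      fix t assume "t \<in> S h"
      then obtain f L K where t: "t = m f + \<eta> * L + (N + \<eta>) * K" and f: "L-lipschitz_on UNIV f" "0 \<le> K"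
        "\<And>x y. (x, y) \<in> I \<Longrightarrow> \<bar>h (x, y) - (f x - f y)\<bar> \<le> K * dist x y" using SE by metis
      have fl: "(L + L0)-lipschitz_on UNIV (\<lambda>x. f x - f0 x)" by (rule lipschitz_diff[OF f(1) 0(1)])
      have "(f x - f0 x) - (f y - f0 y) \<le> (K + K0) * dist x y" if "x \<in> F" "y \<in> F" for x y
      proof (cases "x = y")
        case False
        then have "(x, y) \<in> I" using that by (simp add: I_def)
        from f(3)[OF this] 0(3)[OF this] show ?thesis by (simp add: abs_le_iff algebra_simps)
      qed simp
      then obtain g where g: "(K + K0)-lipschitz_on UNIV g" "\<And>x. x \<in> F \<Longrightarrow> g x = f x - f0 x"
        using lipschitz_extend_finite[OF F(1), of "K + K0" "\<lambda>x. f x - f0 x"] f(2) 0(2) by auto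
      have "\<bar>m (\<lambda>x. (f x - f0 x) - g x)\<bar> \<le> \<eta> * ((L + L0) + (K + K0))"
        by (rule F(3)[OF lipschitz_diff[OF fl g(1)]]) (simp add: g(2))
      moreover have "m (\<lambda>x. (f x - f0 x) - g x) = m f - m f0 - m g"
        using KR_diff[OF m LipI[OF fl] LipI[OF g(1)]] KR_diff[OF m LipI[OF f(1)] LipI[OF 0(1)]] by simp
      moreover have "\<bar>m g\<bar> \<le> N * (K + K0)" by (rule KR_bound[OF m g(1)])
      ultimately show "m f0 - (N + \<eta>) * K0 - \<eta> * L0 \<le> t"
        unfolding t by (simp add: abs_le_iff algebra_simps)
    qed
  qed
  define q where "q h = Inf (S h)" for h
  have qle: "q h \<le> s" if "s \<in> S h" for h s unfolding q_def by (rule cInf_lower[OF that bdd])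
  have sub: "q (\<lambda>i. g i + h i) \<le> q g + q h" for g h
  proof -
    have add: "q (\<lambda>i. g i + h i) \<le> s + t" if st: "s \<in> S g" "t \<in> S h" for s t
    proof -
      obtain f1 L1 K1 where 1: "s = m f1 + \<eta> * L1 + (N + \<eta>) * K1" "L1-lipschitz_on UNIV f1" "0 \<le> K1"
        "\<And>x y. (x, y) \<in> I \<Longrightarrow> \<bar>g (x, y) - (f1 x - f1 y)\<bar> \<le> K1 * dist x y" using SE[OF st(1)] by metis
      obtain f2 L2 K2 where 2: "t = m f2 + \<eta> * L2 + (N + \<eta>) * K2" "L2-lipschitz_on UNIV f2" "0 \<le> K2"
        "\<And>x y. (x, y) \<in> I \<Longrightarrow> \<bar>h (x, y) - (f2 x - f2 y)\<bar> \<le> K2 * dist x y" using SE[OF st(2)] by metis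
      have "m (\<lambda>x. f1 x + f2 x) + \<eta> * (L1 + L2) + (N + \<eta>) * (K1 + K2) \<in> S (\<lambda>i. g i + h i)"
      proof (rule SI)
        show "(L1 + L2)-lipschitz_on UNIV (\<lambda>x. f1 x + f2 x)" by (rule lipschitz_on_add[OF 1(2) 2(2)])
        show "\<bar>g (x, y) + h (x, y) - (f1 x + f2 x - (f1 y + f2 y))\<bar> \<le> (K1 + K2) * dist x y" if "(x, y) \<in> I" for x y
          using 1(4)[OF that] 2(4)[OF that] by (simp add: abs_le_iff algebra_simps)
      qed (use 1(3) 2(3) in simp)
      from qle[OF this] show ?thesis
        using KR_add[OF m LipI[OF 1(2)] LipI[OF 2(2)]] by (simp add: 1(1) 2(1) algebra_simps)
    qed
    have "q (\<lambda>i. g i + h i) - s \<le> q h" if "s \<in> S g" for s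
      unfolding q_def[of h] using add[OF that] by (intro cInf_greatest[OF ne]) (simp add: algebra_simps)
    then have "q (\<lambda>i. g i + h i) - q h \<le> q g"
      unfolding q_def[of g] by (intro cInf_greatest[OF ne]) (simp add: algebra_simps)
    then show ?thesis by simp
  qed
  have hom1: "q (\<lambda>i. c * h i) \<le> c * q h" if c: "c > 0" for c h
  proof -
    have "q (\<lambda>i. c * h i) \<le> c * s" if s: "s \<in> S h" for s
    proof -
      obtain f L K where 1: "s = m f + \<eta> * L + (N + \<eta>) * K" "L-lipschitz_on UNIV f" "0 \<le> K"
        "\<And>x y. (x, y) \<in> I \<Longrightarrow> \<bar>h (x, y) - (f x - f y)\<bar> \<le> K * dist x y" using SE[OF s] by metis
      have "m (\<lambda>x. c * f x) + \<eta> * (c * L) + (N + \<eta>) * (c * K) \<in> S (\<lambda>i. c * h i)"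
      proof (rule SI)
        show "(c * L)-lipschitz_on UNIV (\<lambda>x. c * f x)"
          using lipschitz_on_cmult_real[OF 1(2), of c] c by simp
        fix x y assume xy: "(x, y) \<in> I"
        have "c * h (x, y) - (c * f x - c * f y) = c * (h (x, y) - (f x - f y))"
          by (simp add: algebra_simps)
        then have "\<bar>c * h (x, y) - (c * f x - c * f y)\<bar> = c * \<bar>h (x, y) - (f x - f y)\<bar>"
          by (simp only: abs_mult abs_of_pos[OF c])
        also have "\<dots> \<le> c * (K * dist x y)" using c 1(4)[OF xy] by (intro mult_left_mono) auto
        finally show "\<bar>c * h (x, y) - (c * f x - c * f y)\<bar> \<le> c * K * dist x y" by (simp add: mult.assoc)
      qed (use 1(3) c in simp)
      from qle[OF this] show ?thesis
        using KR_cmult[OF m LipI[OF 1(2)]] by (simp add: 1(1) algebra_simps)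
    qed
    then have "q (\<lambda>i. c * h i) / c \<le> q h"
      unfolding q_def[of h] using c by (intro cInf_greatest[OF ne]) (simp add: divide_le_eq mult.commute)
    then show ?thesis using c by (simp add: divide_le_eq mult.commute)
  qed
  have hom: "q (\<lambda>i. c * h i) = c * q h" if c: "c > 0" for c h
  proof (rule antisym[OF hom1[OF c]])
    have "q (\<lambda>i. (1 / c) * (c * h i)) \<le> (1 / c) * q (\<lambda>i. c * h i)" by (rule hom1) (use c in simp)
    then show "c * q h \<le> q (\<lambda>i. c * h i)" using c by (simp add: field_simps)
  qed
  obtain a where a: "\<And>h. (\<And>i. i \<notin> I \<Longrightarrow> h i = 0) \<Longrightarrow> (\<Sum>i\<in>I. a i * h i) \<le> q h"
    using finite_hahn_banach[OF fI, of q, OF sub hom] by blast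
  \<comment> \<open>Hahn-Banach controls only functions that vanish off \<open>I\<close>, so
    \<open>h\<close> is cut down to \<open>I\<close> first.\<close>
  have aq: "(\<Sum>i\<in>I. a i * h i) \<le> s" if "s \<in> S (\<lambda>i. if i \<in> I then h i else 0)" for h s
    using order.trans[OF a[of "\<lambda>i. if i \<in> I then h i else 0"] qle[OF that]] by (auto cong: sum.cong)
  have one: "(\<Sum>(x, y)\<in>I. a (x, y) * (f x - f y)) \<le> m f + \<eta> * L" if f: "L-lipschitz_on UNIV f" for f L
  proof -
    have "(\<Sum>i\<in>I. a i * (f (fst i) - f (snd i))) \<le> m f + \<eta> * L + (N + \<eta>) * 0"
      by (intro aq SI f) auto
    then show ?thesis by (simp add: case_prod_unfold)
  qed
  have "(\<Sum>(x, y)\<in>I. \<bar>a (x, y)\<bar> * dist x y) \<le> N + \<eta>"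
  proof -
    \<comment> \<open>Testing with the signs of the coefficients turns the linear bound into one for
      the cost.\<close>
    have "(\<Sum>i\<in>I. a i * (sgn (a i) * dist (fst i) (snd i))) \<le> m (\<lambda>_. 0) + \<eta> * 0 + (N + \<eta>) * 1"
    proof (intro aq SI zero_lip)
      fix x y assume "(x, y) \<in> I"
      then show "\<bar>(if (x, y) \<in> I then sgn (a (x, y)) * dist (fst (x, y)) (snd (x, y)) else 0) - (0 - 0)\<bar> \<le> 1 * dist x y"
        by (simp add: abs_mult abs_sgn_eq)
    qed simp
    moreover have "a i * (sgn (a i) * t) = \<bar>a i\<bar> * t" for i t
      by (simp add: sgn_if)
    ultimately show ?thesis by (simp add: m0 case_prod_unfold)
  qed
  moreover have "\<bar>m f - (\<Sum>(x, y)\<in>I. a (x, y) * (f x - f y))\<bar> \<le> \<eta> * L" if f: "L-lipschitz_on UNIV f" for f L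
  proof -
    have f': "L-lipschitz_on UNIV (\<lambda>x. - 1 * f x)"
      using lipschitz_on_cmult_real[OF f, of "-1"] by simp
    have "(\<Sum>(x, y)\<in>I. a (x, y) * (- 1 * f x - - 1 * f y)) = - (\<Sum>(x, y)\<in>I. a (x, y) * (f x - f y))"
      by (simp add: sum_negf[symmetric] case_prod_unfold algebra_simps)
    with one[OF f'] one[OF f] KR_cmult[OF m LipI[OF f], of "-1"] show ?thesis by (simp add: abs_le_iff)
  qed
  moreover have "I \<subseteq> A \<times> A" "\<forall>x. (x, x) \<notin> I" using F(2) by (auto simp: I_def)
  ultimately show ?thesis using fI by (intro exI[of _ I] exI[of _ a] conjI allI impI) simp_all
qed


text \<open>What a step leaves over is again a \<open>KR_functional\<close> over \<open>A\<close>,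
  with norm bound \<open>\<eta> k\<close> instead of \<open>N\<close>, so the step can be repeated
  on it. Step 0 costs \<open>N + \<eta> 0\<close> and step \<open>Suc j\<close> costs
  \<open>\<eta> j + \<eta> (Suc j)\<close>; since \<open>\<eta>\<close> sums to
  \<open>2 * \<delta>\<close>, the total is \<open>N + 4 * \<delta>\<close>.\<close>

lemma KR_dipole_series:
  fixes m :: "('a::{second_countable_topology, metric_space} \<Rightarrow> real) \<Rightarrow> real"
  assumes m: "KR_functional A N m" and d: "\<delta> > 0"
  obtains I :: "nat \<Rightarrow> ('a \<times> 'a) set" and a c where
    "\<And>k. finite (I k)" "\<And>k. I k \<subseteq> A \<times> A" "\<And>k x. (x, x) \<notin> I k"
    "\<And>k. (\<Sum>(x, y)\<in>I k. \<bar>a k (x, y)\<bar> * dist x y) \<le> c k"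
    "c sums (N + 4 * \<delta>)"
    "\<And>f. f \<in> Lip \<Longrightarrow> (\<lambda>k. \<Sum>(x, y)\<in>I k. a k (x, y) * (f x - f y)) sums m f"
proof -
  define \<eta> where "\<eta> k = \<delta> * (1 / 2) ^ k" for k :: nat
  define Nk where "Nk k = (case k of 0 \<Rightarrow> N | Suc j \<Rightarrow> \<eta> j)" for k
  have \<eta>0: "\<eta> k > 0" for k using d by (simp add: \<eta>_def)
  define Q where "Q k m' J b \<longleftrightarrow> finite J \<and> J \<subseteq> A \<times> A \<and> (\<forall>x. (x, x) \<notin> J) \<and>
      (\<Sum>(x, y)\<in>J. \<bar>b (x, y)\<bar> * dist x y) \<le> Nk k + \<eta> k \<and>
      (\<forall>f L. L-lipschitz_on UNIV f \<longrightarrow> \<bar>m' f - (\<Sum>(x, y)\<in>J. b (x, y) * (f x - f y))\<bar> \<le> \<eta> k * L)"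
    for k and m' :: "('a \<Rightarrow> real) \<Rightarrow> real" and J and b :: "'a \<times> 'a \<Rightarrow> real"
  have "\<forall>k m'. \<exists>J b. KR_functional A (Nk k) m' \<longrightarrow> Q k m' J b"
  proof (intro allI)
    fix k m'
    show "\<exists>J b. KR_functional A (Nk k) m' \<longrightarrow> Q k m' J b"
      using KR_dipole_step[of A "Nk k" m' "\<eta> k", OF _ \<eta>0] unfolding Q_def by simp
  qed
  then obtain JJ BB where JB: "\<And>k m'. KR_functional A (Nk k) m' \<Longrightarrow> Q k m' (JJ k m') (BB k m')"
    by metis
  define M where "M = rec_nat m (\<lambda>k m' f. m' f - (\<Sum>(x, y)\<in>JJ k m'. BB k m' (x, y) * (f x - f y)))"
  define I where "I k = JJ k (M k)" for k
  define a where "a k = BB k (M k)" for k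
  have M0: "M 0 = m" and MS: "M (Suc k) = (\<lambda>f. M k f - (\<Sum>(x, y)\<in>I k. a k (x, y) * (f x - f y)))" for k
    by (simp_all add: M_def I_def a_def)
  have KR: "KR_functional A (Nk k) (M k)" for k
  proof (induction k)
    case 0
    then show ?case using m by (simp add: M0 Nk_def)
  next
    case (Suc k)
    have Q: "Q k (M k) (I k) (a k)" unfolding I_def a_def by (rule JB[OF Suc])
    define l where "l f = (\<Sum>(x, y)\<in>I k. a k (x, y) * (f x - f y))" for f
    have Ml: "M (Suc k) = (\<lambda>f. M k f - l f)" by (simp add: MS l_def)
    show ?case
      unfolding KR_functional_def
    proof (intro conjI ballI allI impI)
      fix f g :: "'a \<Rightarrow> real" and b c :: real assume f: "f \<in> Lip" and g: "g \<in> Lip"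
      have "l (\<lambda>x. b * f x + c * g x) = b * l f + c * l g"
        unfolding l_def sum_distrib_left sum.distrib[symmetric] by (intro sum.cong) (auto simp: algebra_simps)
      then show "M (Suc k) (\<lambda>x. b * f x + c * g x) = b * M (Suc k) f + c * M (Suc k) g"
        unfolding Ml using KR_lincomb[OF Suc f g, of b c] by (simp add: algebra_simps)
    next
      fix P :: "nat \<Rightarrow> 'a \<Rightarrow> real" and p :: "'a \<Rightarrow> real" and L
      assume P: "\<forall>j. L-lipschitz_on UNIV (P j)" and p: "p \<in> Lip" and lim: "\<forall>x. (\<lambda>j. P j x) \<longlonglongrightarrow> p x"
      have "(\<lambda>j. l (P j)) \<longlonglongrightarrow> l p"
        unfolding l_def case_prod_unfold using lim by (intro tendsto_intros) auto
      then show "(\<lambda>j. M (Suc k) (P j)) \<longlonglongrightarrow> M (Suc k) p"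
        unfolding Ml using KR_cont[OF Suc, of L P p] P p lim by (intro tendsto_diff) auto
    next
      fix f :: "'a \<Rightarrow> real" and L assume "L-lipschitz_on UNIV f"
      then show "\<bar>M (Suc k) f\<bar> \<le> Nk (Suc k) * L"
        using Q unfolding Q_def by (simp add: Ml l_def Nk_def)
    next
      fix f :: "'a \<Rightarrow> real" and c assume f: "f \<in> Lip" and c: "\<forall>x\<in>A. f x = c"
      \<comment> \<open>Both ends of every dipole lie in \<open>A\<close>, so the remainder still
        sees only the values on \<open>A\<close>.\<close>
      have "l f = 0"
        unfolding l_def using Q c unfolding Q_def by (intro sum.neutral) auto
      then show "M (Suc k) f = 0" unfolding Ml using KR_const[OF Suc f, of c] c by simp
    qed
  qed
  have Q: "Q k (M k) (I k) (a k)" for k unfolding I_def a_def by (rule JB[OF KR])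
  show ?thesis
  proof (rule that[of I a "\<lambda>k. Nk k + \<eta> k"])
    have s\<eta>: "\<eta> sums (2 * \<delta>)"
      using sums_mult[OF geometric_sums[of "1 / 2 :: real"], of \<delta>]
      by (simp add: \<eta>_def[abs_def] mult.commute)
    have "(\<lambda>k. Nk (Suc k)) sums (2 * \<delta>)" using s\<eta> by (simp add: Nk_def)
    then have "Nk sums (2 * \<delta> + Nk 0)" by (rule sums_Suc)
    from sums_add[OF this s\<eta>] show "(\<lambda>k. Nk k + \<eta> k) sums (N + 4 * \<delta>)"
      by (simp add: Nk_def algebra_simps)
    fix f :: "'a \<Rightarrow> real" assume f: "f \<in> Lip"
    obtain L where L: "L-lipschitz_on UNIV f" using f by (auto simp: Lip_def)
    have part: "(\<Sum>k<n. \<Sum>(x, y)\<in>I k. a k (x, y) * (f x - f y)) = m f - M n f" for n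
      by (induction n) (simp_all add: M0 MS)
    have "(\<lambda>n. M (Suc n) f) \<longlonglongrightarrow> 0"
    proof (rule Lim_null_comparison)
      show "eventually (\<lambda>n. norm (M (Suc n) f) \<le> \<eta> n * L) sequentially"
        using KR_bound[OF KR L, of "Suc _"] by (simp add: Nk_def)
      show "(\<lambda>n. \<eta> n * L) \<longlonglongrightarrow> 0"
        using tendsto_mult_right[OF summable_LIMSEQ_zero[OF sums_summable[OF s\<eta>]], of L] by simp
    qed
    then have "(\<lambda>n. M n f) \<longlonglongrightarrow> 0" by (rule LIMSEQ_imp_Suc)
    then show "(\<lambda>k. \<Sum>(x, y)\<in>I k. a k (x, y) * (f x - f y)) sums m f"
      unfolding sums_def part using tendsto_diff[OF tendsto_const[of "m f"]] by force
  qed (use Q in \<open>auto simp: Q_def\<close>)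
qed

subsection \<open>The current of integration over a segment\<close>

text \<open>
  For Lipschitz \<open>g\<close> and \<open>q\<close> the Riemann-Stieltjes integral of \<open>g\<close> against \<open>q\<close> over \<open>[0, 1]\<close> is the
  limit of its dyadic sums. This spares differentiating \<open>q\<close>.
\<close>

definition rs_sum :: "nat \<Rightarrow> (real \<Rightarrow> real) \<Rightarrow> (real \<Rightarrow> real) \<Rightarrow> real" where
  "rs_sum n g q = (\<Sum>k<2 ^ n. g (real k / 2 ^ n) * (q ((real k + 1) / 2 ^ n) - q (real k / 2 ^ n)))"

definition rs_integral :: "(real \<Rightarrow> real) \<Rightarrow> (real \<Rightarrow> real) \<Rightarrow> real" where
  "rs_integral g q = lim (\<lambda>n. rs_sum n g q)"

text \<open>The explicit rate is kept because it is uniform in the integrator, which allows limits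
  to be interchanged in \<open>rs_integral_cont\<close>.\<close>

lemma geometric_steps_limit:
  fixes s :: "nat \<Rightarrow> real"
  assumes C: "C \<ge> 0" and step: "\<And>n. \<bar>s (Suc n) - s n\<bar> \<le> C * (1 / 2) ^ Suc n"
  shows "s \<longlonglongrightarrow> lim s" "\<bar>lim s - s n\<bar> \<le> C * (1 / 2) ^ n"
proof -
  have tel: "\<bar>s (n + k) - s n\<bar> \<le> C * ((1 / 2) ^ n - (1 / 2) ^ (n + k))" for n k
  proof (induction k)
    case (Suc k)
    have "\<bar>s (n + Suc k) - s n\<bar> \<le> C * ((1 / 2) ^ n - (1 / 2) ^ (n + k)) + C * (1 / 2) ^ Suc (n + k)"
      using Suc step[of "n + k"] unfolding add_Suc_right by linarith
    then show ?case by (simp add: algebra_simps)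
  qed simp
  have tel': "\<bar>s (n + k) - s n\<bar> \<le> C * (1 / 2) ^ n" for n k
  proof -
    have "C * ((1 / 2) ^ n - (1 / 2) ^ (n + k)) \<le> C * (1 / 2) ^ n"
      using C by (intro mult_left_mono) auto
    with tel[of n k] show ?thesis by linarith
  qed
  have "Cauchy s"
  proof (rule metric_CauchyI)
    fix e :: real assume e: "e > 0"
    have "(\<lambda>n. C * (1 / 2) ^ n) \<longlonglongrightarrow> C * 0" by (intro tendsto_mult_left LIMSEQ_realpow_zero) auto
    then have "eventually (\<lambda>n. C * (1 / 2) ^ n < e / 2) sequentially"
      using e by (intro order_tendstoD) auto
    then obtain N where N: "C * (1 / 2) ^ N < e / 2" by (auto simp: eventually_sequentially)
    have "dist (s m) (s n) < e" if mn: "m \<ge> N" "n \<ge> N" for m n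
    proof -
      have "\<bar>s m - s N\<bar> < e / 2" using tel'[of N "m - N"] N mn by simp
      moreover have "\<bar>s n - s N\<bar> < e / 2" using tel'[of N "n - N"] N mn by simp
      ultimately show ?thesis unfolding dist_real_def by linarith
    qed
    then show "\<exists>M. \<forall>m\<ge>M. \<forall>n\<ge>M. dist (s m) (s n) < e" by blast
  qed
  then show lim: "s \<longlonglongrightarrow> lim s" by (simp add: Cauchy_convergent convergent_LIMSEQ_iff[symmetric])
  have "(\<lambda>k. \<bar>s (n + k) - s n\<bar>) \<longlonglongrightarrow> \<bar>lim s - s n\<bar>"
    using LIMSEQ_ignore_initial_segment[OF lim, of n] by (intro tendsto_intros) (simp add: add.commute)
  then show "\<bar>lim s - s n\<bar> \<le> C * (1 / 2) ^ n"
    by (rule LIMSEQ_le_const2) (use tel' in auto)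
qed

lemma sum_lessThan_double: "(\<Sum>j<2 * N. h j) = (\<Sum>k<N. h (2 * k) + h (2 * k + 1))"
  for h :: "nat \<Rightarrow> 'b::comm_monoid_add"
  by (induction N) (simp_all add: add.assoc)

text \<open>Halving an interval changes its term by an increment of \<open>g\<close> times an
  increment of \<open>q\<close>, both over half intervals of length \<open>d\<close>:
  \<open>2 ^ n\<close> errors of size at most \<open>L * M * d * d\<close>.\<close>

lemma rs_sum_step:
  assumes g: "L-lipschitz_on UNIV g" and q: "M-lipschitz_on UNIV q"
  shows "\<bar>rs_sum (Suc n) g q - rs_sum n g q\<bar> \<le> L * M * (1 / 2) ^ Suc n"
proof -
  have L: "0 \<le> L" and M: "0 \<le> M" using g q by (auto intro: lipschitz_on_nonneg)
  define d :: real where "d = 1 / 2 ^ Suc n"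
  have d: "d > 0" by (simp add: d_def)
  have e: "real (2 * k) / 2 ^ Suc n = real k / 2 ^ n" "(real (2 * k + 1) + 1) / 2 ^ Suc n = (real k + 1) / 2 ^ n"
    "(real (2 * k) + 1) / 2 ^ Suc n = real k / 2 ^ n + d" "real (2 * k + 1) / 2 ^ Suc n = real k / 2 ^ n + d"
    "(real k + 1) / 2 ^ n = real k / 2 ^ n + 2 * d" for k
    by (simp_all add: d_def field_simps)
  have p2: "(2 :: nat) ^ Suc n = 2 * 2 ^ n" by simp
  have "rs_sum (Suc n) g q - rs_sum n g q =
    (\<Sum>k<2 ^ n. (g (real k / 2 ^ n + d) - g (real k / 2 ^ n)) * (q (real k / 2 ^ n + 2 * d) - q (real k / 2 ^ n + d)))"
    unfolding rs_sum_def p2 sum_lessThan_double e sum_subtractf[symmetric]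
    by (intro sum.cong) (simp_all add: algebra_simps)
  also have "\<bar>\<dots>\<bar> \<le> (\<Sum>k<(2::nat) ^ n. L * d * (M * d))"
  proof (intro order.trans[OF sum_abs] sum_mono)
    fix k
    show "\<bar>(g (real k / 2 ^ n + d) - g (real k / 2 ^ n)) * (q (real k / 2 ^ n + 2 * d) - q (real k / 2 ^ n + d))\<bar> \<le> L * d * (M * d)"
      using lipschitz_onD[OF g, of "real k / 2 ^ n + d" "real k / 2 ^ n"]
        lipschitz_onD[OF q, of "real k / 2 ^ n + 2 * d" "real k / 2 ^ n + d"] L M d
      unfolding abs_mult by (intro mult_mono) (auto simp: dist_real_def)
  qed
  also have "\<dots> = (L * M * d) * (2 ^ n * d)" by simp
  also have "\<dots> \<le> (L * M * d) * 1"
    using L M d by (intro mult_left_mono) (auto simp: d_def)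
  finally show ?thesis by (simp add: d_def power_divide)
qed

lemma rs_integral_lim:
  assumes "L-lipschitz_on UNIV g" "M-lipschitz_on UNIV q"
  shows "(\<lambda>n. rs_sum n g q) \<longlonglongrightarrow> rs_integral g q"
    "\<bar>rs_integral g q - rs_sum n g q\<bar> \<le> L * M * (1 / 2) ^ n"
proof -
  have C: "0 \<le> L * M" using assms by (auto intro: lipschitz_on_nonneg mult_nonneg_nonneg)
  from geometric_steps_limit[OF C rs_sum_step[OF assms]]
  show "(\<lambda>n. rs_sum n g q) \<longlonglongrightarrow> rs_integral g q" "\<bar>rs_integral g q - rs_sum n g q\<bar> \<le> L * M * (1 / 2) ^ n"
    by (simp_all add: rs_integral_def)
qed

lemma rs_integral_const: "rs_integral (\<lambda>_. 1) q = q 1 - q 0"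
proof -
  have "rs_sum n (\<lambda>_. 1) q = q 1 - q 0" for n
  proof -
    have "rs_sum n (\<lambda>_. 1) q = (\<Sum>k<2 ^ n. q (real (Suc k) / 2 ^ n) - q (real k / 2 ^ n))"
      unfolding rs_sum_def by (intro sum.cong) (simp_all add: add.commute)
    also have "\<dots> = q (real (2 ^ n) / 2 ^ n) - q (real 0 / 2 ^ n)"
      by (rule sum_lessThan_telescope)
    finally show ?thesis by simp
  qed
  then show ?thesis by (simp add: rs_integral_def)
qed

lemma riemann_sum_le_integral:
  fixes h :: "real \<Rightarrow> real"
  assumes h: "L-lipschitz_on UNIV h" and d: "d > 0"
  shows "(\<Sum>k<M. h (real k * d) * d) \<le> integral {0..real M * d} h + real M * (L * d * d)"
proof (induction M)
  case (Suc M)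
  have int: "h integrable_on {a..b}" for a b
    by (intro integrable_continuous_real Lip_continuous_on LipI[OF h])
  have "integral {real M * d..real (Suc M) * d} (\<lambda>_. h (real M * d) - L * d) \<le> integral {real M * d..real (Suc M) * d} h"
  proof (rule integral_le)
    fix t assume t: "t \<in> {real M * d..real (Suc M) * d}"
    then have "dist t (real M * d) \<le> d" by (simp add: dist_real_def algebra_simps)
    then have "L * dist t (real M * d) \<le> L * d" using lipschitz_on_nonneg[OF h] by (intro mult_left_mono)
    then show "h (real M * d) - L * d \<le> h t"
      using lipschitz_onD[OF h, of t "real M * d"] by (simp add: dist_real_def abs_le_iff)
  qed (auto intro: int)
  moreover have "integral {real M * d..real (Suc M) * d} (\<lambda>_. h (real M * d) - L * d) = d * (h (real M * d) - L * d)"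
    using d by (simp add: algebra_simps)
  moreover have "integral {0..real M * d} h + integral {real M * d..real (Suc M) * d} h = integral {0..real (Suc M) * d} h"
    using d int by (intro Henstock_Kurzweil_Integration.integral_combine) (auto simp: algebra_simps)
  ultimately show ?case using Suc by (simp add: algebra_simps)
qed simp

text \<open>The bound has to contain the integral of \<open>\<bar>g t\<bar>\<close> and not its
  supremum, since it becomes the finite mass axiom for a segment.\<close>

lemma rs_integral_bound:
  assumes g: "L-lipschitz_on UNIV g" and q: "M-lipschitz_on UNIV q"
  shows "\<bar>rs_integral g q\<bar> \<le> M * integral {0..1} (\<lambda>t. \<bar>g t\<bar>)"
proof -
  have M: "0 \<le> M" using q by (rule lipschitz_on_nonneg)
  have ag: "L-lipschitz_on UNIV (\<lambda>t. \<bar>g t\<bar>)"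
  proof (rule lipschitz_onI)
    show "dist \<bar>g x\<bar> \<bar>g y\<bar> \<le> L * dist x y" for x y
      using lipschitz_onD[OF g, of x y] by (simp add: dist_real_def)
  qed (rule lipschitz_on_nonneg[OF g])
  have bd: "\<bar>rs_sum n g q\<bar> \<le> M * (integral {0..1} (\<lambda>t. \<bar>g t\<bar>) + L * (1 / 2) ^ n)" for n
  proof -
    define d :: real where "d = 1 / 2 ^ n"
    have d: "d > 0" "real (2 ^ n) * d = 1" by (simp_all add: d_def)
    have "\<bar>rs_sum n g q\<bar> \<le> (\<Sum>k<2 ^ n. M * (\<bar>g (real k * d)\<bar> * d))"
      unfolding rs_sum_def
    proof (intro order.trans[OF sum_abs] sum_mono)
      fix k
      have "\<bar>q ((real k + 1) / 2 ^ n) - q (real k / 2 ^ n)\<bar> \<le> M * d"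
        using lipschitz_onD[OF q, of "(real k + 1) / 2 ^ n" "real k / 2 ^ n"]
        by (simp add: dist_real_def d_def diff_divide_distrib[symmetric])
      then have "\<bar>g (real k / 2 ^ n)\<bar> * \<bar>q ((real k + 1) / 2 ^ n) - q (real k / 2 ^ n)\<bar> \<le> \<bar>g (real k / 2 ^ n)\<bar> * (M * d)"
        by (intro mult_left_mono) auto
      then show "\<bar>g (real k / 2 ^ n) * (q ((real k + 1) / 2 ^ n) - q (real k / 2 ^ n))\<bar> \<le> M * (\<bar>g (real k * d)\<bar> * d)"
        unfolding abs_mult d_def by (simp add: mult_ac)
    qed
    also have "\<dots> = M * (\<Sum>k<2 ^ n. \<bar>g (real k * d)\<bar> * d)" by (simp add: sum_distrib_left)
    also have "\<dots> \<le> M * (integral {0..real (2 ^ n) * d} (\<lambda>t. \<bar>g t\<bar>) + real (2 ^ n) * (L * d * d))"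
      by (intro mult_left_mono[OF _ M] riemann_sum_le_integral ag d(1))
    also have "real (2 ^ n) * (L * d * d) = L * d * (real (2 ^ n) * d)" by (simp only: mult_ac)
    finally show ?thesis unfolding d(2) by (simp add: d_def power_divide)
  qed
  have "(\<lambda>n. M * (integral {0..1} (\<lambda>t. \<bar>g t\<bar>) + L * (1 / 2) ^ n)) \<longlonglongrightarrow> M * (integral {0..1} (\<lambda>t. \<bar>g t\<bar>) + L * 0)"
    by (intro tendsto_intros LIMSEQ_realpow_zero) auto
  then show ?thesis
    using LIMSEQ_le[OF tendsto_rabs[OF rs_integral_lim(1)[OF g q]]] bd by auto
qed

text \<open>The dyadic sums approximate all the integrals with one error depending on
  \<open>L\<close>, \<open>M\<close> and \<open>n\<close> only, and for fixed \<open>n\<close> they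
  are finite sums, continuous in the integrator.\<close>

lemma rs_integral_cont:
  assumes g: "L-lipschitz_on UNIV g" and Q: "\<And>j::nat. M-lipschitz_on UNIV (Q j)" and q: "M-lipschitz_on UNIV q"
    and lim: "\<And>t. (\<lambda>j. Q j t) \<longlonglongrightarrow> q t"
  shows "(\<lambda>j. rs_integral g (Q j)) \<longlonglongrightarrow> rs_integral g q"
proof (rule metric_LIMSEQ_I)
  fix e :: real assume e: "e > 0"
  have "(\<lambda>n. L * M * (1 / 2) ^ n) \<longlonglongrightarrow> L * M * 0" by (intro tendsto_mult_left LIMSEQ_realpow_zero) auto
  then have "eventually (\<lambda>n. L * M * (1 / 2) ^ n < e / 3) sequentially"
    using e by (intro order_tendstoD) auto
  then obtain n where n: "L * M * (1 / 2) ^ n < e / 3" by (auto simp: eventually_sequentially)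
  have "(\<lambda>j. rs_sum n g (Q j)) \<longlonglongrightarrow> rs_sum n g q"
    unfolding rs_sum_def by (intro tendsto_intros lim)
  then obtain N where N: "\<And>j. j \<ge> N \<Longrightarrow> dist (rs_sum n g (Q j)) (rs_sum n g q) < e / 3"
    using metric_LIMSEQ_D[of _ _ "e / 3"] e by (metis divide_pos_pos zero_less_numeral)
  have "dist (rs_integral g (Q j)) (rs_integral g q) < e" if "j \<ge> N" for j
  proof -
    have "dist (rs_integral g (Q j)) (rs_integral g q) \<le> \<bar>rs_integral g (Q j) - rs_sum n g (Q j)\<bar>
        + dist (rs_sum n g (Q j)) (rs_sum n g q) + \<bar>rs_integral g q - rs_sum n g q\<bar>"
      unfolding dist_real_def by linarith
    with rs_integral_lim(2)[OF g Q, of j n] rs_integral_lim(2)[OF g q, of n] N[OF that] n show ?thesis by linarith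
  qed
  then show "\<exists>N. \<forall>j\<ge>N. dist (rs_integral g (Q j)) (rs_integral g q) < e" by blast
qed

text \<open>The compact set \<open>S \<inter> {0..1}\<close> has positive distance from the
  complement of \<open>V\<close>. Once the mesh is finer, an interval with \<open>g\<close> nonzero
  at its left end has both ends in \<open>V\<close>, so \<open>q\<close> has no increment on
  it.\<close>

lemma rs_integral_local:
  assumes g: "L-lipschitz_on UNIV g" and q: "M-lipschitz_on UNIV q"
    and V: "open V" "\<And>t. t \<in> V \<Longrightarrow> q t = c" and S: "closed S" "S \<subseteq> V" "\<And>t. g t \<noteq> 0 \<Longrightarrow> t \<in> S"
  shows "rs_integral g q = 0"
proof -
  have "compact (S \<inter> {0..1})" using S(1) by (simp add: closed_Int_compact)
  moreover have "closed (- V)" using V(1) by (simp add: closed_Compl)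
  ultimately obtain d where d: "d > 0" "\<And>s t. s \<in> S \<inter> {0..1} \<Longrightarrow> t \<in> - V \<Longrightarrow> d \<le> dist s t"
    using separate_compact_closed[of "S \<inter> {0..1}" "- V"] S(2) by blast
  obtain N where N: "(1 / 2 :: real) ^ N < d" using real_arch_pow_inv[OF d(1), of "1 / 2"] by auto
  have "rs_sum n g q = 0" if n: "n \<ge> N" for n
    unfolding rs_sum_def
  proof (intro sum.neutral ballI)
    fix k :: nat assume k: "k \<in> {..<2 ^ n}"
    show "g (real k / 2 ^ n) * (q ((real k + 1) / 2 ^ n) - q (real k / 2 ^ n)) = 0"
    proof (cases "g (real k / 2 ^ n) = 0")
      case False
      then have s: "real k / 2 ^ n \<in> S" by (rule S(3))
      have "real k \<le> 2 ^ n" using k by (metis lessThan_iff less_imp_le of_nat_le_iff of_nat_numeral of_nat_power)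
      then have s': "real k / 2 ^ n \<in> S \<inter> {0..1}" using s by simp
      have "dist (real k / 2 ^ n) ((real k + 1) / 2 ^ n) = (1 / 2) ^ n"
        by (simp add: dist_real_def diff_divide_distrib[symmetric] power_divide)
      also have "\<dots> \<le> (1 / 2) ^ N" using n by (intro power_decreasing) auto
      also have "\<dots> < d" by (rule N)
      finally have "(real k + 1) / 2 ^ n \<in> V" using d(2)[OF s', of "(real k + 1) / 2 ^ n"] by fastforce
      moreover have "real k / 2 ^ n \<in> V" using s S(2) by blast
      ultimately show ?thesis using V(2) by simp
    qed simp
  qed
  then have "(\<lambda>n. rs_sum n g q) \<longlonglongrightarrow> 0"
    by (intro tendsto_eventually) (auto simp: eventually_sequentially)
  then show ?thesis using rs_integral_lim(1)[OF g q] LIMSEQ_unique by blast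
qed

lemma rs_integral_bilinear:
  assumes g: "L-lipschitz_on UNIV g" "L'-lipschitz_on UNIV g'" and q: "M-lipschitz_on UNIV q" "M'-lipschitz_on UNIV q'"
  shows "rs_integral (\<lambda>t. a * g t + b * g' t) q = a * rs_integral g q + b * rs_integral g' q"
    and "rs_integral g (\<lambda>t. a * q t + b * q' t) = a * rs_integral g q + b * rs_integral g q'"
proof -
  have "rs_sum n (\<lambda>t. a * g t + b * g' t) q = a * rs_sum n g q + b * rs_sum n g' q" for n
    unfolding rs_sum_def sum_distrib_left sum.distrib[symmetric] by (intro sum.cong) (auto simp: algebra_simps)
  then have "(\<lambda>n. rs_sum n (\<lambda>t. a * g t + b * g' t) q) \<longlonglongrightarrow> a * rs_integral g q + b * rs_integral g' q"
    using rs_integral_lim(1)[OF g(1) q(1)] rs_integral_lim(1)[OF g(2) q(1)] by (auto intro!: tendsto_intros)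
  then show "rs_integral (\<lambda>t. a * g t + b * g' t) q = a * rs_integral g q + b * rs_integral g' q"
    using rs_integral_lim(1)[OF lipschitz_lincomb[OF g] q(1)] LIMSEQ_unique by blast
  have "rs_sum n g (\<lambda>t. a * q t + b * q' t) = a * rs_sum n g q + b * rs_sum n g q'" for n
    unfolding rs_sum_def sum_distrib_left sum.distrib[symmetric] by (intro sum.cong) (auto simp: algebra_simps)
  then have "(\<lambda>n. rs_sum n g (\<lambda>t. a * q t + b * q' t)) \<longlonglongrightarrow> a * rs_integral g q + b * rs_integral g q'"
    using rs_integral_lim(1)[OF g(1) q(1)] rs_integral_lim(1)[OF g(1) q(2)] by (auto intro!: tendsto_intros)
  then show "rs_integral g (\<lambda>t. a * q t + b * q' t) = a * rs_integral g q + b * rs_integral g q'"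
    using rs_integral_lim(1)[OF g(1) lipschitz_lincomb[OF q]] LIMSEQ_unique by blast
qed

section \<open>Segments as metric currents\<close>

definition segment_param :: "'a::real_normed_vector \<Rightarrow> 'a \<Rightarrow> real \<Rightarrow> 'a" where
  "segment_param u v t = u + t *\<^sub>R (v - u)"

definition segment_current :: "'a::real_normed_vector \<Rightarrow> 'a \<Rightarrow> 'a functional" where
  "segment_current u v f p = rs_integral (\<lambda>t. f (segment_param u v t)) (\<lambda>t. p (segment_param u v t))"

text \<open>The length measure of the segment, written as an image so that integrals reduce to
  \<open>{0..1}\<close>; it is zero for \<open>u = v\<close>.\<close>

definition segment_measure :: "'a::real_normed_vector \<Rightarrow> 'a \<Rightarrow> 'a measure" where
  "segment_measure u v =
     distr (density lborel (\<lambda>t. ennreal (dist u v * indicator {0..1} t))) borel (segment_param u v)"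

lemma segment_param_lipschitz:
  assumes "L-lipschitz_on UNIV f"
  shows "(L * dist u v)-lipschitz_on UNIV (\<lambda>t. f (segment_param u v t))"
proof (rule lipschitz_onI)
  show "0 \<le> L * dist u v" using lipschitz_on_nonneg[OF assms] by simp
  fix s t
  have "segment_param u v s - segment_param u v t = (s - t) *\<^sub>R (v - u)"
    by (simp add: segment_param_def algebra_simps)
  then have "dist (segment_param u v s) (segment_param u v t) = dist u v * dist s t"
    by (simp add: dist_norm norm_minus_commute mult.commute)
  then show "dist (f (segment_param u v s)) (f (segment_param u v t)) \<le> L * dist u v * dist s t"
    using lipschitz_onD[OF assms, of "segment_param u v s" "segment_param u v t"] by (simp add: mult.assoc)
qed

lemma segment_param_continuous: "continuous_on S (segment_param u v)"
  unfolding segment_param_def by (intro continuous_intros)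

lemma segment_param_measurable [measurable]: "segment_param u v \<in> borel_measurable borel"
  by (intro borel_measurable_continuous_onI segment_param_continuous)

lemma segment_measure_sets [simp]: "sets (segment_measure u v) = sets borel"
  and segment_measure_space [simp]: "space (segment_measure u v) = UNIV"
  by (simp_all add: segment_measure_def)

lemma emeasure_segment_measure:
  fixes u v :: "'a::real_normed_vector"
  assumes "A \<in> sets borel"
  shows "emeasure (segment_measure u v) A = ennreal (dist u v) * emeasure lborel ({0..1} \<inter> segment_param u v -` A)"
proof -
  have m: "segment_param u v -` A \<in> sets borel"
    using measurable_sets_borel[OF segment_param_measurable assms] .
  have "emeasure (segment_measure u v) A = emeasure (density lborel (\<lambda>t. ennreal (dist u v * indicator {0..1} t))) (segment_param u v -` A)"
    unfolding segment_measure_def using assms by (subst emeasure_distr) auto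
  also have "\<dots> = (\<integral>\<^sup>+t. ennreal (dist u v * indicator {0..1} t) * indicator (segment_param u v -` A) t \<partial>lborel)"
    using m by (subst emeasure_density) auto
  also have "\<dots> = (\<integral>\<^sup>+t. ennreal (dist u v) * indicator ({0..1} \<inter> segment_param u v -` A) t \<partial>lborel)"
    by (intro nn_integral_cong) (auto simp: indicator_def)
  also have "\<dots> = ennreal (dist u v) * emeasure lborel ({0..1} \<inter> segment_param u v -` A)"
    using m by (subst nn_integral_cmult_indicator) auto
  finally show ?thesis .
qed

lemma segment_measure_total: "emeasure (segment_measure u v) UNIV = ennreal (dist u v)"
  by (subst emeasure_segment_measure) auto

lemma segment_measure_finite: "finite_measure (segment_measure u v)"
  by (rule finite_measureI) (simp add: segment_measure_total)

text \<open>The starting point is removed so that segments issuing from one point can be disjoint;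
  for \<open>u \<noteq> v\<close> it corresponds to a single, Lebesgue-null parameter.\<close>

lemma segment_measure_concentrated:
  fixes u v :: "'a::real_normed_vector"
  shows "emeasure (segment_measure u v) (- (closed_segment u v - {u})) = 0"
proof (cases "u = v")
  case True
  then show ?thesis by (subst emeasure_segment_measure) (auto intro: borel_closed)
next
  case False
  have "{0..1} \<inter> segment_param u v -` (- (closed_segment u v - {u})) \<subseteq> {0}"
  proof
    fix t assume t: "t \<in> {0..1} \<inter> segment_param u v -` (- (closed_segment u v - {u}))"
    then have "segment_param u v t \<in> closed_segment u v"
      by (auto simp: segment_param_def closed_segment_def algebra_simps intro!: exI[of _ t])
    then have "segment_param u v t = u" using t by auto
    then show "t \<in> {0}" using False by (simp add: segment_param_def)
  qed
  then have "emeasure lborel ({0..1} \<inter> segment_param u v -` (- (closed_segment u v - {u}))) \<le> emeasure lborel {0::real}"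
    by (intro emeasure_mono) auto
  then show ?thesis by (subst emeasure_segment_measure) auto
qed

lemma segment_mass_bound: "mass_bound (segment_current u v) (segment_measure u v)"
proof (rule mass_boundI)
  fix f p :: "'a \<Rightarrow> real" and L assume f: "f \<in> Lip_bdd" and p: "L-lipschitz_on UNIV p"
  let ?g = "\<lambda>t. f (segment_param u v t)"
  have fl: "(lip_const f)-lipschitz_on UNIV f" by (rule lip_const_lipschitz[OF Lip_bdd_Lip[OF f]])
  have gl: "(lip_const f * dist u v)-lipschitz_on UNIV ?g" by (rule segment_param_lipschitz[OF fl])
  have gc: "continuous_on S (\<lambda>t. \<bar>?g t\<bar>)" for S
    by (intro continuous_intros Lip_continuous_on[OF LipI[OF gl]])
  have fm [measurable]: "f \<in> borel_measurable borel" by (rule Lip_measurable[OF Lip_bdd_Lip[OF f] refl])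
  have "(\<integral>x. \<bar>f x\<bar> \<partial>segment_measure u v) = (\<integral>t. \<bar>?g t\<bar> \<partial>density lborel (\<lambda>t. ennreal (dist u v * indicator {0..1} t)))"
    unfolding segment_measure_def by (subst integral_distr) auto
  also have "\<dots> = (\<integral>t. (dist u v * indicator {0..1} t) *\<^sub>R \<bar>?g t\<bar> \<partial>lborel)"
    by (subst integral_density) auto
  also have "\<dots> = dist u v * (LINT t:{0..1}|lborel. \<bar>?g t\<bar>)"
    by (simp add: set_lebesgue_integral_def mult.assoc)
  also have "(LINT t:{0..1}|lborel. \<bar>?g t\<bar>) = integral {0..1} (\<lambda>t. \<bar>?g t\<bar>)"
    by (intro set_borel_integral_eq_integral(2) borel_integrable_atLeastAtMost')
       (rule gc)
  finally have "(\<integral>x. \<bar>f x\<bar> \<partial>segment_measure u v) = dist u v * integral {0..1} (\<lambda>t. \<bar>?g t\<bar>)" .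
  with rs_integral_bound[OF gl segment_param_lipschitz[OF p, of u v]]
  show "\<bar>segment_current u v f p\<bar> \<le> L * (\<integral>x. \<bar>f x\<bar> \<partial>segment_measure u v)"
    by (simp add: segment_current_def mult.assoc)
qed (simp_all add: segment_measure_finite)

lemma segment_metric_current: "metric_current (segment_current u v)"
proof (rule metric_currentI[OF _ segment_mass_bound])
  note sl = segment_param_lipschitz[OF lip_const_lipschitz, of _ u v]
  show "bilinear_functional (segment_current u v)"
    unfolding bilinear_functional_def segment_current_def
    by (auto intro!: rs_integral_bilinear sl dest!: Lip_bdd_Lip)
next
  fix f p :: "'a \<Rightarrow> real" and P :: "nat \<Rightarrow> 'a \<Rightarrow> real" and L
  assume f: "f \<in> Lip_bdd" and P: "\<And>j. L-lipschitz_on UNIV (P j)" and p: "L-lipschitz_on UNIV p"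
    and lim: "\<And>x. (\<lambda>j. P j x) \<longlonglongrightarrow> p x"
  show "(\<lambda>j. segment_current u v f (P j)) \<longlonglongrightarrow> segment_current u v f p"
    unfolding segment_current_def
    by (rule rs_integral_cont[OF segment_param_lipschitz[OF lip_const_lipschitz[OF Lip_bdd_Lip[OF f]]]
        segment_param_lipschitz[OF P] segment_param_lipschitz[OF p] lim])
next
  fix f p :: "'a \<Rightarrow> real" and U c
  assume f: "f \<in> Lip_bdd" and p: "p \<in> Lip" and U: "open U" "fun_spt f \<subseteq> U" "\<And>x. x \<in> U \<Longrightarrow> p x = c"
  show "segment_current u v f p = 0"
    unfolding segment_current_def
  proof (rule rs_integral_local)
    show "(lip_const f * dist u v)-lipschitz_on UNIV (\<lambda>t. f (segment_param u v t))"
      by (rule segment_param_lipschitz[OF lip_const_lipschitz[OF Lip_bdd_Lip[OF f]]])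
    show "(lip_const p * dist u v)-lipschitz_on UNIV (\<lambda>t. p (segment_param u v t))"
      by (rule segment_param_lipschitz[OF lip_const_lipschitz[OF p]])
    show "open (segment_param u v -` U)" by (rule open_vimage[OF U(1) segment_param_continuous])
    show "closed (segment_param u v -` fun_spt f)"
      by (rule closed_vimage[OF _ segment_param_continuous]) (simp add: fun_spt_def)
    show "segment_param u v -` fun_spt f \<subseteq> segment_param u v -` U" using U(2) by blast
    show "t \<in> segment_param u v -` fun_spt f" if "f (segment_param u v t) \<noteq> 0" for t
      using that closure_subset[of "{x. f x \<noteq> 0}"] by (auto simp: fun_spt_def)
    show "p (segment_param u v t) = c" if "t \<in> segment_param u v -` U" for t using that U(3) by simp
  qed
qed

lemma segment_boundary: "segment_current u v (\<lambda>_. 1) f = f v - f u"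
  by (simp add: segment_current_def rs_integral_const segment_param_def)

subsection \<open>Countable sums of measures and currents\<close>

text \<open>\<open>measure_of\<close> takes the prescribed values only if these form a measure,
  which is checked in \<open>emeasure_measure_series\<close>.\<close>

definition measure_series :: "(nat \<Rightarrow> 'a::topological_space measure) \<Rightarrow> 'a measure" where
  "measure_series \<mu> = measure_of UNIV (sets borel) (\<lambda>A. \<Sum>k. emeasure (\<mu> k) A)"

lemma measure_series_sets [simp]: "sets (measure_series \<mu>) = sets borel"
  and measure_series_space [simp]: "space (measure_series \<mu>) = UNIV"
  using sets.sigma_sets_eq[of borel] by (simp_all add: measure_series_def space_borel)

text \<open>One of the sums is read as an integral over counting measure, which may be exchanged
  with a series of nonnegative functions.\<close>

lemma suminf_ennreal_commute: "(\<Sum>i. \<Sum>j. f i j) = (\<Sum>j. \<Sum>i. f i j)"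
  for f :: "nat \<Rightarrow> nat \<Rightarrow> ennreal"
  using nn_integral_suminf[of "\<lambda>j i. f i j" "count_space UNIV", OF borel_measurable_count_space]
  unfolding nn_integral_count_space_nat .

lemma emeasure_measure_series:
  assumes "\<And>k. sets (\<mu> k) = sets borel" "A \<in> sets borel"
  shows "emeasure (measure_series \<mu>) A = (\<Sum>k. emeasure (\<mu> k) A)"
proof (rule emeasure_measure_of[OF measure_series_def])
  show "countably_additive (sets (measure_series \<mu>)) (\<lambda>A. \<Sum>k. emeasure (\<mu> k) A)"
  proof (rule countably_additiveI)
    fix B :: "nat \<Rightarrow> 'a set"
    assume B: "range B \<subseteq> sets (measure_series \<mu>)" "disjoint_family B"
    have "(\<Sum>i. emeasure (\<mu> k) (B i)) = emeasure (\<mu> k) (\<Union>i. B i)" for k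
      using B assms(1) by (intro suminf_emeasure) auto
    then show "(\<Sum>i. \<Sum>k. emeasure (\<mu> k) (B i)) = (\<Sum>k. emeasure (\<mu> k) (\<Union>i. B i))"
      by (subst suminf_ennreal_commute) simp
  qed
qed (use assms in \<open>auto simp: positive_def\<close>)

lemma nn_integral_measure_series:
  assumes s: "\<And>k. sets (\<mu> k) = sets borel" and f: "f \<in> borel_measurable borel"
  shows "(\<integral>\<^sup>+x. f x \<partial>measure_series \<mu>) = (\<Sum>k. \<integral>\<^sup>+x. f x \<partial>\<mu> k)"
proof -
  have m: "g \<in> borel_measurable borel \<Longrightarrow> g \<in> borel_measurable (\<mu> k)"
    "g \<in> borel_measurable borel \<Longrightarrow> g \<in> borel_measurable (measure_series \<mu>)" for g :: "'a \<Rightarrow> ennreal" and k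
    using s by (simp_all cong: measurable_cong_sets)
  show ?thesis
    using f
  proof (induction rule: borel_measurable_induct)
    case (cong f g)
    then have "f = g" by auto
    then show ?case using cong by simp
  next
    case (set A)
    have "(\<integral>\<^sup>+x. indicator A x \<partial>\<mu> k) = emeasure (\<mu> k) A" for k
      using set s[of k] by (intro nn_integral_indicator) simp
    moreover have "(\<integral>\<^sup>+x. indicator A x \<partial>measure_series \<mu>) = emeasure (measure_series \<mu>) A"
      using set by (intro nn_integral_indicator) simp
    ultimately show ?case by (simp only: emeasure_measure_series[OF s set])
  next
    case (mult u c)
    from mult(2) have "u \<in> borel_measurable (\<mu> k)" "u \<in> borel_measurable (measure_series \<mu>)" for k
      by (rule m)+
    then show ?case by (simp only: nn_integral_cmult mult ennreal_suminf_cmult)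
  next
    case (add u v)
    have "u \<in> borel_measurable (\<mu> k)" "u \<in> borel_measurable (measure_series \<mu>)"
      "v \<in> borel_measurable (\<mu> k)" "v \<in> borel_measurable (measure_series \<mu>)" for k
      by (rule m, rule add)+
    then show ?case by (simp only: nn_integral_add add(3,6) add.IH suminf_add[OF summableI summableI])
  next
    case (seq U)
    have *: "(\<integral>\<^sup>+x. (SUP i. U i) x \<partial>N) = (SUP i. \<integral>\<^sup>+x. U i x \<partial>N)"
      if "\<And>i. U i \<in> borel_measurable N" for N
      unfolding SUP_apply using \<open>incseq U\<close> that by (intro nn_integral_monotone_convergence_SUP)
    have "(\<Sum>k. SUP i. \<integral>\<^sup>+x. U i x \<partial>\<mu> k) = (SUP i. \<Sum>k. \<integral>\<^sup>+x. U i x \<partial>\<mu> k)"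
      using \<open>incseq U\<close> by (intro ennreal_suminf_SUP_eq)
        (auto simp: incseq_def le_fun_def intro!: nn_integral_mono)
    then show ?case
      by (simp only: *[OF m(2)[OF seq(1)]] *[OF m(1)[OF seq(1)]] seq.IH)
  qed
qed

lemma integral_measure_series:
  fixes \<mu> :: "nat \<Rightarrow> 'a::metric_space measure"
  assumes s: "\<And>k. sets (\<mu> k) = sets borel" and fin: "\<And>k. finite_measure (\<mu> k)"
    and c: "\<And>k. emeasure (\<mu> k) UNIV \<le> ennreal (c k)" "\<And>k. 0 \<le> c k" "c sums C" and f: "f \<in> Lip_bdd"
  shows "finite_measure (measure_series \<mu>)" "emeasure (measure_series \<mu>) UNIV \<le> ennreal C"
    "(\<lambda>k. \<integral>x. \<bar>f x\<bar> \<partial>\<mu> k) sums (\<integral>x. \<bar>f x\<bar> \<partial>measure_series \<mu>)"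
proof -
  have "emeasure (measure_series \<mu>) UNIV = (\<Sum>k. emeasure (\<mu> k) UNIV)"
    by (rule emeasure_measure_series[OF s]) auto
  also have "\<dots> \<le> (\<Sum>k. ennreal (c k))"
    by (intro suminf_le c) auto
  also have "\<dots> = ennreal C"
    using suminf_ennreal2[OF c(2) sums_summable[OF c(3)]] sums_unique[OF c(3)] by simp
  finally show tot: "emeasure (measure_series \<mu>) UNIV \<le> ennreal C" .
  then have "emeasure (measure_series \<mu>) UNIV \<noteq> \<infinity>"
    using le_less_trans[OF tot ennreal_less_top] by simp
  then show fs: "finite_measure (measure_series \<mu>)"
    by (intro finite_measureI) simp
  have fa: "(\<lambda>x. \<bar>f x\<bar>) \<in> Lip_bdd" by (rule Lip_bdd_abs[OF f])
  obtain B where B: "B > 0" "\<And>x. \<bar>f x\<bar> \<le> B" using Lip_bddE[OF f] by metis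
  have int: "(\<integral>\<^sup>+x. ennreal \<bar>f x\<bar> \<partial>N) = ennreal (\<integral>x. \<bar>f x\<bar> \<partial>N)"
    if "finite_measure N" "sets N = sets borel" for N
    using Lip_bdd_integrable[OF fa that] by (intro nn_integral_eq_integral) auto
  have le: "(\<integral>x. \<bar>f x\<bar> \<partial>\<mu> k) \<le> B * c k" for k
  proof -
    interpret finite_measure "\<mu> k" by (rule fin)
    have "(\<integral>x. \<bar>f x\<bar> \<partial>\<mu> k) \<le> (\<integral>x. B \<partial>\<mu> k)"
      using B by (intro integral_mono' ) auto
    also have "\<dots> = B * measure (\<mu> k) UNIV" using sets_eq_imp_space_eq[OF s[of k]] by simp
    also have "\<dots> \<le> B * c k"
      using c(1)[of k] c(2)[of k] B(1) by (simp add: emeasure_eq_measure)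
    finally show ?thesis .
  qed
  have sm: "summable (\<lambda>k. \<integral>x. \<bar>f x\<bar> \<partial>\<mu> k)"
    by (rule summable_comparison_test[OF _ summable_mult[OF sums_summable[OF c(3)], of B]]) (use le in auto)
  have "f \<in> borel_measurable borel" by (rule Lip_measurable[OF Lip_bdd_Lip[OF f] refl])
  then have "(\<lambda>x. ennreal \<bar>f x\<bar>) \<in> borel_measurable borel" by measurable
  from nn_integral_measure_series[of \<mu>, OF s this]
  have "ennreal (\<integral>x. \<bar>f x\<bar> \<partial>measure_series \<mu>) = (\<Sum>k. ennreal (\<integral>x. \<bar>f x\<bar> \<partial>\<mu> k))"
    unfolding int[OF fs measure_series_sets] int[OF fin s] .
  also have "\<dots> = ennreal (\<Sum>k. \<integral>x. \<bar>f x\<bar> \<partial>\<mu> k)"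
    by (intro suminf_ennreal2 sm) simp
  finally have "(\<integral>x. \<bar>f x\<bar> \<partial>measure_series \<mu>) = (\<Sum>k. \<integral>x. \<bar>f x\<bar> \<partial>\<mu> k)"
    by (subst (asm) ennreal_inj) (auto intro!: suminf_nonneg sm)
  then show "(\<lambda>k. \<integral>x. \<bar>f x\<bar> \<partial>\<mu> k) sums (\<integral>x. \<bar>f x\<bar> \<partial>measure_series \<mu>)"
    using summable_sums[OF sm] by simp
qed

text \<open>The \<open>k\<close>-th term is dominated by \<open>L\<close> times the integral of
  \<open>\<bar>f x\<bar>\<close> over \<open>\<mu> k\<close>, summable in \<open>k\<close> and
  independent of the sequence of second arguments; so Tannery's theorem transfers the continuity
  axiom to the sum.\<close>

lemma current_series:
  fixes T :: "nat \<Rightarrow> 'a::metric_space functional"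
  assumes T: "\<And>k. metric_current (T k)" and m: "\<And>k. mass_bound (T k) (\<mu> k)"
    and c: "\<And>k. emeasure (\<mu> k) UNIV \<le> ennreal (c k)" "\<And>k. 0 \<le> c k" "c sums C"
  shows "f \<in> Lip_bdd \<Longrightarrow> p \<in> Lip \<Longrightarrow> summable (\<lambda>k. T k f p)"
    and "mass_bound (\<lambda>f p. \<Sum>k. T k f p) (measure_series \<mu>)"
    and "metric_current (\<lambda>f p. \<Sum>k. T k f p)"
proof -
  note ims = integral_measure_series[OF mass_boundD_sets[OF m] mass_boundD_finite[OF m] c]
  have dom: "summable (\<lambda>k. L * (\<integral>x. \<bar>f x\<bar> \<partial>\<mu> k))" if "f \<in> Lip_bdd" for f L
    using sums_summable[OF ims(3)[OF that]] by (rule summable_mult)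
  have sm: "summable (\<lambda>k. \<bar>T k f p\<bar>)" if f: "f \<in> Lip_bdd" and p: "L-lipschitz_on UNIV p"
    for f p :: "'a \<Rightarrow> real" and L
    by (rule summable_comparison_test[OF _ dom[OF f, of L]]) (use mass_boundD[OF m f p] in auto)
  show sm': "summable (\<lambda>k. T k f p)" if "f \<in> Lip_bdd" "p \<in> Lip" for f p :: "'a \<Rightarrow> real"
    using sm[OF that(1) lip_const_lipschitz[OF that(2)]] by (rule summable_rabs_cancel)
  show mb: "mass_bound (\<lambda>f p. \<Sum>k. T k f p) (measure_series \<mu>)"
  proof (rule mass_boundI)
    show "finite_measure (measure_series \<mu>)" by (rule ims(1)) (rule Lip_bdd_const)
    fix f p :: "'a \<Rightarrow> real" and L assume f: "f \<in> Lip_bdd" and p: "L-lipschitz_on UNIV p"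
    have "\<bar>\<Sum>k. T k f p\<bar> \<le> (\<Sum>k. \<bar>T k f p\<bar>)" by (rule summable_rabs[OF sm[OF f p]])
    also have "\<dots> \<le> (\<Sum>k. L * (\<integral>x. \<bar>f x\<bar> \<partial>\<mu> k))"
      by (rule suminf_le[OF mass_boundD[OF m f p] sm[OF f p] dom[OF f]])
    also have "\<dots> = L * (\<integral>x. \<bar>f x\<bar> \<partial>measure_series \<mu>)"
      using sums_unique[OF sums_mult[OF ims(3)[OF f], of L]] by simp
    finally show "\<bar>\<Sum>k. T k f p\<bar> \<le> L * (\<integral>x. \<bar>f x\<bar> \<partial>measure_series \<mu>)" .
  qed simp
  show "metric_current (\<lambda>f p. \<Sum>k. T k f p)"
  proof (rule metric_currentI[OF _ mb])
    show "bilinear_functional (\<lambda>f p. \<Sum>k. T k f p)"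
      unfolding bilinear_functional_def
    proof (intro conjI ballI allI)
      fix f g p :: "'a \<Rightarrow> real" and a b :: real assume f: "f \<in> Lip_bdd" and g: "g \<in> Lip_bdd" and p: "p \<in> Lip"
      show "(\<Sum>k. T k (\<lambda>x. a * f x + b * g x) p) = a * (\<Sum>k. T k f p) + b * (\<Sum>k. T k g p)"
        using sums_add[OF sums_mult[OF summable_sums[OF sm'[OF f p]], of a] sums_mult[OF summable_sums[OF sm'[OF g p]], of b]]
        by (simp add: bilinear_left[OF current_bilinear[OF T] f g p] sums_unique[symmetric])
    next
      fix f p q :: "'a \<Rightarrow> real" and a b :: real assume f: "f \<in> Lip_bdd" and p: "p \<in> Lip" and q: "q \<in> Lip"
      show "(\<Sum>k. T k f (\<lambda>x. a * p x + b * q x)) = a * (\<Sum>k. T k f p) + b * (\<Sum>k. T k f q)"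
        using sums_add[OF sums_mult[OF summable_sums[OF sm'[OF f p]], of a] sums_mult[OF summable_sums[OF sm'[OF f q]], of b]]
        by (simp add: bilinear_right[OF current_bilinear[OF T] f p q] sums_unique[symmetric])
    qed
  next
    fix f p :: "'a \<Rightarrow> real" and P :: "nat \<Rightarrow> 'a \<Rightarrow> real" and L
    assume f: "f \<in> Lip_bdd" and P: "\<And>j. L-lipschitz_on UNIV (P j)" and p: "L-lipschitz_on UNIV p"
      and lim: "\<And>x. (\<lambda>j. P j x) \<longlonglongrightarrow> p x"
    have "eventually (\<lambda>(k, j). norm (T k f (P j)) \<le> L * (\<integral>x. \<bar>f x\<bar> \<partial>\<mu> k)) (at_top \<times>\<^sub>F sequentially)"
      using mass_boundD[OF m f P] by (intro always_eventually) auto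
    from tannerys_theorem[OF current_continuous[OF T f P LipI[OF p] lim] this dom[OF f]]
    show "(\<lambda>j. \<Sum>k. T k f (P j)) \<longlonglongrightarrow> (\<Sum>k. T k f p)" by simp
  next
    fix f p :: "'a \<Rightarrow> real" and U c
    assume "f \<in> Lip_bdd" "p \<in> Lip" "open U" "fun_spt f \<subseteq> U" "\<And>x. x \<in> U \<Longrightarrow> p x = c"
    then have "T k f p = 0" for k by (rule current_local[OF T])
    then show "(\<Sum>k. T k f p) = 0" by simp
  qed
qed

lemma zero_current:
  shows "mass_bound ((\<lambda>_ _. 0) :: 'a::metric_space functional) (null_measure borel)"
    and "metric_current ((\<lambda>_ _. 0) :: 'a functional)"
proof -
  show mb: "mass_bound ((\<lambda>_ _. 0) :: 'a functional) (null_measure borel)"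
  proof (rule mass_boundI)
    show "finite_measure (null_measure borel)" by (rule finite_measureI) simp
    show "\<bar>0\<bar> \<le> L * (\<integral>x. \<bar>f x\<bar> \<partial>null_measure borel)" if "L-lipschitz_on UNIV p" for f p :: "'a \<Rightarrow> real" and L
      using lipschitz_on_nonneg[OF that] by (simp add: integral_nonneg)
  qed simp
  show "metric_current ((\<lambda>_ _. 0) :: 'a functional)"
    by (rule metric_currentI[OF _ mb]) (auto simp: bilinear_functional_def)
qed

lemma current_cmult:
  assumes T: "metric_current T" and m: "mass_bound T \<mu>"
  shows "metric_current (\<lambda>f p. a * T f p)" "mass_bound (\<lambda>f p. a * T f p) (density \<mu> (\<lambda>_. ennreal \<bar>a\<bar>))"
proof -
  interpret finite_measure \<mu> using mass_boundD_finite[OF m] .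
  show mb: "mass_bound (\<lambda>f p. a * T f p) (density \<mu> (\<lambda>_. ennreal \<bar>a\<bar>))"
  proof (rule mass_boundI)
    show "finite_measure (density \<mu> (\<lambda>_. ennreal \<bar>a\<bar>))"
      by (rule finite_measureI) (simp add: emeasure_density_const emeasure_eq_measure ennreal_mult[symmetric])
    fix f p :: "'a \<Rightarrow> real" and L assume f: "f \<in> Lip_bdd" and p: "L-lipschitz_on UNIV p"
    have [measurable]: "f \<in> borel_measurable \<mu>" by (rule Lip_measurable[OF Lip_bdd_Lip[OF f] mass_boundD_sets[OF m]])
    have "\<bar>a * T f p\<bar> \<le> \<bar>a\<bar> * (L * (\<integral>x. \<bar>f x\<bar> \<partial>\<mu>))"
      unfolding abs_mult by (intro mult_left_mono mass_boundD[OF m f p]) simp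
    also have "\<dots> = L * (\<integral>x. \<bar>f x\<bar> \<partial>density \<mu> (\<lambda>_. ennreal \<bar>a\<bar>))"
      by (subst integral_density) auto
    finally show "\<bar>a * T f p\<bar> \<le> L * (\<integral>x. \<bar>f x\<bar> \<partial>density \<mu> (\<lambda>_. ennreal \<bar>a\<bar>))" .
  qed (simp add: mass_boundD_sets[OF m])
  show "metric_current (\<lambda>f p. a * T f p)"
  proof (rule metric_currentI[OF _ mb])
    show "bilinear_functional (\<lambda>f p. a * T f p)"
      unfolding bilinear_functional_def
      by (simp add: bilinear_left[OF current_bilinear[OF T]] bilinear_right[OF current_bilinear[OF T]] algebra_simps)
  next
    fix f p :: "'a \<Rightarrow> real" and P :: "nat \<Rightarrow> 'a \<Rightarrow> real" and L
    assume f: "f \<in> Lip_bdd" and P: "\<And>j. L-lipschitz_on UNIV (P j)" and p: "L-lipschitz_on UNIV p"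
      and lim: "\<And>x. (\<lambda>j. P j x) \<longlonglongrightarrow> p x"
    show "(\<lambda>j. a * T f (P j)) \<longlonglongrightarrow> a * T f p"
      by (rule tendsto_mult_left[OF current_continuous[OF T f P LipI[OF p] lim]])
  next
    fix f p :: "'a \<Rightarrow> real" and U c
    assume "f \<in> Lip_bdd" "p \<in> Lip" "open U" "fun_spt f \<subseteq> U" "\<And>x. x \<in> U \<Longrightarrow> p x = c"
    then have "T f p = 0" by (rule current_local[OF T])
    then show "a * T f p = 0" by simp
  qed
qed

subsection \<open>Currents with prescribed boundary, singular to a given measure\<close>

text \<open>Collects what the correction to \<open>T\<close> must satisfy, in a form stable under
  countable sums. A mass bound \<open>\<nu>\<close> replaces the mass measure, so that sums and
  multiples raise no question of minimality; \<open>A\<close> witnesses singularity to \<mu>, and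
  the support condition is that \<open>\<nu>\<close> vanishes off \<open>K\<close>.\<close>

definition fillable :: "'a::metric_space measure \<Rightarrow> 'a set \<Rightarrow> (('a \<Rightarrow> real) \<Rightarrow> real) \<Rightarrow> real \<Rightarrow> bool" where
  "fillable \<mu> K m c \<longleftrightarrow> 0 \<le> c \<and> (\<exists>R \<nu> A. metric_current R \<and> mass_bound R \<nu> \<and> (\<forall>f\<in>Lip. R (\<lambda>_. 1) f = m f) \<and>
     emeasure \<nu> UNIV \<le> ennreal c \<and> A \<in> sets borel \<and> emeasure \<mu> A = 0 \<and> emeasure \<nu> (- A) = 0 \<and> emeasure \<nu> (- K) = 0)"

lemma fillable_zero: "fillable \<mu> K (\<lambda>_. 0) 0"
  unfolding fillable_def using zero_current
  by (intro conjI exI[of _ "\<lambda>_ _. 0"] exI[of _ "null_measure borel"] exI[of _ "{}"]) auto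

text \<open>The carriers are united: a countable union of \<mu>-null sets is \<mu>-null, and its
  complement lies in the complement of each.\<close>

lemma fillable_sums:
  fixes \<mu> :: "'a::metric_space measure"
  assumes sm: "sets \<mu> = sets borel" and K: "closed K" and f: "\<And>k. fillable \<mu> K (m k) (c k)" and c: "c sums C"
    and m: "\<And>f. f \<in> Lip \<Longrightarrow> (\<lambda>k. m k f) sums M f"
  shows "fillable \<mu> K M C"
proof -
  have c0: "0 \<le> c k" for k using f by (simp add: fillable_def)
  have "\<forall>k. \<exists>R \<nu> A. metric_current R \<and> mass_bound R \<nu> \<and> (\<forall>f\<in>Lip. R (\<lambda>_. 1) f = m k f) \<and>
     emeasure \<nu> UNIV \<le> ennreal (c k) \<and> A \<in> sets borel \<and> emeasure \<mu> A = 0 \<and> emeasure \<nu> (- A) = 0 \<and> emeasure \<nu> (- K) = 0"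
    using f unfolding fillable_def by blast
  then obtain R where "\<forall>k. \<exists>\<nu> A. metric_current (R k) \<and> mass_bound (R k) \<nu> \<and> (\<forall>f\<in>Lip. R k (\<lambda>_. 1) f = m k f) \<and>
     emeasure \<nu> UNIV \<le> ennreal (c k) \<and> A \<in> sets borel \<and> emeasure \<mu> A = 0 \<and> emeasure \<nu> (- A) = 0 \<and> emeasure \<nu> (- K) = 0"
    by (rule choice[THEN exE])
  then obtain \<nu> where "\<forall>k. \<exists>A. metric_current (R k) \<and> mass_bound (R k) (\<nu> k) \<and> (\<forall>f\<in>Lip. R k (\<lambda>_. 1) f = m k f) \<and>
     emeasure (\<nu> k) UNIV \<le> ennreal (c k) \<and> A \<in> sets borel \<and> emeasure \<mu> A = 0 \<and> emeasure (\<nu> k) (- A) = 0 \<and> emeasure (\<nu> k) (- K) = 0"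
    by (rule choice[THEN exE])
  then obtain A where *: "\<forall>k. metric_current (R k) \<and> mass_bound (R k) (\<nu> k) \<and> (\<forall>f\<in>Lip. R k (\<lambda>_. 1) f = m k f) \<and>
     emeasure (\<nu> k) UNIV \<le> ennreal (c k) \<and> A k \<in> sets borel \<and> emeasure \<mu> (A k) = 0 \<and> emeasure (\<nu> k) (- A k) = 0 \<and> emeasure (\<nu> k) (- K) = 0"
    by (rule choice[THEN exE])
  then have R: "metric_current (R k)" and n: "mass_bound (R k) (\<nu> k)" and b: "\<And>f. f \<in> Lip \<Longrightarrow> R k (\<lambda>_. 1) f = m k f"
    and le: "emeasure (\<nu> k) UNIV \<le> ennreal (c k)" and A: "A k \<in> sets borel" "emeasure \<mu> (A k) = 0" "emeasure (\<nu> k) (- A k) = 0"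
    and nK: "emeasure (\<nu> k) (- K) = 0" for k
    by simp_all
  have sn: "sets (\<nu> k) = sets borel" for k by (rule mass_boundD_sets[OF n])
  note S = current_series[OF R n le c0 c]
  note ims = integral_measure_series[OF sn mass_boundD_finite[OF n] le c0 c]
  show ?thesis
    unfolding fillable_def
  proof (intro conjI exI ballI)
    show "0 \<le> C" using sums_le[OF c0 sums_zero c] .
    show "metric_current (\<lambda>f p. \<Sum>k. R k f p)" by (rule S(3))
    show "mass_bound (\<lambda>f p. \<Sum>k. R k f p) (measure_series \<nu>)" by (rule S(2))
    show "(\<Sum>k. R k (\<lambda>_. 1) f) = M f" if "f \<in> Lip" for f
      using b[OF that] sums_unique[OF m[OF that]] by simp
    show "emeasure (measure_series \<nu>) UNIV \<le> ennreal C" by (rule ims(2)) (rule Lip_bdd_const)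
    show AU: "(\<Union>k. A k) \<in> sets borel" using A(1) by auto
    have "(\<Union>k. A k) \<in> null_sets \<mu>" using A sm by (intro null_sets_UN) (auto simp: null_sets_def)
    then show "emeasure \<mu> (\<Union>k. A k) = 0" by blast
    have "emeasure (\<nu> k) (- (\<Union>k. A k)) \<le> emeasure (\<nu> k) (- A k)" for k
      using A(1) sn by (intro emeasure_mono) auto
    then have "emeasure (\<nu> k) (- (\<Union>k. A k)) = 0" for k using A(3) by (metis le_zero_eq)
    then show "emeasure (measure_series \<nu>) (- (\<Union>k. A k)) = 0"
      by (subst emeasure_measure_series[OF sn borel_comp[OF AU]]) simp
    show "emeasure (measure_series \<nu>) (- K) = 0"
      using K nK by (subst emeasure_measure_series[OF sn]) auto
  qed
qed

text \<open>A finite sum is a series padded with the zero current.\<close>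

lemma fillable_add:
  assumes sm: "sets \<mu> = sets borel" and K: "closed K" and m: "fillable \<mu> K m c" "fillable \<mu> K m' c'"
  shows "fillable \<mu> K (\<lambda>f. m f + m' f) (c + c')"
proof -
  define mm where "mm k = (if k = 0 then m else if k = 1 then m' else (\<lambda>_. 0))" for k :: nat
  define cc where "cc k = (if k = 0 then c else if k = 1 then c' else 0)" for k :: nat
  show ?thesis
  proof (rule fillable_sums[OF sm K, of mm cc])
    show "fillable \<mu> K (mm k) (cc k)" for k using m by (simp add: mm_def cc_def fillable_zero)
    have "cc sums (\<Sum>k\<in>{0, 1}. cc k)" by (rule sums_finite) (auto simp: cc_def)
    then show "cc sums (c + c')" by (simp add: cc_def)
    show "(\<lambda>k. mm k f) sums (m f + m' f)" for f
    proof -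
      have "(\<lambda>k. mm k f) sums (\<Sum>k\<in>{0, 1}. mm k f)" by (rule sums_finite) (auto simp: mm_def)
      then show ?thesis by (simp add: mm_def)
    qed
  qed
qed

lemma fillable_sum:
  assumes "sets \<mu> = sets borel" "closed K" "finite I" "\<And>i. i \<in> I \<Longrightarrow> fillable \<mu> K (m i) (c i)"
  shows "fillable \<mu> K (\<lambda>f. \<Sum>i\<in>I. m i f) (\<Sum>i\<in>I. c i)"
  using assms(3,4)
proof (induction I rule: finite_induct)
  case empty
  show ?case by (simp add: fillable_zero)
next
  case (insert i I)
  have "fillable \<mu> K (\<lambda>f. m i f + (\<Sum>i\<in>I. m i f)) (c i + (\<Sum>i\<in>I. c i))"
    by (intro fillable_add[OF assms(1,2)] insert.IH insert.prems) simp_all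
  then show ?case using insert.hyps by simp
qed

lemma fillable_cmult:
  assumes "fillable \<mu> K m c"
  shows "fillable \<mu> K (\<lambda>f. a * m f) (\<bar>a\<bar> * c)"
proof -
  obtain R \<nu> A where R: "metric_current R" "mass_bound R \<nu>" "\<And>f. f \<in> Lip \<Longrightarrow> R (\<lambda>_. 1) f = m f"
    "emeasure \<nu> UNIV \<le> ennreal c" "A \<in> sets borel" "emeasure \<mu> A = 0" "emeasure \<nu> (- A) = 0" "emeasure \<nu> (- K) = 0"
    and c: "0 \<le> c" using assms unfolding fillable_def by blast
  have sn: "sets \<nu> = sets borel" by (rule mass_boundD_sets[OF R(2)])
  have em: "emeasure (density \<nu> (\<lambda>_. ennreal \<bar>a\<bar>)) X = ennreal \<bar>a\<bar> * emeasure \<nu> X" if "X \<in> sets borel" for X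
    using that sn by (simp add: emeasure_density_const)
  \<comment> \<open>Outside the \<sigma>-algebra \<open>emeasure\<close> is 0 by convention, so
    \<open>K\<close> may be an arbitrary set.\<close>
  have z: "emeasure (density \<nu> (\<lambda>_. ennreal \<bar>a\<bar>)) X = 0" if "emeasure \<nu> X = 0" for X
    using that by (cases "X \<in> sets \<nu>") (simp_all add: emeasure_density_const emeasure_notin_sets)
  show ?thesis
    unfolding fillable_def
  proof (intro conjI exI ballI)
    show "0 \<le> \<bar>a\<bar> * c" using c by simp
    show "metric_current (\<lambda>f p. a * R f p)" "mass_bound (\<lambda>f p. a * R f p) (density \<nu> (\<lambda>_. ennreal \<bar>a\<bar>))"
      by (rule current_cmult[OF R(1,2)])+
    show "a * R (\<lambda>_. 1) f = a * m f" if "f \<in> Lip" for f using R(3)[OF that] by simp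
    have "ennreal \<bar>a\<bar> * emeasure \<nu> UNIV \<le> ennreal \<bar>a\<bar> * ennreal c" by (rule mult_left_mono[OF R(4)]) simp
    then show "emeasure (density \<nu> (\<lambda>_. ennreal \<bar>a\<bar>)) UNIV \<le> ennreal (\<bar>a\<bar> * c)"
      using c by (simp add: em ennreal_mult)
    show "A \<in> sets borel" "emeasure \<mu> A = 0" by (fact R)+
    show "emeasure (density \<nu> (\<lambda>_. ennreal \<bar>a\<bar>)) (- A) = 0" "emeasure (density \<nu> (\<lambda>_. ennreal \<bar>a\<bar>)) (- K) = 0"
      by (intro z R)+
  qed
qed

lemma fillable_mono:
  assumes "fillable \<mu> K m c" "c \<le> c'"
  shows "fillable \<mu> K m c'"
proof -
  have c: "ennreal c \<le> ennreal c'" by (rule ennreal_leI[OF assms(2)])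
  obtain R \<nu> A where R: "metric_current R" "mass_bound R \<nu>" "\<forall>f\<in>Lip. R (\<lambda>_. 1) f = m f"
    "emeasure \<nu> UNIV \<le> ennreal c" "A \<in> sets borel" "emeasure \<mu> A = 0" "emeasure \<nu> (- A) = 0" "emeasure \<nu> (- K) = 0"
    and c0: "0 \<le> c" using assms(1) unfolding fillable_def by blast
  show ?thesis
    unfolding fillable_def
    by (intro conjI exI[of _ R] exI[of _ \<nu>] exI[of _ A] R order.trans[OF c0 assms(2)] order.trans[OF R(4) c])
qed

lemma fillable_segment:
  fixes u v :: "'a::real_normed_vector"
  assumes "emeasure \<mu> (closed_segment u v - {u}) = 0" "closed_segment u v \<subseteq> K"
  shows "fillable \<mu> K (\<lambda>f. f v - f u) (dist u v)"
proof -
  have cb: "closed_segment u v - {u} \<in> sets borel"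
    by (intro sets.Diff borel_closed compact_imp_closed[OF compact_segment]) auto
  have "emeasure (segment_measure u v) (- K) \<le> emeasure (segment_measure u v) (- (closed_segment u v - {u}))"
    using assms(2) cb by (intro emeasure_mono) auto
  then have "emeasure (segment_measure u v) (- K) = 0"
    unfolding segment_measure_concentrated by (rule le_zero_eq[THEN iffD1])
  moreover have "emeasure (segment_measure u v) UNIV \<le> ennreal (dist u v)"
    by (simp add: segment_measure_total)
  ultimately show ?thesis
    unfolding fillable_def using segment_metric_current segment_mass_bound segment_boundary
      cb assms(1) segment_measure_concentrated
    by (intro conjI exI[of _ "segment_current u v"] exI[of _ "segment_measure u v"]
        exI[of _ "closed_segment u v - {u}"] ballI zero_le_dist)
qed

text \<open>The dimension enters here: one vector cannot span two independent ones. The vector found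
  is the direction of the bends.\<close>

lemma vector_off_line:
  fixes e :: "'a::real_vector"
  assumes "\<exists>V::'a set. independent V \<and> card V = 2"
  obtains v where "\<And>c. v \<noteq> c *\<^sub>R e"
proof -
  obtain V :: "'a set" where V: "independent V" "card V = 2" using assms by blast
  have "\<not> V \<subseteq> span {e}"
  proof
    assume "V \<subseteq> span {e}"
    then have "card V \<le> card {e}" using independent_span_bound[of "{e}" V] V(1) by auto
    then show False using V(2) by simp
  qed
  then obtain v where "v \<notin> span {e}" by blast
  then have "v \<noteq> c *\<^sub>R e" for c by (auto simp: span_singleton)
  then show ?thesis by (rule that)
qed

text \<open>Finite partial sums of the measures of disjoint sets stay below the total mass, so the
  family is summable over all real parameters and hence nonzero at countably many only.\<close>

lemma countable_charged:
  assumes "finite_measure \<mu>" and P: "\<And>t. P t \<in> sets \<mu>" and disj: "disjoint_family P"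
  shows "countable {t. emeasure \<mu> (P t) \<noteq> 0}"
proof -
  interpret finite_measure \<mu> by fact
  have "(\<lambda>t. measure \<mu> (P t)) summable_on UNIV"
  proof (rule nonneg_bdd_above_summable_on)
    have "(\<Sum>t\<in>F. measure \<mu> (P t)) \<le> measure \<mu> (space \<mu>)" if "finite F" for F
    proof -
      have "(\<Sum>t\<in>F. measure \<mu> (P t)) = measure \<mu> (\<Union>t\<in>F. P t)"
        using that P disj by (intro finite_measure_finite_Union[symmetric]) (auto simp: disjoint_family_on_def)
      also have "\<dots> \<le> measure \<mu> (space \<mu>)" by (rule bounded_measure)
      finally show ?thesis .
    qed
    then show "bdd_above (sum (\<lambda>t. measure \<mu> (P t)) ` {F. F \<subseteq> UNIV \<and> finite F})"
      by (intro bdd_aboveI2) auto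
  qed simp
  from summable_countable_real[OF this] show ?thesis
    by (simp add: emeasure_eq_measure)
qed

text \<open>A common point gives \<open>s (e + t v) = s' (e + t' v)\<close>. As \<open>v\<close> is
  no multiple of \<open>e\<close>, the coefficients agree: \<open>s = s'\<close> and
  \<open>s t = s' t'\<close>, so \<open>s = 0\<close> for different \<open>t\<close>, and the point
  is \<open>x\<close>.\<close>

lemma countable_charged_rays:
  fixes \<mu> :: "'a::real_normed_vector measure"
  assumes fin: "finite_measure \<mu>" and sm: "sets \<mu> = sets borel" and e: "e \<noteq> 0" and v: "\<And>c. v \<noteq> c *\<^sub>R e"
  shows "countable {t. emeasure \<mu> (closed_segment x (x + (e + t *\<^sub>R v)) - {x}) \<noteq> 0}"
proof (rule countable_charged[OF fin])
  show "closed_segment x (x + (e + t *\<^sub>R v)) - {x} \<in> sets \<mu>" for t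
    unfolding sm by (intro sets.Diff borel_closed compact_imp_closed[OF compact_segment]) auto
  show "disjoint_family (\<lambda>t. closed_segment x (x + (e + t *\<^sub>R v)) - {x})"
    unfolding disjoint_family_on_def
  proof (intro ballI impI, rule ccontr)
    fix t t' :: real assume tt: "t \<noteq> t'"
    assume "(closed_segment x (x + (e + t *\<^sub>R v)) - {x}) \<inter> (closed_segment x (x + (e + t' *\<^sub>R v)) - {x}) \<noteq> {}"
    then obtain w where w: "w \<in> closed_segment x (x + (e + t *\<^sub>R v))" "w \<in> closed_segment x (x + (e + t' *\<^sub>R v))" "w \<noteq> x"
      by blast
    obtain s where s: "w = x + s *\<^sub>R (e + t *\<^sub>R v)"
      using w(1) unfolding closed_segment_def by (auto simp: algebra_simps)
    obtain s' where s': "w = x + s' *\<^sub>R (e + t' *\<^sub>R v)"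
      using w(2) unfolding closed_segment_def by (auto simp: algebra_simps)
    have eq: "(s' * t' - s * t) *\<^sub>R v = (s - s') *\<^sub>R e" using s s' by (simp add: algebra_simps)
    have "s' * t' - s * t = 0"
    proof (rule ccontr)
      assume n: "s' * t' - s * t \<noteq> 0"
      have "v = (1 / (s' * t' - s * t)) *\<^sub>R ((s' * t' - s * t) *\<^sub>R v)" using n by simp
      also have "\<dots> = ((1 / (s' * t' - s * t)) * (s - s')) *\<^sub>R e" unfolding eq by simp
      finally show False using v by blast
    qed
    moreover from this eq have "s = s'" using e by simp
    ultimately have "s * (t' - t) = 0" by (simp add: algebra_simps)
    then have "s = 0" using tt by simp
    then show False using s w(3) by simp
  qed
qed

text \<open>
  A segment from \<open>x\<close> to \<open>y\<close> may be charged by \<open>\<mu>\<close>, but the paths from \<open>x\<close> to \<open>y\<close> through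
  \<open>(x + y) / 2 + t v\<close> are made of pairwise disjoint half-open segments issuing from \<open>x\<close> and from \<open>y\<close>,
  so only countably many are charged.
\<close>

lemma fillable_dipole:
  fixes \<mu> :: "'a::real_normed_vector measure"
  assumes dim: "\<exists>V::'a set. independent V \<and> card V = 2"
    and fin: "finite_measure \<mu>" and sm: "sets \<mu> = sets borel"
    and xy: "x \<noteq> y" "closed_segment x y \<subseteq> H" and \<rho>: "\<rho> > 0" and \<tau>: "\<tau> > 0"
  shows "fillable \<mu> {z. infdist z H \<le> \<rho>} (\<lambda>f. f y - f x) (dist x y + \<tau>)"
proof -
  define e where "e = (1 / 2) *\<^sub>R (y - x)"
  have e: "e \<noteq> 0" "- e \<noteq> 0" using xy(1) by (simp_all add: e_def)
  obtain v where v: "\<And>c. v \<noteq> c *\<^sub>R e" using vector_off_line[OF dim] by blast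
  have v': "v \<noteq> c *\<^sub>R (- e)" for c using v[of "- c"] by simp
  have v0: "norm v > 0" using v[of 0] by simp
  \<comment> \<open>For \<open>t < \<sigma>\<close> the displacement \<open>t * norm v\<close> is
    below \<open>\<rho>\<close>, which keeps the path near \<open>H\<close>, and below
    \<open>\<tau> / 2\<close>, which is the excess length allowed for each of its two
    halves.\<close>
  define \<sigma> where "\<sigma> = min \<rho> (\<tau> / 2) / norm v"
  have \<sigma>: "\<sigma> > 0" using \<rho> \<tau> v0 by (simp add: \<sigma>_def)
  define C where "C = {t. emeasure \<mu> (closed_segment x (x + (e + t *\<^sub>R v)) - {x}) \<noteq> 0} \<union>
    {t. emeasure \<mu> (closed_segment y (y + (- e + t *\<^sub>R v)) - {y}) \<noteq> 0}"
  have "countable C"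
    unfolding C_def using countable_charged_rays[OF fin sm e(1) v] countable_charged_rays[OF fin sm e(2) v'] by simp
  then have "\<not> {0<..<\<sigma>} \<subseteq> C"
    using \<sigma> uncountable_open_interval[of 0 \<sigma>] countable_subset by blast
  then obtain t where "t \<in> {0<..<\<sigma>}" and tC: "t \<notin> C" by blast
  then have t: "0 < t" "t < \<sigma>" "t \<notin> C" by simp_all
  define z where "z = x + (e + t *\<^sub>R v)"
  have z: "z = y + (- e + t *\<^sub>R v)"
  proof -
    have "x + e = y - e" by (simp add: e_def algebra_simps flip: scaleR_add_left)
    then show ?thesis by (simp add: z_def algebra_simps)
  qed
  have "emeasure \<mu> (closed_segment x (x + (e + t *\<^sub>R v)) - {x}) = 0"
    "emeasure \<mu> (closed_segment y (y + (- e + t *\<^sub>R v)) - {y}) = 0"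
    using t(3) unfolding C_def by blast+
  then have null: "emeasure \<mu> (closed_segment x z - {x}) = 0" "emeasure \<mu> (closed_segment y z - {y}) = 0"
    unfolding z_def[symmetric] z[symmetric] by simp_all
  have tv: "t * norm v \<le> \<rho>" "2 * (t * norm v) \<le> \<tau>"
    using t v0 by (auto simp: \<sigma>_def field_simps)
  have near: "closed_segment u (u + (d + t *\<^sub>R v)) \<subseteq> {z. infdist z H \<le> \<rho>}" if ud: "closed_segment u (u + d) \<subseteq> H" for u d
  proof
    fix w assume "w \<in> closed_segment u (u + (d + t *\<^sub>R v))"
    then obtain s where s: "w = u + s *\<^sub>R (d + t *\<^sub>R v)" "0 \<le> s" "s \<le> 1"
      unfolding closed_segment_def by (auto simp: algebra_simps)
    have "u + s *\<^sub>R d \<in> closed_segment u (u + d)"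
      unfolding closed_segment_def using s by (auto simp: algebra_simps intro!: exI[of _ s])
    then have "u + s *\<^sub>R d \<in> H" using ud by blast
    then have "infdist w H \<le> dist w (u + s *\<^sub>R d)" by (rule infdist_le)
    also have "\<dots> = s * (t * norm v)" using s t by (simp add: dist_norm algebra_simps)
    also have "\<dots> \<le> 1 * (t * norm v)" using s t by (intro mult_right_mono) auto
    finally show "w \<in> {z. infdist z H \<le> \<rho>}" using tv(1) by simp
  qed
  have mid: "x + e \<in> closed_segment x y" "y + - e \<in> closed_segment x y"
    unfolding closed_segment_def e_def
    by (auto intro!: exI[of _ "1 / 2"] simp: algebra_simps simp flip: scaleR_add_left)
  have sub: "closed_segment x z \<subseteq> {z. infdist z H \<le> \<rho>}" "closed_segment y z \<subseteq> {z. infdist z H \<le> \<rho>}"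
  proof -
    have "closed_segment x (x + e) \<subseteq> H" "closed_segment y (y + - e) \<subseteq> H"
      using mid xy(2) subset_closed_segment[of x "x + e" x y] subset_closed_segment[of y "y + - e" x y] by auto
    then show "closed_segment x z \<subseteq> {z. infdist z H \<le> \<rho>}" "closed_segment y z \<subseteq> {z. infdist z H \<le> \<rho>}"
      using near[of x e] near[of y "- e"] unfolding z_def[symmetric] z[symmetric] by auto
  qed
  have cl: "closed {z. infdist z H \<le> \<rho>}" by (intro closed_Collect_le continuous_intros)
  \<comment> \<open>Each half must start at an end point of the dipole for its half-open segment to
    be uncharged, so the half at \<open>y\<close> runs backwards and enters with coefficient
    -1.\<close>
  have "fillable \<mu> {z. infdist z H \<le> \<rho>} (\<lambda>f. (f z - f x) + (-1) * (f z - f y)) (dist x z + \<bar>-1\<bar> * dist y z)"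
    by (intro fillable_add[OF sm cl] fillable_cmult fillable_segment null sub)
  moreover have "dist x z + \<bar>-1\<bar> * dist y z \<le> dist x y + \<tau>"
  proof -
    have "dist z x = norm (e + t *\<^sub>R v)" by (simp add: z_def dist_norm)
    then have "dist x z \<le> norm e + t * norm v"
      using t norm_triangle_ineq[of e "t *\<^sub>R v"] by (simp add: dist_commute)
    moreover have "dist z y = norm (- e + t *\<^sub>R v)" by (simp add: z dist_norm)
    then have "dist y z \<le> norm e + t * norm v"
      using t norm_triangle_ineq[of "- e" "t *\<^sub>R v"] by (simp add: dist_commute)
    moreover have "norm e = dist x y / 2" by (simp add: e_def dist_norm norm_minus_commute)
    ultimately show ?thesis using tv(2) by simp
  qed
  ultimately have "fillable \<mu> {z. infdist z H \<le> \<rho>} (\<lambda>f. (f z - f x) + (-1) * (f z - f y)) (dist x y + \<tau>)"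
    by (rule fillable_mono)
  then show ?thesis by (simp add: algebra_simps)
qed

text \<open>The dipole series accounts for \<open>N + 4 * \<delta>\<close>. Bending the dipoles of
  block \<open>k\<close> is allowed to cost \<open>\<delta> * (1 / 2) ^ k\<close>, which adds
  \<open>2 * \<delta>\<close> in total. The bends lie near the hull of \<open>A\<close>, since the
  segments between points of \<open>A\<close> lie in it.\<close>

lemma fillable_KR:
  fixes \<mu> :: "'a::{real_normed_vector, second_countable_topology} measure"
  assumes dim: "\<exists>V::'a set. independent V \<and> card V = 2"
    and fin: "finite_measure \<mu>" and sm: "sets \<mu> = sets borel"
    and m: "KR_functional A N m" and d: "\<delta> > 0" and \<rho>: "\<rho> > 0"
  shows "fillable \<mu> {z. infdist z (convex hull A) \<le> \<rho>} m (N + 6 * \<delta>)"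
proof -
  let ?K = "{z. infdist z (convex hull A) \<le> \<rho>}"
  have cl: "closed ?K" by (intro closed_Collect_le continuous_intros)
  obtain I :: "nat \<Rightarrow> ('a \<times> 'a) set" and a c where I: "\<And>k. finite (I k)" "\<And>k. I k \<subseteq> A \<times> A" "\<And>k x. (x, x) \<notin> I k"
    "\<And>k. (\<Sum>(x, y)\<in>I k. \<bar>a k (x, y)\<bar> * dist x y) \<le> c k" "c sums (N + 4 * \<delta>)"
    "\<And>f. f \<in> Lip \<Longrightarrow> (\<lambda>k. \<Sum>(x, y)\<in>I k. a k (x, y) * (f x - f y)) sums m f"
    by (rule KR_dipole_series[OF m d]) blast
  have "fillable \<mu> ?K (\<lambda>f. \<Sum>(x, y)\<in>I k. a k (x, y) * (f x - f y)) (c k + \<delta> * (1 / 2) ^ k)" for k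
  proof -
    define s where "s = (\<Sum>i\<in>I k. \<bar>a k i\<bar>)"
    have s: "0 \<le> s" unfolding s_def by (intro sum_nonneg) auto
    \<comment> \<open>The excess length \<open>\<tau>\<close> of each path is weighted by its
      coefficient, so it is charged \<open>s\<close> times in all; \<open>1 + s\<close> avoids
      dividing by 0.\<close>
    define \<tau> where "\<tau> = \<delta> * (1 / 2) ^ k / (1 + s)"
    have \<tau>: "\<tau> > 0" using s d by (simp add: \<tau>_def add_pos_nonneg)
    have "fillable \<mu> ?K (\<lambda>f. \<Sum>i\<in>I k. a k i * (f (fst i) - f (snd i))) (\<Sum>i\<in>I k. \<bar>a k i\<bar> * (dist (snd i) (fst i) + \<tau>))"
    proof (intro fillable_sum[OF sm cl I(1)] fillable_cmult fillable_dipole[OF dim fin sm _ _ \<rho> \<tau>])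
      fix i assume i: "i \<in> I k"
      show "snd i \<noteq> fst i" using I(3)[of "fst i" k] i by (metis prod.collapse)
      have "fst i \<in> convex hull A" "snd i \<in> convex hull A"
        using subsetD[OF I(2) i] by (auto simp: mem_Times_iff intro: hull_inc)
      then show "closed_segment (snd i) (fst i) \<subseteq> convex hull A"
        by (intro closed_segment_subset convex_convex_hull)
    qed
    moreover have "(\<Sum>i\<in>I k. \<bar>a k i\<bar> * (dist (snd i) (fst i) + \<tau>)) \<le> c k + \<delta> * (1 / 2) ^ k"
    proof -
      have "(\<Sum>i\<in>I k. \<bar>a k i\<bar> * (dist (snd i) (fst i) + \<tau>)) = (\<Sum>(x, y)\<in>I k. \<bar>a k (x, y)\<bar> * dist x y) + s * \<tau>"
        by (simp add: s_def case_prod_unfold algebra_simps sum.distrib sum_distrib_left dist_commute)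
      moreover have "s * \<tau> = (s / (1 + s)) * (\<delta> * (1 / 2) ^ k)" by (simp add: \<tau>_def)
      moreover have "(s / (1 + s)) * (\<delta> * (1 / 2) ^ k) \<le> 1 * (\<delta> * (1 / 2) ^ k)"
        using s d by (intro mult_right_mono) auto
      ultimately show ?thesis using I(4)[of k] by linarith
    qed
    ultimately show ?thesis by (simp only: case_prod_unfold prod.collapse) (rule fillable_mono)
  qed
  moreover have "(\<lambda>k. c k + \<delta> * (1 / 2) ^ k) sums (N + 6 * \<delta>)"
    using sums_add[OF I(5) sums_mult[OF geometric_sums[of "1 / 2 :: real"], of \<delta>]] by (simp add: algebra_simps)
  ultimately show ?thesis by (rule fillable_sums[OF sm cl _ _ I(6)])
qed

subsection \<open>Restriction and proof of the theorem\<close>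

lemma current_add:
  assumes T: "metric_current T" "mass_bound T \<mu>" and R: "metric_current R" "mass_bound R \<nu>"
  shows "\<exists>\<kappa>. metric_current (\<lambda>f p. T f p + R f p) \<and> mass_bound (\<lambda>f p. T f p + R f p) \<kappa> \<and>
    (\<forall>A\<in>sets borel. emeasure \<kappa> A = emeasure \<mu> A + emeasure \<nu> A)"
proof -
  define TT where "TT k = (if k = 0 then T else if k = 1 then R else (\<lambda>_ _. 0))" for k :: nat
  define mm where "mm k = (if k = 0 then \<mu> else if k = 1 then \<nu> else null_measure borel)" for k :: nat
  define c where "c k = (if k = 0 then measure \<mu> UNIV else if k = 1 then measure \<nu> UNIV else 0)" for k :: nat
  interpret \<mu>: finite_measure \<mu> using mass_boundD_finite[OF T(2)] .
  interpret \<nu>: finite_measure \<nu> using mass_boundD_finite[OF R(2)] .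
  have cur: "metric_current (TT k)" for k using T(1) R(1) by (simp add: TT_def zero_current)
  have mb: "mass_bound (TT k) (mm k)" for k using T(2) R(2) by (simp add: TT_def mm_def zero_current)
  have le: "emeasure (mm k) UNIV \<le> ennreal (c k)" for k
    by (simp add: mm_def c_def \<mu>.emeasure_eq_measure \<nu>.emeasure_eq_measure)
  have c0: "0 \<le> c k" for k by (simp add: c_def)
  have cs: "c sums (\<Sum>k\<in>{0, 1}. c k)" by (rule sums_finite) (auto simp: c_def)
  have eq: "(\<lambda>f p. \<Sum>k. TT k f p) = (\<lambda>f p. T f p + R f p)"
  proof (intro ext)
    fix f p
    have "(\<Sum>k. TT k f p) = (\<Sum>k\<in>{0, 1}. TT k f p)" by (rule suminf_finite) (auto simp: TT_def)
    then show "(\<Sum>k. TT k f p) = T f p + R f p" by (simp add: TT_def)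
  qed
  have "emeasure (measure_series mm) A = emeasure \<mu> A + emeasure \<nu> A" if A: "A \<in> sets borel" for A
  proof -
    have "emeasure (measure_series mm) A = (\<Sum>k. emeasure (mm k) A)"
      by (rule emeasure_measure_series[OF mass_boundD_sets[OF mb] A])
    also have "\<dots> = (\<Sum>k\<in>{0, 1}. emeasure (mm k) A)" by (rule suminf_finite) (auto simp: mm_def)
    finally show ?thesis by (simp add: mm_def)
  qed
  with current_series(2,3)[OF cur mb le c0 cs] show ?thesis unfolding eq by blast
qed

lemma integral_mono_measure:
  assumes M: "finite_measure M" "sets M = sets borel" and N: "finite_measure N" "sets N = sets borel"
    and le: "\<And>A. A \<in> sets borel \<Longrightarrow> emeasure M A \<le> emeasure N A"
    and h: "h \<in> borel_measurable borel" "\<And>x. 0 \<le> h x" "\<And>x. h x \<le> B"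
  shows "(\<integral>x. h x \<partial>M) \<le> (\<integral>x. h x \<partial>N :: real)"
proof -
  have eq: "(\<integral>\<^sup>+x. ennreal (h x) \<partial>P) = ennreal (\<integral>x. h x \<partial>P)"
    if P: "finite_measure P" "sets P = sets borel" for P
  proof (rule nn_integral_eq_integral)
    have "h \<in> borel_measurable P" using h(1) P(2) by (simp cong: measurable_cong_sets)
    then show "integrable P h"
      using h(2,3) by (intro finite_measure.integrable_const_bound[OF P(1), of _ B]) auto
  qed (use h(2) in simp)
  have "M \<le> N" using le M(2) N(2) by (subst le_measure) auto
  then have "(\<integral>\<^sup>+x. ennreal (h x) \<partial>M) \<le> (\<integral>\<^sup>+x. ennreal (h x) \<partial>N)"
    using M(2) N(2) by (intro nn_integral_mono_measure) auto
  then show ?thesis unfolding eq[OF M] eq[OF N] by (simp add: integral_nonneg h(2))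
qed

text \<open>Multiply \<open>f\<close> by Lipschitz functions that approach the indicator of
  \<open>E\<close> in \<open>L^1\<close> of \<kappa>. As \<kappa> dominates \<mu>, \<nu> and the
  mass measure of the sum, convergence holds for all three. \<mu> does not see \<open>- E\<close>
  and \<nu> does not see \<open>E\<close>, so \<open>T\<close> tends to \<open>T f p\<close> and
  \<open>R\<close> to 0 along this sequence. Any other sequence with the same limit differs from it
  by one tending to 0 in \<open>L^1\<close> of the mass measure, which settles the description in
  \<open>current_ext\<close>.\<close>

lemma current_restrict_eq:
  fixes T R :: "'a::{second_countable_topology, complete_space} functional"
  assumes C: "metric_current (\<lambda>f p. T f p + R f p)"
    and T: "metric_current T" "mass_bound T \<mu>" and R: "mass_bound R \<nu>"
    and E: "E \<in> sets borel" "emeasure \<mu> (- E) = 0" "emeasure \<nu> E = 0"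
    and k: "mass_bound (\<lambda>f p. T f p + R f p) \<kappa>"
      "\<And>A. A \<in> sets borel \<Longrightarrow> emeasure \<mu> A \<le> emeasure \<kappa> A" "\<And>A. A \<in> sets borel \<Longrightarrow> emeasure \<nu> A \<le> emeasure \<kappa> A"
  shows "current_eq T (current_restrict (\<lambda>f p. T f p + R f p) E)"
  unfolding current_eq_def
proof (intro ballI)
  fix f p :: "'a \<Rightarrow> real" assume f: "f \<in> Lip_bdd" and p: "p \<in> Lip"
  define CC where "CC f p = T f p + R f p" for f p
  define g where "g x = indicator E x * f x" for x
  define \<omega> where "\<omega> = mass_measure CC"
  have CC: "metric_current CC" using C by (simp add: CC_def[abs_def])
  have kC: "mass_bound CC \<kappa>" using k(1) by (simp add: CC_def[abs_def])
  have lC: "mass_bound CC \<omega>" unfolding \<omega>_def by (rule mass_measure_bound[OF CC])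
  have lk: "emeasure \<omega> A \<le> emeasure \<kappa> A" if "A \<in> sets borel" for A
    unfolding \<omega>_def by (rule mass_measure_le[OF CC kC that])
  note fs = mass_boundD_finite mass_boundD_sets
  have pl: "(lip_const p)-lipschitz_on UNIV p" by (rule lip_const_lipschitz[OF p])
  obtain B where B: "B > 0" "\<And>x. \<bar>f x\<bar> \<le> B" using Lip_bddE[OF f] by metis
  have fm [measurable]: "f \<in> borel_measurable borel" by (rule Lip_measurable[OF Lip_bdd_Lip[OF f] refl])
  note [measurable] = E(1)
  have gm [measurable]: "g \<in> borel_measurable borel" unfolding g_def by measurable
  have gB: "\<bar>g x\<bar> \<le> B" for x using B by (simp add: g_def indicator_def)
  have int: "integrable M (\<lambda>x. \<bar>u x - g x\<bar>)" if u: "u \<in> Lip_bdd" and M: "finite_measure M" "sets M = sets borel" for u M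
  proof -
    obtain D where D: "\<And>x. \<bar>u x\<bar> \<le> D" using Lip_bddE[OF u] by metis
    have "\<bar>u x - g x\<bar> \<le> D + B" for x using D[of x] gB[of x] by linarith
    moreover have "u \<in> borel_measurable M" "g \<in> borel_measurable M"
      using Lip_measurable[OF Lip_bdd_Lip[OF u] M(2)] gm M(2) by (simp_all cong: measurable_cong_sets)
    ultimately show ?thesis by (intro finite_measure.integrable_const_bound[OF M(1), of _ "D + B"]) auto
  qed
  have "\<exists>\<phi>. \<phi> \<in> Lip_bdd \<and> (\<forall>x. 0 \<le> \<phi> x \<and> \<phi> x \<le> 1) \<and> (\<integral>x. \<bar>\<phi> x - indicator E x\<bar> \<partial>\<kappa>) \<le> 1 / real (Suc n)" for n
    by (rule Lip_bdd_approx_indicator[OF fs[OF kC] fs[OF kC] E(1), of "1 / real (Suc n)"]) auto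
  then obtain \<phi> where \<phi>: "\<And>n. \<phi> n \<in> Lip_bdd" "\<And>n x. 0 \<le> \<phi> n x \<and> \<phi> n x \<le> 1"
    "\<And>n. (\<integral>x. \<bar>\<phi> n x - indicator E x\<bar> \<partial>\<kappa>) \<le> 1 / real (Suc n)" by metis
  define F0 where "F0 n x = \<phi> n x * f x" for n x
  have F0: "F0 n \<in> Lip_bdd" for n unfolding F0_def by (rule Lip_bdd_mult[OF \<phi>(1) f])
  have lim0: "(\<lambda>n. \<integral>x. \<bar>F0 n x - g x\<bar> \<partial>M) \<longlonglongrightarrow> 0"
    if M: "finite_measure M" "sets M = sets borel" and Mk: "\<And>A. A \<in> sets borel \<Longrightarrow> emeasure M A \<le> emeasure \<kappa> A" for M
  proof (rule Lim_null_comparison)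
    have [measurable]: "\<phi> n \<in> borel_measurable borel" for n by (rule Lip_measurable[OF Lip_bdd_Lip[OF \<phi>(1)] refl])
    have "(\<integral>x. \<bar>F0 n x - g x\<bar> \<partial>M) \<le> B * (1 / real (Suc n))" for n
    proof -
      have h: "0 \<le> B * \<bar>\<phi> n x - indicator E x\<bar> \<and> B * \<bar>\<phi> n x - indicator E x\<bar> \<le> B * 1" for x
        using \<phi>(2)[of n x] B(1) by (intro conjI mult_left_mono) (auto simp: indicator_def)
      have hm: "(\<lambda>x. B * \<bar>\<phi> n x - indicator E x\<bar>) \<in> borel_measurable borel" by measurable
      have "(\<integral>x. \<bar>F0 n x - g x\<bar> \<partial>M) \<le> (\<integral>x. B * \<bar>\<phi> n x - indicator E x\<bar> \<partial>M)"
      proof (rule integral_mono')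
        show "integrable M (\<lambda>x. B * \<bar>\<phi> n x - indicator E x\<bar>)"
          using h hm M(2) by (intro finite_measure.integrable_const_bound[OF M(1), of _ "B * 1"]) (auto cong: measurable_cong_sets)
        fix x
        have "\<bar>F0 n x - g x\<bar> = \<bar>f x\<bar> * \<bar>\<phi> n x - indicator E x\<bar>"
          by (simp add: F0_def g_def abs_mult[symmetric] algebra_simps)
        then show "\<bar>F0 n x - g x\<bar> \<le> B * \<bar>\<phi> n x - indicator E x\<bar>"
          using mult_right_mono[OF B(2)[of x], of "\<bar>\<phi> n x - indicator E x\<bar>"] by simp
      qed (use B in auto)
      also have "\<dots> \<le> (\<integral>x. B * \<bar>\<phi> n x - indicator E x\<bar> \<partial>\<kappa>)"
        by (rule integral_mono_measure[OF M fs[OF kC] Mk hm]) (use h in auto)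
      also have "\<dots> = B * (\<integral>x. \<bar>\<phi> n x - indicator E x\<bar> \<partial>\<kappa>)" by simp
      also have "\<dots> \<le> B * (1 / real (Suc n))" using B(1) \<phi>(3) by (intro mult_left_mono) auto
      finally show ?thesis .
    qed
    then show "eventually (\<lambda>n. norm (\<integral>x. \<bar>F0 n x - g x\<bar> \<partial>M) \<le> B * (1 / real (Suc n))) sequentially"
      by (simp add: integral_nonneg)
    show "(\<lambda>n. B * (1 / real (Suc n))) \<longlonglongrightarrow> 0"
      using tendsto_mult_left[OF LIMSEQ_Suc[OF lim_1_over_n], of B] by simp
  qed
  have lim_null: "(\<lambda>n. S (v n) p) \<longlonglongrightarrow> 0"
    if S: "mass_bound S M" and v: "\<And>n. v n \<in> Lip_bdd" and l: "(\<lambda>n. \<integral>x. \<bar>v n x\<bar> \<partial>M) \<longlonglongrightarrow> 0"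
    for S :: "'a functional" and M and v :: "nat \<Rightarrow> 'a \<Rightarrow> real"
  proof (rule Lim_null_comparison)
    show "eventually (\<lambda>n. norm (S (v n) p) \<le> lip_const p * (\<integral>x. \<bar>v n x\<bar> \<partial>M)) sequentially"
      using mass_boundD[OF S v pl] by simp
    show "(\<lambda>n. lip_const p * (\<integral>x. \<bar>v n x\<bar> \<partial>M)) \<longlonglongrightarrow> 0"
      using tendsto_mult_left[OF l, of "lip_const p"] by simp
  qed
  have "(\<lambda>n. T (\<lambda>x. F0 n x - f x) p) \<longlonglongrightarrow> 0"
  proof (rule lim_null[OF T(2) Lip_bdd_diff[OF F0 f]])
    have "- E \<in> null_sets \<mu>" using E(1,2) fs(2)[OF T(2)] by (auto simp: null_sets_def)
    then have "AE x in \<mu>. x \<in> E" by (rule AE_I') auto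
    then have "(\<integral>x. \<bar>F0 n x - f x\<bar> \<partial>\<mu>) = (\<integral>x. \<bar>F0 n x - g x\<bar> \<partial>\<mu>)" for n
      using fs(2)[OF T(2)] Lip_measurable[OF Lip_bdd_Lip[OF F0[of n]] refl]
      by (intro integral_cong_AE) (auto simp: g_def cong: measurable_cong_sets)
    then show "(\<lambda>n. \<integral>x. \<bar>F0 n x - f x\<bar> \<partial>\<mu>) \<longlonglongrightarrow> 0"
      using lim0[OF fs[OF T(2)] k(2)] by simp
  qed
  then have "(\<lambda>n. T (F0 n) p - T f p) \<longlonglongrightarrow> 0"
    using bilinear_diff_left[OF current_bilinear[OF T(1)] F0 f p] by simp
  then have limT: "(\<lambda>n. T (F0 n) p) \<longlonglongrightarrow> T f p" by (rule LIM_zero_cancel)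
  have limR: "(\<lambda>n. R (F0 n) p) \<longlonglongrightarrow> 0"
  proof (rule lim_null[OF R F0])
    have "E \<in> null_sets \<nu>" using E(1,3) fs(2)[OF R] by (auto simp: null_sets_def)
    then have "AE x in \<nu>. x \<notin> E" by (rule AE_I') auto
    then have "(\<integral>x. \<bar>F0 n x\<bar> \<partial>\<nu>) = (\<integral>x. \<bar>F0 n x - g x\<bar> \<partial>\<nu>)" for n
      using fs(2)[OF R] Lip_measurable[OF Lip_bdd_Lip[OF F0[of n]] refl]
      by (intro integral_cong_AE) (auto simp: g_def cong: measurable_cong_sets)
    then show "(\<lambda>n. \<integral>x. \<bar>F0 n x\<bar> \<partial>\<nu>) \<longlonglongrightarrow> 0"
      using lim0[OF fs[OF R] k(3)] by simp
  qed
  have limC: "(\<lambda>n. CC (F0 n) p) \<longlonglongrightarrow> T f p"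
    using tendsto_add[OF limT limR] by (simp add: CC_def)
  have l0: "(\<lambda>n. \<integral>x. \<bar>F0 n x - g x\<bar> \<partial>\<omega>) \<longlonglongrightarrow> 0"
    by (rule lim0[OF fs[OF lC] lk])
  have "current_ext CC g p = T f p"
    unfolding current_ext_def \<omega>_def[symmetric]
  proof (rule the_equality)
    show "\<forall>F. (\<forall>n. F n \<in> Lip_bdd) \<longrightarrow> (\<lambda>n. \<integral>x. \<bar>F n x - g x\<bar> \<partial>\<omega>) \<longlonglongrightarrow> 0 \<longrightarrow> (\<lambda>n. CC (F n) p) \<longlonglongrightarrow> T f p"
    proof (intro allI impI)
      fix F :: "nat \<Rightarrow> 'a \<Rightarrow> real"
      assume F: "\<forall>n. F n \<in> Lip_bdd" and l: "(\<lambda>n. \<integral>x. \<bar>F n x - g x\<bar> \<partial>\<omega>) \<longlonglongrightarrow> 0"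
      then have Fb: "F n \<in> Lip_bdd" for n by blast
      have "(\<lambda>n. CC (\<lambda>x. F n x - F0 n x) p) \<longlonglongrightarrow> 0"
      proof (rule lim_null[OF lC Lip_bdd_diff[OF Fb F0]], rule Lim_null_comparison)
        have "(\<integral>x. \<bar>F n x - F0 n x\<bar> \<partial>\<omega>) \<le> (\<integral>x. \<bar>F n x - g x\<bar> \<partial>\<omega>) + (\<integral>x. \<bar>F0 n x - g x\<bar> \<partial>\<omega>)" for n
        proof -
          note i = int[OF Fb[of n] fs[OF lC]] int[OF F0[of n] fs[OF lC]]
          have "(\<integral>x. \<bar>F n x - F0 n x\<bar> \<partial>\<omega>) \<le> (\<integral>x. \<bar>F n x - g x\<bar> + \<bar>F0 n x - g x\<bar> \<partial>\<omega>)"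
            by (rule integral_mono'[OF Bochner_Integration.integrable_add[OF i]]) auto
          also have "\<dots> = (\<integral>x. \<bar>F n x - g x\<bar> \<partial>\<omega>) + (\<integral>x. \<bar>F0 n x - g x\<bar> \<partial>\<omega>)"
            by (rule Bochner_Integration.integral_add[OF i])
          finally show ?thesis .
        qed
        then show "eventually (\<lambda>n. norm (\<integral>x. \<bar>F n x - F0 n x\<bar> \<partial>\<omega>)
            \<le> (\<integral>x. \<bar>F n x - g x\<bar> \<partial>\<omega>) + (\<integral>x. \<bar>F0 n x - g x\<bar> \<partial>\<omega>)) sequentially"
          by (simp add: integral_nonneg)
        show "(\<lambda>n. (\<integral>x. \<bar>F n x - g x\<bar> \<partial>\<omega>) + (\<integral>x. \<bar>F0 n x - g x\<bar> \<partial>\<omega>)) \<longlonglongrightarrow> 0"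
          using tendsto_add[OF l l0] by simp
      qed
      then have "(\<lambda>n. CC (F n) p - CC (F0 n) p) \<longlonglongrightarrow> 0"
        using bilinear_diff_left[OF current_bilinear[OF CC] Fb F0 p] by simp
      from tendsto_add[OF this limC] show "(\<lambda>n. CC (F n) p) \<longlonglongrightarrow> T f p" by simp
    qed
    fix l
    assume "\<forall>F. (\<forall>n. F n \<in> Lip_bdd) \<longrightarrow> (\<lambda>n. \<integral>x. \<bar>F n x - g x\<bar> \<partial>\<omega>) \<longlonglongrightarrow> 0 \<longrightarrow> (\<lambda>n. CC (F n) p) \<longlonglongrightarrow> l"
    then have "(\<lambda>n. CC (F0 n) p) \<longlonglongrightarrow> l" using F0 l0 by blast
    then show "l = T f p" using limC by (rule LIMSEQ_unique)
  qed
  then show "T f p = current_restrict (\<lambda>f p. T f p + R f p) E f p"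
    by (simp add: current_restrict_def CC_def[abs_def] g_def[abs_def])
qed

lemma current_spt_subset:
  fixes T :: "'a::{second_countable_topology, complete_space} functional"
  assumes "metric_current T" "mass_bound T \<nu>" "closed K" "emeasure \<nu> (- K) = 0"
  shows "current_spt T \<subseteq> K"
proof
  fix x assume x: "x \<in> current_spt T"
  show "x \<in> K"
  proof (rule ccontr)
    assume "x \<notin> K"
    moreover have "open (- K)" using assms(3) by (simp add: open_Compl)
    ultimately have "emeasure (mass_measure T) (- K) > 0"
      using x by (auto simp: current_spt_def measure_spt_def)
    moreover have "emeasure (mass_measure T) (- K) \<le> emeasure \<nu> (- K)"
      using assms(3) by (intro mass_measure_le[OF assms(1,2)]) auto
    ultimately show False using assms(4) by simp
  qed
qed

text \<open>A real supremum is meaningful only for a nonempty set bounded above; finite mass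
  supplies the upper bound. It also settles \<open>L = 0\<close>, where \<open>f\<close> cannot be
  normalized.\<close>

lemma KR_norm_bound:
  fixes T :: "'a::metric_space functional"
  assumes T: "metric_current T" and f: "L-lipschitz_on UNIV f"
  shows "T (\<lambda>_. 1) f \<le> KR_norm (current_boundary T) * L"
proof -
  obtain \<mu> where m: "mass_bound T \<mu>" using current_mass_bound[OF T] by blast
  have bound: "\<bar>T (\<lambda>_. 1) g\<bar> \<le> M * measure \<mu> UNIV" if "M-lipschitz_on UNIV g" for g M
    using mass_boundD[OF m Lip_bdd_const that, of 1] sets_eq_imp_space_eq[OF mass_boundD_sets[OF m]] by simp
  show ?thesis
  proof (cases "L = 0")
    case True
    then show ?thesis using bound[OF f] by simp
  next
    case False
    then have L: "L > 0" using lipschitz_on_nonneg[OF f] by simp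
    define g where "g x = (1 / L) * f x" for x
    have g: "1-lipschitz_on UNIV g"
      unfolding g_def using lipschitz_on_cmult_real[OF f, of "1 / L"] L by simp
    have "bdd_above (current_boundary T ` {f \<in> Lip. lip_const f \<le> 1})"
    proof (rule bdd_aboveI2)
      fix h :: "'a \<Rightarrow> real" assume h: "h \<in> {f \<in> Lip. lip_const f \<le> 1}"
      then have "1-lipschitz_on UNIV h" by (intro lipschitz_on_le[OF lip_const_lipschitz]) auto
      from bound[OF this] show "current_boundary T h \<le> 1 * measure \<mu> UNIV" by (simp add: current_boundary_def)
    qed
    moreover have "g \<in> {f \<in> Lip. lip_const f \<le> 1}" using LipI[OF g] lip_const_le[OF g] by simp
    ultimately have "current_boundary T g \<le> KR_norm (current_boundary T)"
      unfolding KR_norm_def by (rule cSUP_upper[rotated])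
    then have "T (\<lambda>_. 1) g \<le> KR_norm (current_boundary T)" by (simp add: current_boundary_def)
    moreover have "T (\<lambda>_. 1) g = (1 / L) * T (\<lambda>_. 1) f"
      using bilinear_right[OF current_bilinear[OF T] Lip_bdd_const LipI[OF f] LipI[OF f], of 1 "1 / L" 0]
      by (simp add: g_def[abs_def])
    ultimately show ?thesis using L by (simp add: field_simps)
  qed
qed

text \<open>The sign is that of the correction, whose boundary has to cancel \<partial>T. If the
  support is empty, so is its neighbourhood, and the last clause says that \<partial>T is
  zero.\<close>

lemma boundary_KR_functional:
  fixes T :: "'a::{second_countable_topology, complete_space} functional"
  assumes T: "metric_current T" and e: "\<epsilon> > 0"
  shows "KR_functional (closed_nbhd (boundary_spt T) \<epsilon>) (KR_norm (current_boundary T)) (\<lambda>f. - T (\<lambda>_. 1) f)"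
  unfolding KR_functional_def
proof (intro conjI ballI allI impI)
  note bil = current_bilinear[OF T]
  fix f g :: "'a \<Rightarrow> real" and a b :: real assume f: "f \<in> Lip" and g: "g \<in> Lip"
  show "- T (\<lambda>_. 1) (\<lambda>x. a * f x + b * g x) = a * - T (\<lambda>_. 1) f + b * - T (\<lambda>_. 1) g"
    using bilinear_right[OF bil Lip_bdd_const f g, of 1 a b] by simp
next
  fix P :: "nat \<Rightarrow> 'a \<Rightarrow> real" and p :: "'a \<Rightarrow> real" and L
  assume P: "\<forall>j. L-lipschitz_on UNIV (P j)" and p: "p \<in> Lip" and lim: "\<forall>x. (\<lambda>j. P j x) \<longlonglongrightarrow> p x"
  show "(\<lambda>j. - T (\<lambda>_. 1) (P j)) \<longlonglongrightarrow> - T (\<lambda>_. 1) p"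
    by (rule tendsto_minus[OF current_continuous[OF T Lip_bdd_const P[THEN spec] p lim[THEN spec]]])
next
  fix f :: "'a \<Rightarrow> real" and L assume f: "L-lipschitz_on UNIV f"
  have f': "L-lipschitz_on UNIV (\<lambda>x. (- 1) * f x)" using lipschitz_on_cmult_real[OF f, of "-1"] by simp
  have "T (\<lambda>_. 1) (\<lambda>x. (- 1) * f x) = - T (\<lambda>_. 1) f"
    using bilinear_right[OF current_bilinear[OF T] Lip_bdd_const LipI[OF f] LipI[OF f], of 1 "-1" 0] by simp
  with KR_norm_bound[OF T f] KR_norm_bound[OF T f']
  show "\<bar>- T (\<lambda>_. 1) f\<bar> \<le> KR_norm (current_boundary T) * L" by (simp add: abs_le_iff)
next
  fix f :: "'a \<Rightarrow> real" and c assume f: "f \<in> Lip" and c: "\<forall>x\<in>closed_nbhd (boundary_spt T) \<epsilon>. f x = c"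
  have "T (\<lambda>_. 1) (\<lambda>x. f x - c) = 0"
  proof (rule boundary_vanishes[OF T])
    show "(\<lambda>x. f x - c) \<in> Lip" by (rule Lip_diff[OF f Lip_const])
    have "x \<notin> fun_spt (\<lambda>x. f x - c)" if x: "x \<in> boundary_spt T" for x
    proof -
      have "{y. f y - c \<noteq> 0} \<subseteq> - ball x \<epsilon>"
      proof
        fix y assume y: "y \<in> {y. f y - c \<noteq> 0}"
        have "y \<notin> ball x \<epsilon>"
        proof
          assume "y \<in> ball x \<epsilon>"
          then have "infdist y (boundary_spt T) \<le> \<epsilon>"
            using x by (intro infdist_le2[of x]) (auto simp: dist_commute)
          then have "y \<in> closed_nbhd (boundary_spt T) \<epsilon>" using x by (auto simp: closed_nbhd_def)
          then show False using c y by simp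
        qed
        then show "y \<in> - ball x \<epsilon>" by simp
      qed
      then have "fun_spt (\<lambda>x. f x - c) \<subseteq> - ball x \<epsilon>"
        unfolding fun_spt_def by (rule closure_minimal) (simp add: closed_Compl)
      then show ?thesis using e by auto
    qed
    then show "fun_spt (\<lambda>x. f x - c) \<inter> boundary_spt T = {}" by blast
  qed
  \<comment> \<open>Locality with the whole space as neighbourhood.\<close>
  moreover have "T (\<lambda>_. 1) (\<lambda>_. c) = 0"
    by (rule current_local[OF T Lip_bdd_const Lip_const open_UNIV]) auto
  moreover have "T (\<lambda>_. 1) (\<lambda>x. f x - c) = T (\<lambda>_. 1) f - T (\<lambda>_. 1) (\<lambda>_. c)"
    by (rule bilinear_diff_right[OF current_bilinear[OF T] Lip_bdd_const f Lip_const])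
  ultimately show "- T (\<lambda>_. 1) f = 0" by simp
qed

text \<open>A point \<open>z\<close> close to \<open>y\<close> in the inner hull lies in the
  translate of that hull by \<open>z - y\<close>. This is the hull of the translated neighbourhood,
  which stays within \<epsilon> of \<open>S\<close>; no convex combination has to be written
  out.\<close>

lemma hull_nbhd_subset:
  fixes S :: "'a::real_normed_vector set"
  assumes S: "S \<noteq> {}" and e: "\<epsilon> > 0"
  shows "{z. infdist z (convex hull (closed_nbhd S (\<epsilon> / 2))) \<le> \<epsilon> / 4} \<subseteq> convex hull (closed_nbhd S \<epsilon>)"
proof
  let ?A = "closed_nbhd S (\<epsilon> / 2)"
  fix z assume z: "z \<in> {z. infdist z (convex hull ?A) \<le> \<epsilon> / 4}"
  have "S \<subseteq> ?A" using S e by (auto simp: closed_nbhd_def)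
  then have ne: "convex hull ?A \<noteq> {}" using S by auto
  have "infdist z (convex hull ?A) < \<epsilon> / 2" using z e by simp
  then obtain y where y: "y \<in> convex hull ?A" "dist z y < \<epsilon> / 2"
    unfolding infdist_notempty[OF ne] cINF_less_iff[OF ne bdd_belowI2[OF zero_le_dist]] by blast
  have "z \<in> (\<lambda>x. (z - y) + x) ` (convex hull ?A)" using y(1) by (intro image_eqI[of _ _ y]) simp_all
  also have "\<dots> = convex hull ((\<lambda>x. (z - y) + x) ` ?A)" by (simp only: convex_hull_translation)
  also have "\<dots> \<subseteq> convex hull (closed_nbhd S \<epsilon>)"
  proof (rule hull_mono, rule image_subsetI)
    fix x assume x: "x \<in> ?A"
    have "infdist ((z - y) + x) S \<le> infdist x S + dist ((z - y) + x) x" by (rule infdist_triangle)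
    also have "\<dots> \<le> \<epsilon> / 2 + \<epsilon> / 2" using x y(2) by (intro add_mono) (auto simp: closed_nbhd_def dist_norm)
    finally show "(z - y) + x \<in> closed_nbhd S \<epsilon>" using S by (simp add: closed_nbhd_def)
  qed
  finally show "z \<in> convex hull (closed_nbhd S \<epsilon>)" .
qed

theorem theoremC:
  fixes T :: "'a::{banach, second_countable_topology} functional" and \<epsilon> :: real
  assumes dim: "\<exists>V::'a set. independent V \<and> card V = 2"
    and T: "metric_current T"
    and eps: "\<epsilon> > 0"
  shows "\<exists>C B. metric_current C \<and> B \<in> sets borel \<and>
    (let R = (\<lambda>f p. C f p - T f p);
         K = convex hull (closed_nbhd (boundary_spt T) \<epsilon>)
     in is_cycle C \<and>
        current_spt R \<subseteq> K \<and> (current_spt T \<subseteq> K \<longrightarrow> current_spt C \<subseteq> K) \<and>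
        mutually_singular (mass_measure T) (mass_measure R) \<and>
        current_eq T (current_restrict C B) \<and>
        current_eq R (current_restrict C (- B)) \<and>
        mass C \<le> mass T + KR_norm (current_boundary T) + \<epsilon>)"
proof -
  define S where "S = boundary_spt T"
  define A where "A = closed_nbhd S (\<epsilon> / 2)"
  define K where "K = convex hull (closed_nbhd S \<epsilon>)"
  \<comment> \<open>For empty \<open>S\<close> the hull is empty and \<open>infdist\<close> to it is
    0, so the second formula would give the whole space.\<close>
  define K1 where "K1 = (if S = {} then {} else {z. infdist z (convex hull A) \<le> \<epsilon> / 4})"
  define N where "N = KR_norm (current_boundary T)"
  define m where "m = (\<lambda>f. - T (\<lambda>_. 1) f)"
  define \<mu> where "\<mu> = mass_measure T"
  have Tm: "mass_bound T \<mu>" unfolding \<mu>_def by (rule mass_measure_bound[OF T])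
  interpret \<mu>: finite_measure \<mu> by (rule mass_boundD_finite[OF Tm])
  note sm = mass_boundD_sets[OF Tm]
  have m: "KR_functional A N m"
    unfolding A_def N_def S_def m_def using eps by (intro boundary_KR_functional[OF T]) simp
  have K1: "closed K1"
    unfolding K1_def by (auto intro!: closed_Collect_le continuous_intros)
  have K1K: "K1 \<subseteq> K"
    using hull_nbhd_subset[OF _ eps, of S] by (auto simp: K1_def K_def A_def)
  have "fillable \<mu> K1 m (N + \<epsilon>)"
  proof (cases "S = {}")
    case True
    have m0: "m f = 0" if "f \<in> Lip" for f
      by (rule KR_const[OF m that, of 0]) (simp add: A_def closed_nbhd_def True)
    have "fillable \<mu> K1 m 0"
    proof (rule fillable_sums[OF sm K1 fillable_zero sums_zero])
      show "(\<lambda>k. 0) sums m f" if "f \<in> Lip" for f unfolding m0[OF that] by (rule sums_zero)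
    qed
    moreover have "0 \<le> N + \<epsilon>" using KR_nonneg[OF m] eps by simp
    ultimately show ?thesis by (rule fillable_mono)
  next
    \<comment> \<open>\<open>fillable_KR\<close> exceeds \<open>N\<close> by six times its
      parameter, hence \<open>\<epsilon> / 6\<close>.\<close>
    case False
    then show ?thesis
      using fillable_KR[OF dim \<mu>.finite_measure_axioms sm m, of "\<epsilon> / 6" "\<epsilon> / 4"] eps by (simp add: K1_def)
  qed
  then obtain R \<nu> Z where R: "metric_current R" "mass_bound R \<nu>" "\<forall>f\<in>Lip. R (\<lambda>_. 1) f = m f"
    "emeasure \<nu> UNIV \<le> ennreal (N + \<epsilon>)" "Z \<in> sets borel" "emeasure \<mu> Z = 0" "emeasure \<nu> (- Z) = 0"
    "emeasure \<nu> (- K1) = 0"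
    unfolding fillable_def by blast
  define C where "C = (\<lambda>f p. T f p + R f p)"
  obtain \<kappa> where \<kappa>: "metric_current C" "mass_bound C \<kappa>"
    "\<And>X. X \<in> sets borel \<Longrightarrow> emeasure \<kappa> X = emeasure \<mu> X + emeasure \<nu> X"
    using current_add[OF T Tm R(1,2)] unfolding C_def by blast
  have \<kappa>le: "emeasure \<mu> X \<le> emeasure \<kappa> X" "emeasure \<nu> X \<le> emeasure \<kappa> X" if "X \<in> sets borel" for X
    unfolding \<kappa>(3)[OF that] by (auto intro: add_increasing add_increasing2)
  have CR: "(\<lambda>f p. C f p - T f p) = R" by (simp add: C_def)
  have "is_cycle C"
    using R(3) by (simp add: is_cycle_def current_boundary_def C_def m_def)
  moreover have "current_spt R \<subseteq> K"
    using current_spt_subset[OF R(1,2) K1 R(8)] K1K by blast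
  \<comment> \<open>\<open>K\<close> need not be closed, so the neighbourhood of \<open>x\<close> on
    which both measures vanish is cut out by the closed set \<open>K1\<close> instead.\<close>
  moreover have "current_spt C \<subseteq> K" if TK: "current_spt T \<subseteq> K"
  proof
    fix x assume x: "x \<in> current_spt C"
    show "x \<in> K"
    proof (rule ccontr)
      assume xK: "x \<notin> K"
      then have "x \<notin> current_spt T" using TK by blast
      then obtain U where U: "open U" "x \<in> U" "emeasure \<mu> U = 0"
        unfolding current_spt_def measure_spt_def \<mu>_def by (auto simp: zero_less_iff_neq_zero)
      define V where "V = U \<inter> - K1"
      have V: "open V" "x \<in> V" using U K1 K1K xK by (auto simp: V_def open_Compl)
      have "emeasure \<mu> V \<le> emeasure \<mu> U"
        using U(1) sm by (intro emeasure_mono) (auto simp: V_def)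
      moreover have "emeasure \<nu> V \<le> emeasure \<nu> (- K1)"
        using K1 mass_boundD_sets[OF R(2)] by (intro emeasure_mono) (auto simp: V_def)
      ultimately have "emeasure \<kappa> V = 0" using V(1) U(3) R(8) by (simp add: \<kappa>(3))
      then have "emeasure (mass_measure C) V = 0"
        using mass_measure_le[OF \<kappa>(1,2), of V] V(1) by simp
      moreover have "emeasure (mass_measure C) V > 0"
        using x V by (auto simp: current_spt_def measure_spt_def)
      ultimately show False by simp
    qed
  qed
  moreover have "mutually_singular (mass_measure T) (mass_measure R)"
    unfolding mutually_singular_def
  proof (intro bexI conjI)
    show "emeasure (mass_measure T) Z = 0" using R(6) by (simp add: \<mu>_def)
    show "emeasure (mass_measure R) (- Z) = 0"
      using mass_measure_le[OF R(1,2), of "- Z"] R(5,7) borel_comp[OF R(5)] by simp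
  qed (rule R(5))
  \<comment> \<open>The Borel set of the theorem is the complement of the carrier \<open>Z\<close>
    of \<open>R\<close>, which \<mu> does not charge.\<close>
  moreover have "current_eq T (current_restrict C (- Z))"
    unfolding C_def
    by (rule current_restrict_eq[OF _ T Tm R(2) borel_comp[OF R(5)] _ R(7)])
      (use \<kappa>(1,2) \<kappa>le R(6) in \<open>simp_all add: C_def\<close>)
  moreover have "current_eq R (current_restrict C (- (- Z)))"
  proof -
    have C': "C = (\<lambda>f p. R f p + T f p)" by (simp add: C_def add.commute)
    show ?thesis
      unfolding C' double_complement
      by (rule current_restrict_eq[OF _ R(1,2) Tm R(5,7,6)]) (use \<kappa>(1,2) \<kappa>le in \<open>simp_all add: C'\<close>)
  qed
  moreover have "mass C \<le> mass T + N + \<epsilon>"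
  proof -
    have NE: "0 \<le> N + \<epsilon>" using KR_nonneg[OF m] eps by simp
    have "emeasure (mass_measure C) UNIV \<le> emeasure \<kappa> UNIV"
      by (rule mass_measure_le[OF \<kappa>(1,2)]) simp
    also have "\<dots> = emeasure \<mu> UNIV + emeasure \<nu> UNIV" by (rule \<kappa>(3)) simp
    also have "\<dots> \<le> ennreal (measure \<mu> UNIV) + ennreal (N + \<epsilon>)"
      using R(4) by (intro add_mono) (simp_all add: \<mu>.emeasure_eq_measure)
    also have "\<dots> = ennreal (measure \<mu> UNIV + (N + \<epsilon>))" using NE by simp
    finally have "ennreal (measure (mass_measure C) UNIV) \<le> ennreal (measure \<mu> UNIV + (N + \<epsilon>))"
      using finite_measure.emeasure_eq_measure[OF mass_boundD_finite[OF mass_measure_bound[OF \<kappa>(1)]], of UNIV]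
      by simp
    then have "measure (mass_measure C) UNIV \<le> measure \<mu> UNIV + (N + \<epsilon>)"
      using NE by (subst (asm) ennreal_le_iff) auto
    then show ?thesis by (simp add: mass_def \<mu>_def)
  qed
  ultimately have "is_cycle C \<and> current_spt R \<subseteq> K \<and> (current_spt T \<subseteq> K \<longrightarrow> current_spt C \<subseteq> K) \<and>
      mutually_singular (mass_measure T) (mass_measure R) \<and> current_eq T (current_restrict C (- Z)) \<and>
      current_eq R (current_restrict C (- (- Z))) \<and> mass C \<le> mass T + KR_norm (current_boundary T) + \<epsilon>"
    unfolding N_def by blast
  from this[unfolded K_def S_def] \<kappa>(1) borel_comp[OF R(5)] show ?thesis
    unfolding Let_def by (intro exI[of _ C] exI[of _ "- Z"]) (unfold CR, blast)
qed

end
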